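(* Let $r\in(0,\infty)$, $s\in(0,\infty]$ with $r<s$, and let $p:\mathbf{R}^d\to(r,s)$ be a measurable function such that $r<\operatorname{ess\,inf}p\leq\operatorname{ess\,sup}p<s$ and $p_{r,s}(\cdot)\in LH_0\cap LH_\infty$. Let $v$ be a weight with $v\in A_{p(\cdot),(r,s)}$ and let $X=L^{p(\cdot)}_v(\mathbf{R}^d)$. Then \[ M:X_{r,s}\to X_{r,s},\qquad M:(X_{r,s})'\to(X_{r,s})' \] are bounded.
   Context: Conventions: $\frac1\infty=0$. A weight is a measurable function with $0<v<\infty$ a.e. $Q$ runs over cubes in $\mathbf{R}^d$ with sides parallel to the axes; $Mf=\sup_Q\big(\frac1{|Q|}\int_Q|f|\big)\mathbf{1}_Q$. For measurable $p:\mathbf{R}^d\to(0,\infty]$ with $\Omega_\infty=\{p=\infty\}$, $L^{p(\cdot)}_v$ has quasi-norm $\|f\|_{L^{p(\cdot)}_v}=\inf\{\lambda>0:\int_{\mathbf{R}^d\setminus\Omega_\infty}(|f(x)|v(x)/\lambda)^{p(x)}dx+\|fv\|_{L^\infty(\Omega_\infty)}\le1\}$; $L^{p(\cdot)}$ is the case $v=1$. The exponent $p_{r,s}(\cdot)$ is defined by $\frac1{p_{r,s}(x)}=\frac{\frac1{p(x)}-\frac1s}{\frac1r-\frac1s}$. $v\in A_{p(\cdot),(r,s)}$ iff $\sup_Q|Q|^{-(\frac1r-\frac1s)}\|v\mathbf{1}_Q\|_{L^{\frac1{\frac1{p(\cdot)}-\frac1s}}}\|v^{-1}\mathbf{1}_Q\|_{L^{\frac1{\frac1r-\frac1{p(\cdot)}}}}<\infty$.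 For bounded measurable $u:\mathbf{R}^d\to[1,\infty)$: $u\in LH_0$ iff there is $C>0$ with $|\frac1{u(x)}-\frac1{u(y)}|\le\frac{C}{-\log|x-y|}$ for a.e. $x,y$ with $|x-y|<\frac12$; $u\in LH_\infty$ iff there are $C>0$, $u_\infty\in[1,\infty)$ with $|\frac1{u(x)}-\frac1{u_\infty}|\le\frac{C}{\log(e+|x|)}$ for a.e. $x$. For a quasi-Banach function space $X$ (a quasi-normed space of measurable functions with the ideal, Fatou and saturation properties): $X'=\{g\in L^0: fg\in L^1\ \forall f\in X\}$ with $\|g\|_{X'}=\sup_{\|f\|_X=1}\|fg\|_{L^1}$; for $t\in(0,\infty)$, $X^t=\{f:|f|^{1/t}\in X\}$ with $\|f\|_{X^t}=\||f|^{1/t}\|_X^t$; $X_{r,s}=\big[[(X^r)']^{(s/r)'}\big]'$, where $(s/r)'=\frac1{1-r/s}$. *)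

theory Defs
  imports "HOL-Analysis.Analysis" "HOL-Probability.Essential_Supremum"
begin

text \<open>
  Euclidean space is an arbitrary type of class \<^class>\<open>euclidean_space\<close>, and measurable means Lebesgue
  measurable.  Exponents are \<^typ>\<open>ennreal\<close>-valued, so that inverse of infinity is 0 and inverse of 0
  is infinity.
\<close>

section \<open>Cubes, the maximal operator, weights\<close>

definition cubes :: "'a::euclidean_space set set" where
  "cubes = {cbox a (a + l *\<^sub>R One) | a l. 0 < l}"

definition maximal :: "('a::euclidean_space \<Rightarrow> real) \<Rightarrow> 'a \<Rightarrow> ennreal" where
  "maximal f x = (SUP Q\<in>cubes.
     ((\<integral>\<^sup>+y\<in>Q. ennreal \<bar>f y\<bar> \<partial>lebesgue) / emeasure lebesgue Q) * indicator Q x)"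

definition weight :: "('a::euclidean_space \<Rightarrow> real) \<Rightarrow> bool" where
  "weight v \<longleftrightarrow> v \<in> borel_measurable lebesgue \<and> (AE x in lebesgue. 0 < v x)"

text \<open>Dual to \<^const>\<open>esssup\<close>.\<close>

definition essinf :: "'a measure \<Rightarrow> ('a \<Rightarrow> ennreal) \<Rightarrow> ennreal" where
  "essinf M f = (if f \<in> borel_measurable M then Liminf (ae_filter M) f else bot)"

section \<open>Function spaces\<close>

text \<open>
  The norm is extended-valued and defined on all functions; membership is recorded separately, so
  that the Koethe dual can be defined by its membership condition and not by finiteness of a norm.
\<close>

record 'a fun_space =
  members :: "('a \<Rightarrow> real) set"
  qnorm :: "('a \<Rightarrow> real) \<Rightarrow> ennreal"

text \<open>
  Both parts of the modular are evaluated at \<open>f / l\<close>, which is what makes the quasi-norm homogeneous.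
\<close>

definition vLp_modular ::
  "('a::euclidean_space \<Rightarrow> ennreal) \<Rightarrow> ('a \<Rightarrow> real) \<Rightarrow> ('a \<Rightarrow> real) \<Rightarrow> ennreal" where
  "vLp_modular p v f =
     (\<integral>\<^sup>+x\<in>{x. p x \<noteq> \<infinity>}. ennreal ((\<bar>f x\<bar> * v x) powr enn2real (p x)) \<partial>lebesgue)
     + esssup lebesgue (\<lambda>x. ennreal (\<bar>f x\<bar> * v x) * indicator {x. p x = \<infinity>} x)"

definition vLp_norm ::
  "('a::euclidean_space \<Rightarrow> ennreal) \<Rightarrow> ('a \<Rightarrow> real) \<Rightarrow> ('a \<Rightarrow> real) \<Rightarrow> ennreal" where
  "vLp_norm p v f = (INF l\<in>{l::real. 0 < l \<and> vLp_modular p v (\<lambda>x. f x / l) \<le> 1}. ennreal l)"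

definition vLp :: "('a::euclidean_space \<Rightarrow> ennreal) \<Rightarrow> ('a \<Rightarrow> real) \<Rightarrow> 'a fun_space" where
  "vLp p v = \<lparr>members = {f \<in> borel_measurable lebesgue. vLp_norm p v f < \<infinity>},
               qnorm = vLp_norm p v\<rparr>"

definition koethe_dual :: "'a::euclidean_space fun_space \<Rightarrow> 'a fun_space" where
  "koethe_dual X = \<lparr>
     members = {g \<in> borel_measurable lebesgue. \<forall>f\<in>members X. integrable lebesgue (\<lambda>x. f x * g x)},
     qnorm = (\<lambda>g. SUP f\<in>{f \<in> members X. qnorm X f = 1}. \<integral>\<^sup>+x. ennreal \<bar>f x * g x\<bar> \<partial>lebesgue)\<rparr>"

definition ennpowr :: "ennreal \<Rightarrow> real \<Rightarrow> ennreal" where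
  "ennpowr a t = (if a = \<infinity> then \<infinity> else ennreal (enn2real a powr t))"

definition space_power :: "'a::euclidean_space fun_space \<Rightarrow> real \<Rightarrow> 'a fun_space" where
  "space_power X t = \<lparr>
     members = {f \<in> borel_measurable lebesgue. (\<lambda>x. \<bar>f x\<bar> powr (1 / t)) \<in> members X},
     qnorm = (\<lambda>f. ennpowr (qnorm X (\<lambda>x. \<bar>f x\<bar> powr (1 / t))) t)\<rparr>"

text \<open>The real number \<open>1/s\<close>, equal to 0 for infinite \<open>s\<close>.\<close>

definition recip :: "ennreal \<Rightarrow> real" where
  "recip s = enn2real (inverse s)"

text \<open>The exponent \<open>1 / (1 - r/s)\<close> is the Hoelder conjugate of \<open>s/r\<close>.\<close>

definition rs_space :: "real \<Rightarrow> ennreal \<Rightarrow> 'a::euclidean_space fun_space \<Rightarrow> 'a fun_space" where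
  "rs_space r s X =
     koethe_dual (space_power (koethe_dual (space_power X r)) (1 / (1 - r * recip s)))"

text \<open>
  The maximal function is extended-valued; membership in the target space includes that it is
  finite almost everywhere.
\<close>

definition maximal_bounded_on :: "'a::euclidean_space fun_space \<Rightarrow> bool" where
  "maximal_bounded_on X \<longleftrightarrow> (\<exists>C::real. \<forall>f\<in>members X.
     (AE x in lebesgue. maximal f x < \<infinity>) \<and>
     (\<lambda>x. enn2real (maximal f x)) \<in> members X \<and>
     qnorm X (\<lambda>x. enn2real (maximal f x)) \<le> ennreal C * qnorm X f)"

section \<open>Conditions on exponents and weights\<close>

definition rs_exponent ::
  "real \<Rightarrow> ennreal \<Rightarrow> ('a::euclidean_space \<Rightarrow> ennreal) \<Rightarrow> 'a \<Rightarrow> ennreal" where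
  "rs_exponent r s p x =
     inverse ((inverse (p x) - inverse s) / (inverse (ennreal r) - inverse s))"

definition muckenhoupt_rs ::
  "('a::euclidean_space \<Rightarrow> ennreal) \<Rightarrow> real \<Rightarrow> ennreal \<Rightarrow> ('a \<Rightarrow> real) set" where
  "muckenhoupt_rs p r s = {v. (SUP Q\<in>cubes.
     ennreal (measure lebesgue Q powr (- (1 / r - recip s)))
     * vLp_norm (\<lambda>x. inverse (inverse (p x) - inverse s)) (\<lambda>_. 1) (\<lambda>x. v x * indicator Q x)
     * vLp_norm (\<lambda>x. inverse (inverse (ennreal r) - inverse (p x))) (\<lambda>_. 1)
         (\<lambda>x. inverse (v x) * indicator Q x)) < \<infinity>}"

text \<open>Bounded is understood up to null sets, as for elements of \<open>L\<^sup>\<infinity>\<close>.\<close>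

definition bounded_exponent :: "('a::euclidean_space \<Rightarrow> real) \<Rightarrow> bool" where
  "bounded_exponent u \<longleftrightarrow> u \<in> borel_measurable lebesgue \<and> (\<forall>x. 1 \<le> u x)
     \<and> (\<exists>B. AE x in lebesgue. u x \<le> B)"

definition LH0 :: "('a::euclidean_space \<Rightarrow> real) set" where
  "LH0 = {u. bounded_exponent u \<and> (\<exists>C>0. AE x in lebesgue. AE y in lebesgue.
     norm (x - y) < 1 / 2 \<longrightarrow> \<bar>1 / u x - 1 / u y\<bar> \<le> C / (- ln (norm (x - y))))}"

definition LH_inf :: "('a::euclidean_space \<Rightarrow> real) set" where
  "LH_inf = {u. bounded_exponent u \<and> (\<exists>C>0. \<exists>u_inf\<ge>1. AE x in lebesgue.
     \<bar>1 / u x - 1 / u_inf\<bar> \<le> C / ln (exp 1 + norm x))}"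

end

theory Submission
  imports Defs
begin

text \<open>
  Up to equivalence of norms, \<open>X\<^sub>r\<^sub>,\<^sub>s\<close> is \<open>L\<^sup>q\<^sub>w\<close> with \<open>q = p\<^sub>r\<^sub>,\<^sub>s\<close> and \<open>w = v\<^sup>1\<^sup>/\<^sup>\<delta>\<close>, \<open>\<delta> = 1/r - 1/s\<close>, and its
  Koethe dual is the space with conjugate exponent and weight \<open>1/w\<close>. The hypothesis on \<open>v\<close> becomes the
  variable Muckenhoupt condition for \<open>w\<close>, which is symmetric under this duality, so both claims reduce
  to one weighted bound for \<open>M\<close>.

  That bound follows an argument of Lerner for constant exponents, which needs neither reverse
  Hoelder inequalities nor sparse families. Put \<open>W = w\<^sup>q\<close>, \<open>\<sigma> = w\<^sup>-\<^sup>q\<^sup>'\<close>, \<open>f = g \<sigma>\<close>, and let \<open>M\<^sub>\<mu>\<close> average over a cube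
  \<open>Q\<close> with respect to \<open>\<mu>\<close>, divided by \<open>\<mu>(3Q)\<close>. The Muckenhoupt condition yields the pointwise estimate
  \<open>(M f)\<^sup>q\<^sup>-\<^sup>1 \<le> C M\<^sub>W ((M\<^sub>\<sigma> g)\<^sup>q\<^sup>-\<^sup>1 / W) + error\<close>, and \<open>M\<^sub>\<sigma>\<close>, \<open>M\<^sub>W\<close> are bounded on \<open>L\<^sup>q(\<sigma>)\<close>, \<open>L\<^sup>q\<^sup>'(W)\<close>. The latter holds for
  log-Hoelder exponents and every measure that is polynomially bounded below on cubes and of
  polynomial growth. Decay at infinity costs error terms of the form \<open>(e + |x|)\<^sup>-\<^sup>m\<close>, which are
  integrable for large \<open>m\<close>.

  Taking averages over finite families of cubes only, with bounds uniform in the family, keeps all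
  maximal functions real-valued and their measurability trivial; \<open>M\<close> itself is recovered by monotone
  convergence over a countable family.
\<close>

section \<open>Cubes and weighted maximal operators\<close>

text \<open>For a constant exponent \<open>p\<close> and a cube \<open>Q\<close>, let
  \<open>A\<close> be the integral of \<open>f\<close> over \<open>Q\<close> divided by
  \<open>|3Q|\<close>. The Muckenhoupt condition bounds \<open>A^(p-1) W(3Q)\<close> by a constant
  times \<open>|Q| (A |3Q| / \<sigma>(3Q))^(p-1)\<close>, and the base of the last power is an
  average of \<open>g\<close>, hence at most the maximal function of \<open>g\<close> at every point
  of \<open>Q\<close>. With a variable exponent, the power at \<open>x\<close> has to be traded for
  powers at the points \<open>y\<close> of \<open>Q\<close>, for bases that can be very large or
  very small. The trade costs a bounded factor when the oscillation of \<open>q\<close> times the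
  logarithm of the base is bounded. So the work lies in two-sided polynomial bounds, in the radius
  and the distance from the origin, for all bases that occur: norms of the weights on cubes,
  measures of cubes, averages. Very small averages escape the lower bound, and these are what the
  tail absorbs. On large cubes \<open>q\<close> is compared with its limit at infinity; this fails
  near the origin, so the part of \<open>Q\<close> there is discarded, half of the measure of
  \<open>Q\<close> being enough.\<close>

definition cube :: "'a::euclidean_space \<Rightarrow> real \<Rightarrow> 'a set" where
  "cube c r = cbox (c - r *\<^sub>R One) (c + r *\<^sub>R One)"

text \<open>Cubes are closed balls of the maximum norm with the radius as second argument, so
  tripling keeps the centre and inclusions are coordinatewise triangle inequalities; a negative
  radius gives the empty set.\<close>

lemma mem_cube: "x \<in> cube c r \<longleftrightarrow> (\<forall>i\<in>Basis. \<bar>x \<bullet> i - c \<bullet> i\<bar> \<le> r)"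
  unfolding cube_def mem_box by (auto simp: inner_diff_left inner_add_left abs_le_iff algebra_simps)

lemma cube_sets [measurable, simp]: "cube c r \<in> sets lebesgue"
  by (simp add: cube_def)

lemma cube_mono: "r \<le> r' \<Longrightarrow> cube c r \<subseteq> cube c r'"
  by (auto simp: subset_eq mem_cube intro: order_trans[where y = r])

lemma cube_center: "0 \<le> r \<Longrightarrow> c \<in> cube c r"
  by (simp add: mem_cube)

lemma emeasure_cube:
  fixes c :: "'a::euclidean_space"
  assumes "0 \<le> r" shows "emeasure lebesgue (cube c r) = ennreal ((2 * r) ^ DIM('a))"
proof -
  have "emeasure lebesgue (cube c r) = emeasure lborel (cube c r)"
    by (simp add: cube_def)
  also have "\<dots> = ennreal (\<Prod>b\<in>(Basis::'a set). 2 * r)"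
    unfolding cube_def using assms
    by (subst emeasure_lborel_cbox)
      (auto simp: inner_diff_left inner_add_left algebra_simps simp del: prod_constant intro!: arg_cong[where f = ennreal] prod.cong)
  finally show ?thesis by simp
qed

lemma measure_cube:
  fixes c :: "'a::euclidean_space"
  assumes "0 \<le> r" shows "measure lebesgue (cube c r) = (2 * r) ^ DIM('a)"
  using emeasure_cube[OF assms, of c] assms by (simp add: measure_def)

lemma norm_le_of_coords:
  fixes x :: "'a::euclidean_space" and r :: real
  assumes "\<And>i. i \<in> Basis \<Longrightarrow> \<bar>x \<bullet> i\<bar> \<le> r"
  shows "norm x \<le> DIM('a) * r"
proof -
  have "norm x \<le> (\<Sum>b\<in>Basis. \<bar>x \<bullet> b\<bar>)" by (rule norm_le_l1)
  also have "\<dots> \<le> (\<Sum>b\<in>(Basis::'a set). r)" by (intro sum_mono assms)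
  finally show ?thesis by simp
qed

lemma norm_diff_cube:
  fixes x :: "'a::euclidean_space" and r :: real
  assumes "x \<in> cube c r" "y \<in> cube c r"
  shows "norm (x - y) \<le> 2 * DIM('a) * r"
proof -
  have "\<bar>(x - y) \<bullet> i\<bar> \<le> 2 * r" if "i \<in> Basis" for i
    using assms that unfolding mem_cube inner_diff_left by (auto simp: abs_le_iff dest!: bspec)
  from norm_le_of_coords[OF this] show ?thesis by simp
qed

lemma cube_subset_triple:
  assumes "cube c r \<inter> cube c' r' \<noteq> {}" "r' \<le> r"
  shows "cube c' r' \<subseteq> cube c (3 * r)"
proof
  fix y assume y: "y \<in> cube c' r'"
  obtain z where z: "z \<in> cube c r" "z \<in> cube c' r'" using assms by blast
  show "y \<in> cube c (3 * r)" unfolding mem_cube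
  proof
    fix i :: 'a assume "i \<in> Basis"
    then have "\<bar>y \<bullet> i - c' \<bullet> i\<bar> \<le> r'" "\<bar>z \<bullet> i - c' \<bullet> i\<bar> \<le> r'" "\<bar>z \<bullet> i - c \<bullet> i\<bar> \<le> r"
      using y z unfolding mem_cube by auto
    then show "\<bar>y \<bullet> i - c \<bullet> i\<bar> \<le> 3 * r" using assms(2) by linarith
  qed
qed

text \<open>Greedy selection: the triple of a cube of largest radius contains every cube that meets
  it, and the induction continues with the cubes disjoint from it. In a finite family the largest
  radius is attained, so the factor is exactly 3.\<close>

lemma finite_Vitali_cubes:
  fixes F :: "('a::euclidean_space \<times> real) set"
  assumes "finite F" "\<And>c r. (c, r) \<in> F \<Longrightarrow> 0 < r"
  shows "\<exists>G\<subseteq>F. disjoint_family_on (\<lambda>(c, r). cube c r) G \<and>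
    (\<Union>(c, r)\<in>F. cube c r) \<subseteq> (\<Union>(c, r)\<in>G. cube c (3 * r))"
  using assms
proof (induction "card F" arbitrary: F rule: less_induct)
  case less
  show ?case
  proof (cases "F = {}")
    case True then show ?thesis by (auto simp: disjoint_family_on_def)
  next
    case False
    then have "finite (snd ` F)" "snd ` F \<noteq> {}" using less by auto
    from Max_in[OF this] obtain c0 r0 where m: "(c0, r0) \<in> F" "r0 = Max (snd ` F)"
      by (metis imageE prod.collapse)
    have r0: "r \<le> r0" if "(c, r) \<in> F" for c r
      unfolding m(2) using that less by (intro Max_ge) (auto simp: rev_image_eqI)
    define F' where "F' = {(c, r) \<in> F. cube c0 r0 \<inter> cube c r = {}}"
    have "cube c0 r0 \<noteq> {}" using less(3)[OF m(1)] cube_center[of r0 c0] by auto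
    then have "(c0, r0) \<notin> F'" by (auto simp: F'_def)
    moreover have sub: "F' \<subseteq> F" by (auto simp: F'_def)
    ultimately have "card F' < card F" using m(1) less by (intro psubset_card_mono) auto
    then obtain G where G: "G \<subseteq> F'" "disjoint_family_on (\<lambda>(c, r). cube c r) G"
        "(\<Union>(c, r)\<in>F'. cube c r) \<subseteq> (\<Union>(c, r)\<in>G. cube c (3 * r))"
      using less(1)[of F'] sub less(2,3) by (meson finite_subset subsetD)
    have "disjoint_family_on (\<lambda>(c, r). cube c r) (insert (c0, r0) G)"
      using G(1,2) unfolding disjoint_family_on_def F'_def by fastforce
    moreover have "cube c r \<subseteq> (\<Union>(c, r)\<in>insert (c0, r0) G. cube c (3 * r))" if "(c, r) \<in> F" for c r
    proof (cases "(c, r) \<in> F'")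
      case True then show ?thesis using G(3) by blast
    next
      case False
      then have "cube c r \<subseteq> cube c0 (3 * r0)"
        using that r0[OF that] by (intro cube_subset_triple) (auto simp: F'_def)
      then show ?thesis by auto
    qed
    ultimately show ?thesis using G(1) sub m(1)
      by (intro exI[of _ "insert (c0, r0) G"]) (auto; blast)
  qed
qed

text \<open>Dividing by the measure of the tripled cube makes the maximal operators below bounded for
  measures that need not be doubling.\<close>

definition avg :: "'a::euclidean_space measure \<Rightarrow> ('a \<Rightarrow> real) \<Rightarrow> 'a \<Rightarrow> real \<Rightarrow> real" where
  "avg M g c r = enn2real (\<integral>\<^sup>+y\<in>cube c r. ennreal (g y) \<partial>M) / measure M (cube c (3 * r))"

text \<open>The inserted 0 gives a value for the empty family. An infinite integral makes
  \<open>avg\<close> equal to 0 through \<open>enn2real\<close>: lower bounds on integrals by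
  \<open>avg\<close> are then trivial, but estimates with an average on the right-hand side have to
  secure a finite integral.\<close>

definition maxop :: "'a::euclidean_space measure \<Rightarrow> ('a \<times> real) set \<Rightarrow> ('a \<Rightarrow> real) \<Rightarrow> 'a \<Rightarrow> real" where
  "maxop M F g x = Max (insert 0 ((\<lambda>(c, r). avg M g c r * indicator (cube c r) x) ` F))"

lemma avg_nonneg: "0 \<le> avg M g c r"
  by (simp add: avg_def)

lemma maxop_nonneg: "finite F \<Longrightarrow> 0 \<le> maxop M F g x"
  unfolding maxop_def by (rule Max_ge) auto

lemma avg_le_maxop:
  assumes "finite F" "(c, r) \<in> F" "x \<in> cube c r"
  shows "avg M g c r \<le> maxop M F g x"
  unfolding maxop_def using assms by (intro Max_ge) (auto intro!: rev_image_eqI[of "(c,r)"])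

lemma maxop_cases:
  assumes "finite F"
  obtains "maxop M F g x = 0"
  | c r where "(c, r) \<in> F" "x \<in> cube c r" "maxop M F g x = avg M g c r"
proof -
  have "maxop M F g x \<in> insert 0 ((\<lambda>(c, r). avg M g c r * indicator (cube c r) x) ` F)"
    unfolding maxop_def using assms by (intro Max_in) auto
  then consider "maxop M F g x = 0" | c r where "(c, r) \<in> F" "maxop M F g x = avg M g c r * indicator (cube c r) x"
    by auto
  then show thesis
  proof cases
    case (2 c r)
    then show ?thesis using that by (cases "x \<in> cube c r") auto
  qed (use that in auto)
qed

lemma borel_measurable_maxop [measurable]:
  assumes "finite F" and [measurable_cong]: "sets M = sets lebesgue"
  shows "maxop M F g \<in> borel_measurable M"
proof -
  \<comment> \<open>The measurability rule for maxima wants an index set that does not depend on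
    \<open>x\<close>; \<open>None\<close> carries the value 0.\<close>
  have eq: "maxop M F g = (\<lambda>x. Max ((\<lambda>i. case i of None \<Rightarrow> 0 | Some (c, r) \<Rightarrow>
      avg M g c r * indicator (cube c r) x) ` (insert None (Some ` F))))"
    unfolding maxop_def by (intro ext arg_cong[where f = Max]) (auto simp: image_image)
  have [measurable]: "cube c r \<in> sets M" for c r using assms(2) by simp
  show ?thesis unfolding eq using assms(1)
    by (intro borel_measurable_Max) (auto split: option.split)
qed

section \<open>Weak and strong type bounds for measures that are positive and finite on
  cubes\<close>

locale cube_measure =
  fixes M :: "'a::euclidean_space measure"
  assumes sets_M [measurable_cong, simp]: "sets M = sets lebesgue"
    and emeasure_cube_pos: "0 < r \<Longrightarrow> 0 < emeasure M (cube c r)"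
    and emeasure_cube_finite: "emeasure M (cube c r) < \<infinity>"
begin

lemma space_M [simp]: "space M = UNIV"
  using sets_eq_imp_space_eq[OF sets_M] by simp

lemma cube_sets_M [measurable, simp]: "cube c r \<in> sets M" by simp

lemma measure_cube_pos: "0 < r \<Longrightarrow> 0 < measure M (cube c r)"
  using emeasure_cube_pos[of r c] emeasure_cube_finite[of c r]
  by (simp add: measure_def enn2real_positive_iff)

lemma emeasure_cube_eq: "emeasure M (cube c r) = ennreal (measure M (cube c r))"
  using emeasure_cube_finite[of c r] by (simp add: emeasure_eq_ennreal_measure)

lemma sigma_finite_M: "sigma_finite_measure M"
proof
  show "\<exists>A. countable A \<and> A \<subseteq> sets M \<and> \<Union>A = space M \<and> (\<forall>a\<in>A. emeasure M a \<noteq> \<infinity>)"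
  proof (intro exI[of _ "range (\<lambda>n::nat. cube 0 (real n))"] conjI)
    have "x \<in> (\<Union>n::nat. cube 0 (real n))" for x :: 'a
    proof -
      obtain n :: nat where "norm x \<le> n" using real_arch_simple by blast
      then have "\<bar>x \<bullet> i\<bar> \<le> n" if "i \<in> Basis" for i using Basis_le_norm[OF that, of x] by linarith
      then show ?thesis by (auto simp: mem_cube)
    qed
    then show "\<Union> (range (\<lambda>n::nat. cube (0::'a) (real n))) = space M" by auto
  qed (use emeasure_cube_finite less_top in auto)
qed

lemma avg_mult_le:
  assumes "0 < r"
  shows "ennreal (avg M g c r) * emeasure M (cube c (3 * r)) \<le> (\<integral>\<^sup>+y\<in>cube c r. ennreal (g y) \<partial>M)"
proof -
  have "0 < measure M (cube c (3 * r))" using measure_cube_pos assms by simp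
  then have "ennreal (avg M g c r) * emeasure M (cube c (3 * r)) = ennreal (enn2real (\<integral>\<^sup>+y\<in>cube c r. ennreal (g y) \<partial>M))"
    unfolding emeasure_cube_eq avg_def by (simp flip: ennreal_mult)
  \<comment> \<open>If the integral is infinite, the left-hand side is 0.\<close>
  also have "\<dots> \<le> (\<integral>\<^sup>+y\<in>cube c r. ennreal (g y) \<partial>M)" by (simp add: ennreal_enn2real_if)
  finally show ?thesis .
qed

text \<open>Restricting the integral to the level set, as in Doob's inequality, gives the strong type bound
  below from Fubini's theorem alone.\<close>

lemma maxop_weak_type:
  assumes F: "finite F" "\<And>c r. (c, r) \<in> F \<Longrightarrow> 0 < r"
    and [measurable]: "g \<in> borel_measurable M" and "0 \<le> t"
  shows "ennreal t * emeasure M {x. t < maxop M F g x}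
    \<le> (\<integral>\<^sup>+y. ennreal (g y) * indicator {x. t < maxop M F g x} y \<partial>M)"
proof -
  \<comment> \<open>The union of these cubes is exactly the level set, and the integral of
    \<open>g\<close> over each is at least \<open>t\<close> times the measure of its triple. The
    triples of a disjoint subfamily cover the level set, so the weak bound has constant 1.\<close>
  define F' where "F' = {(c, r) \<in> F. t < avg M g c r}"
  have F': "finite F'" "\<And>c r. (c, r) \<in> F' \<Longrightarrow> 0 < r" "F' \<subseteq> F"
    using F by (auto simp: F'_def intro: finite_subset[OF _ F(1)])
  obtain G where G: "G \<subseteq> F'" "disjoint_family_on (\<lambda>(c, r). cube c r) G"
      "(\<Union>(c, r)\<in>F'. cube c r) \<subseteq> (\<Union>(c, r)\<in>G. cube c (3 * r))"
    using finite_Vitali_cubes[OF F'(1)] F'(2) by metis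
  have fG: "finite G" using G(1) F'(1) finite_subset by blast
  have level: "{x. t < maxop M F g x} = (\<Union>(c, r)\<in>F'. cube c r)"
  proof (intro equalityI subsetI)
    fix x assume "x \<in> {x. t < maxop M F g x}"
    then show "x \<in> (\<Union>(c, r)\<in>F'. cube c r)"
      using \<open>0 \<le> t\<close> by (cases rule: maxop_cases[OF F(1), of M g x]) (auto simp: F'_def)
  next
    fix x assume "x \<in> (\<Union>(c, r)\<in>F'. cube c r)"
    then obtain c r where "(c, r) \<in> F" "x \<in> cube c r" "t < avg M g c r" by (auto simp: F'_def)
    then show "x \<in> {x. t < maxop M F g x}" using avg_le_maxop[OF F(1), of c r x M g] by simp
  qed
  have "ennreal t * emeasure M {x. t < maxop M F g x} \<le> ennreal t * emeasure M (\<Union>(c, r)\<in>G. cube c (3 * r))"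
    unfolding level using G(3) fG by (intro mult_left_mono emeasure_mono) auto
  also have "\<dots> \<le> ennreal t * (\<Sum>(c, r)\<in>G. emeasure M (cube c (3 * r)))"
    using emeasure_subadditive_finite[OF fG, of "\<lambda>(c, r). cube c (3 * r)" M]
    by (intro mult_left_mono) (auto simp: case_prod_beta image_subset_iff)
  also have "\<dots> = (\<Sum>(c, r)\<in>G. ennreal t * emeasure M (cube c (3 * r)))"
    by (simp add: sum_distrib_left case_prod_beta)
  also have "\<dots> \<le> (\<Sum>(c, r)\<in>G. \<integral>\<^sup>+y\<in>cube c r. ennreal (g y) \<partial>M)"
  proof (intro sum_mono, clarsimp)
    fix c r assume "(c, r) \<in> G"
    then have *: "0 < r" "t < avg M g c r" using G(1) F' by (auto simp: F'_def)
    have "ennreal t * emeasure M (cube c (3 * r)) \<le> ennreal (avg M g c r) * emeasure M (cube c (3 * r))"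
      using * by (intro mult_right_mono ennreal_leI) auto
    also have "\<dots> \<le> (\<integral>\<^sup>+y\<in>cube c r. ennreal (g y) \<partial>M)" by (rule avg_mult_le[OF *(1)])
    finally show "ennreal t * emeasure M (cube c (3 * r)) \<le> (\<integral>\<^sup>+y\<in>cube c r. ennreal (g y) \<partial>M)" .
  qed
  also have "\<dots> = (\<integral>\<^sup>+y. (\<Sum>(c, r)\<in>G. ennreal (g y) * indicator (cube c r) y) \<partial>M)"
    by (subst nn_integral_sum) (auto simp: case_prod_beta)
  \<comment> \<open>Disjointness of \<open>G\<close> turns the sum of the integrals into one
    integral over a subset of the level set.\<close>
  also have "\<dots> \<le> (\<integral>\<^sup>+y. ennreal (g y) * indicator {x. t < maxop M F g x} y \<partial>M)"
  proof (intro nn_integral_mono)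
    fix y
    have "(\<Sum>(c, r)\<in>G. ennreal (g y) * indicator (cube c r) y) = ennreal (g y) * (\<Sum>i\<in>G. indicator ((\<lambda>(c, r). cube c r) i) y)"
      by (simp add: sum_distrib_left case_prod_beta)
    also have "(\<Sum>i\<in>G. indicator ((\<lambda>(c, r). cube c r) i) y :: ennreal) = indicator (\<Union>i\<in>G. (\<lambda>(c, r). cube c r) i) y"
      using G(2) fG by (rule indicator_UN_disjoint[symmetric, rotated])
    also have "(indicator (\<Union>i\<in>G. (\<lambda>(c, r). cube c r) i) y :: ennreal) \<le> indicator {x. t < maxop M F g x} y"
      unfolding level using G(1) by (auto simp: indicator_def)
    finally show "(\<Sum>(c, r)\<in>G. ennreal (g y) * indicator (cube c r) y) \<le> ennreal (g y) * indicator {x. t < maxop M F g x} y"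
      by (simp add: mult_left_mono)
  qed
  finally show ?thesis .
qed

text \<open>Boundedness and bounded support make the integral of \<open>maxop M F g powr p\<close>
  finite a priori, so that half of it can be absorbed in \<open>maxop_strong_type\<close>.\<close>

lemma maxop_bounded:
  assumes "finite F"
  obtains B R where "0 \<le> B" "\<And>x. maxop M F g x \<le> B" "\<And>x. maxop M F g x \<noteq> 0 \<Longrightarrow> x \<in> cube 0 R"
proof -
  define B where "B = (\<Sum>(c, r)\<in>F. avg M g c r)"
  define R where "R = (\<Sum>(c, r)\<in>F. norm c + \<bar>r\<bar>)"
  have "0 \<le> B" unfolding B_def by (intro sum_nonneg) (auto simp: avg_nonneg)
  moreover have "maxop M F g x \<le> B" for x
  proof (cases rule: maxop_cases[OF assms, of M g x])
    case (2 c r)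
    have "avg M g c r \<le> B" unfolding B_def
      using member_le_sum[OF 2(1), of "\<lambda>(c, r). avg M g c r"] assms by (auto simp: avg_nonneg)
    then show ?thesis using 2 by simp
  qed (use \<open>0 \<le> B\<close> in simp)
  moreover have "x \<in> cube 0 R" if "maxop M F g x \<noteq> 0" for x
  proof (cases rule: maxop_cases[OF assms, of M g x])
    case (2 c r)
    have *: "norm c + \<bar>r\<bar> \<le> R" unfolding R_def
      using member_le_sum[OF 2(1), of "\<lambda>(c, r). norm c + \<bar>r\<bar>"] assms by auto
    have "\<bar>x \<bullet> i\<bar> \<le> R" if i: "i \<in> Basis" for i
    proof -
      have "\<bar>x \<bullet> i - c \<bullet> i\<bar> \<le> r" using 2(2) i unfolding mem_cube by blast
      with Basis_le_norm[OF i, of c] * show ?thesis by linarith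
    qed
    then show ?thesis by (simp add: mem_cube)
  qed (use that in simp)
  ultimately show thesis using that by blast
qed

text \<open>The weak bound is multiplied by \<open>p * t powr (p - 2)\<close> and integrated in
  \<open>t\<close>. After the interchange, the inner integral over
  \<open>0 < t < maxop M F g x\<close> is
  \<open>p / (p - 1) * maxop M F g x powr (p - 1)\<close>.\<close>

lemma maxop_strong_type_aux:
  assumes F: "finite F" "\<And>c r. (c, r) \<in> F \<Longrightarrow> 0 < r"
    and [measurable]: "g \<in> borel_measurable M" and g: "\<And>x. 0 \<le> g x" and p: "1 < p"
  shows "(\<integral>\<^sup>+x. ennreal (maxop M F g x powr p) \<partial>M)
    \<le> (\<integral>\<^sup>+x. ennreal (p / (p - 1) * g x * maxop M F g x powr (p - 1)) \<partial>M)"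
proof -
  interpret sigma_finite_measure M by (rule sigma_finite_M)
  interpret P: pair_sigma_finite lborel M
    using sigma_finite_M sigma_finite_lborel by (intro pair_sigma_finite.intro)
  let ?T = "maxop M F g"
  have [measurable]: "?T \<in> borel_measurable M" using F(1) sets_M by (rule borel_measurable_maxop)
  have T0: "0 \<le> ?T x" for x using F(1) by (rule maxop_nonneg)
  \<comment> \<open>Used with \<open>a = p\<close> and \<open>a = p - 1\<close>. The strict
    inequalities fit the level sets of the weak bound and cost only two endpoints.\<close>
  have layer: "ennreal (?T x powr a) = (\<integral>\<^sup>+t. ennreal (a * t powr (a - 1)) * indicator {t. 0 < t \<and> t < ?T x} t \<partial>lborel)"
    if a: "0 < a" for a x
  proof -
    have "((\<lambda>t. t powr (a - 1)) has_integral (?T x powr a / a)) {0..?T x}"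
      using has_integral_powr_from_0[of "a - 1" "?T x"] a T0 by simp
    then have "((\<lambda>t. a * t powr (a - 1)) has_integral ?T x powr a) {0..?T x}"
      using has_integral_mult_right[of "\<lambda>t. t powr (a - 1)" "?T x powr a / a" "{0..?T x}" a] a by simp
    then have "((\<lambda>t. a * t powr (a - 1) * indicator {0..?T x} t) has_integral ?T x powr a) UNIV"
      by (subst (asm) has_integral_restrict_UNIV[symmetric]) (auto elim!: has_integral_eq[rotated] simp: indicator_def)
    then have "(\<integral>\<^sup>+t. ennreal (a * t powr (a - 1) * indicator {0..?T x} t) \<partial>lborel) = ennreal (?T x powr a)"
      using a by (intro nn_integral_has_integral_lborel) auto
    moreover have "(\<integral>\<^sup>+t. ennreal (a * t powr (a - 1) * indicator {0..?T x} t) \<partial>lborel)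
        = (\<integral>\<^sup>+t. ennreal (a * t powr (a - 1)) * indicator {t. 0 < t \<and> t < ?T x} t \<partial>lborel)"
    proof (intro nn_integral_cong_AE)
      have "AE t in lborel. t \<noteq> 0" "AE t in lborel. t \<noteq> ?T x" by (rule AE_lborel_singleton)+
      then show "AE t in lborel. ennreal (a * t powr (a - 1) * indicator {0..?T x} t)
          = ennreal (a * t powr (a - 1)) * indicator {t. 0 < t \<and> t < ?T x} t"
        by eventually_elim (auto simp: indicator_def)
    qed
    ultimately show ?thesis by simp
  qed
  have "(\<integral>\<^sup>+x. ennreal (?T x powr p) \<partial>M)
      = (\<integral>\<^sup>+x. \<integral>\<^sup>+t. ennreal (p * t powr (p - 1)) * indicator {t. 0 < t \<and> t < ?T x} t \<partial>lborel \<partial>M)"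
    using p by (subst layer[of p]) auto
  also have "\<dots> = (\<integral>\<^sup>+t. \<integral>\<^sup>+x. ennreal (p * t powr (p - 1)) * indicator {t. 0 < t \<and> t < ?T x} t \<partial>M \<partial>lborel)"
    by (subst P.Fubini') (auto simp: indicator_def)
  also have "\<dots> \<le> (\<integral>\<^sup>+t. \<integral>\<^sup>+x. ennreal (p * t powr (p - 2) * g x) * indicator {t. 0 < t \<and> t < ?T x} t \<partial>M \<partial>lborel)"
  proof (rule nn_integral_mono)
    fix t :: real
    show "(\<integral>\<^sup>+x. ennreal (p * t powr (p - 1)) * indicator {t. 0 < t \<and> t < ?T x} t \<partial>M)
      \<le> (\<integral>\<^sup>+x. ennreal (p * t powr (p - 2) * g x) * indicator {t. 0 < t \<and> t < ?T x} t \<partial>M)"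
    proof (cases "0 < t")
      case True
      have "(\<integral>\<^sup>+x. ennreal (p * t powr (p - 1)) * indicator {t. 0 < t \<and> t < ?T x} t \<partial>M)
          = (\<integral>\<^sup>+x. ennreal (p * t powr (p - 1)) * indicator {x. t < ?T x} x \<partial>M)"
        using True by (intro nn_integral_cong) (auto simp: indicator_def)
      also have "\<dots> = ennreal (p * t powr (p - 1)) * emeasure M {x. t < ?T x}"
        using measurable_sets[of ?T M borel "{t<..}"]
        by (subst nn_integral_cmult_indicator) (auto simp: vimage_def)
      also have "\<dots> = ennreal (p * t powr (p - 2)) * (ennreal t * emeasure M {x. t < ?T x})"
        using True p powr_add[of t "p - 2" 1] by (simp add: ennreal_mult mult.assoc)
      also have "\<dots> \<le> ennreal (p * t powr (p - 2)) * (\<integral>\<^sup>+x. ennreal (g x) * indicator {x. t < ?T x} x \<partial>M)"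
        using True by (intro mult_left_mono maxop_weak_type F) auto
      also have "\<dots> = (\<integral>\<^sup>+x. ennreal (p * t powr (p - 2)) * (ennreal (g x) * indicator {x. t < ?T x} x) \<partial>M)"
        by (subst nn_integral_cmult) auto
      also have "\<dots> = (\<integral>\<^sup>+x. ennreal (p * t powr (p - 2) * g x) * indicator {t. 0 < t \<and> t < ?T x} t \<partial>M)"
        using True p g by (intro nn_integral_cong) (auto simp: indicator_def ennreal_mult)
      finally show ?thesis .
    qed (simp add: indicator_def)
  qed
  also have "\<dots> = (\<integral>\<^sup>+x. \<integral>\<^sup>+t. ennreal (p * t powr (p - 2) * g x) * indicator {t. 0 < t \<and> t < ?T x} t \<partial>lborel \<partial>M)"
    by (subst P.Fubini') (auto simp: indicator_def)
  also have "\<dots> = (\<integral>\<^sup>+x. ennreal (p / (p - 1) * g x * ?T x powr (p - 1)) \<partial>M)"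
  proof (intro nn_integral_cong)
    fix x
    have "(\<integral>\<^sup>+t. ennreal (p * t powr (p - 2) * g x) * indicator {t. 0 < t \<and> t < ?T x} t \<partial>lborel)
       = (\<integral>\<^sup>+t. ennreal (p / (p - 1) * g x) * (ennreal ((p - 1) * t powr (p - 1 - 1)) * indicator {t. 0 < t \<and> t < ?T x} t) \<partial>lborel)"
      using p g by (intro nn_integral_cong) (auto simp: indicator_def simp flip: ennreal_mult)
    also have "\<dots> = ennreal (p / (p - 1) * g x) * ennreal (?T x powr (p - 1))"
      using p by (subst nn_integral_cmult) (auto simp: layer[of "p - 1"])
    finally show "(\<integral>\<^sup>+t. ennreal (p * t powr (p - 2) * g x) * indicator {t. 0 < t \<and> t < ?T x} t \<partial>lborel)
        = ennreal (p / (p - 1) * g x * ?T x powr (p - 1))"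
      using ennreal_mult''[of "?T x powr (p - 1)" "p / (p - 1) * g x"] by (simp only: powr_ge_zero)
  qed
  finally show ?thesis .
qed

text \<open>Hoelder's inequality is replaced by a pointwise splitting of the right-hand side of
  \<open>maxop_strong_type_aux\<close>: where \<open>g\<close> is small compared with the maximal
  function, the product is at most half of the left-hand integrand; elsewhere it is at most a
  multiple of \<open>g powr p\<close>. The constant depends on \<open>p\<close> alone.\<close>

lemma maxop_strong_type:
  assumes p: "1 < p"
  shows "\<exists>K\<ge>0. \<forall>F g. finite F \<longrightarrow> (\<forall>(c, r)\<in>F. 0 < r) \<longrightarrow> g \<in> borel_measurable M \<longrightarrow> (\<forall>x. 0 \<le> g x) \<longrightarrow>
    (\<integral>\<^sup>+x. ennreal (maxop M F g x powr p) \<partial>M) \<le> ennreal K * (\<integral>\<^sup>+x. ennreal (g x powr p) \<partial>M)"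
proof (intro exI[of _ "2 * (p / (p - 1)) * (2 * p / (p - 1)) powr (p - 1)"] conjI allI impI)
  \<comment> \<open>Chosen so that \<open>p / (p - 1) * g x\<close> is \<open>th * g x / 2\<close>,
    at most half of \<open>?T x\<close> in the first case of \<open>pw\<close>.\<close>
  define th where "th = 2 * p / (p - 1)"
  have th: "0 < th" "p / (p - 1) = th / 2" using p by (auto simp: th_def field_simps)
  fix F :: "('a \<times> real) set" and g :: "'a \<Rightarrow> real"
  assume F: "finite F" "\<forall>(c, r)\<in>F. 0 < r" and [measurable]: "g \<in> borel_measurable M" and g: "\<forall>x. 0 \<le> g x"
  let ?T = "maxop M F g"
  have [measurable]: "?T \<in> borel_measurable M" using F(1) sets_M by (rule borel_measurable_maxop)
  have T0: "0 \<le> ?T x" for x using F(1) by (rule maxop_nonneg)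
  define I where "I = (\<integral>\<^sup>+x. ennreal (?T x powr p) \<partial>M)"
  define J where "J = (\<integral>\<^sup>+x. ennreal (g x powr p) \<partial>M)"
  obtain B R where B: "0 \<le> B" "\<And>x. ?T x \<le> B" "\<And>x. ?T x \<noteq> 0 \<Longrightarrow> x \<in> cube 0 R"
    using maxop_bounded[OF F(1), of g] by blast
  have "I \<le> (\<integral>\<^sup>+x. ennreal (B powr p) * indicator (cube 0 R) x \<partial>M)"
    unfolding I_def using B T0 p by (intro nn_integral_mono) (auto simp: indicator_def intro!: ennreal_leI powr_mono2)
  also have "\<dots> < \<infinity>"
    using emeasure_cube_finite[of 0 R] by (subst nn_integral_cmult_indicator) (auto simp: ennreal_mult_less_top)
  finally have Ifin: "I < \<infinity>" .
  have pw: "th / 2 * g x * ?T x powr (p - 1) \<le> ?T x powr p / 2 + th / 2 * th powr (p - 1) * g x powr p" for x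
  proof (cases "th * g x \<le> ?T x")
    case True
    have "th / 2 * g x * ?T x powr (p - 1) \<le> ?T x / 2 * ?T x powr (p - 1)"
      using True by (intro mult_right_mono) auto
    also have "\<dots> = ?T x powr p / 2" using powr_mult_base[OF T0[of x], of "p - 1"] by simp
    also have "\<dots> \<le> \<dots> + th / 2 * th powr (p - 1) * g x powr p" using th by simp
    finally show ?thesis .
  next
    case False
    then have "th / 2 * g x * ?T x powr (p - 1) \<le> th / 2 * g x * (th * g x) powr (p - 1)"
      using th g T0 p by (intro mult_left_mono powr_mono2) auto
    also have "\<dots> = th / 2 * th powr (p - 1) * g x powr p"
      using th g powr_mult_base[of "g x" "p - 1"] by (simp add: powr_mult)
    finally show ?thesis by (smt (verit) powr_ge_zero divide_nonneg_pos)
  qed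
  have "I \<le> (\<integral>\<^sup>+x. ennreal (th / 2 * g x * ?T x powr (p - 1)) \<partial>M)"
    unfolding I_def using maxop_strong_type_aux[OF F(1), of g p] F(2) g p th(2) by auto
  also have "\<dots> \<le> (\<integral>\<^sup>+x. ennreal (1 / 2) * ennreal (?T x powr p) + ennreal (th / 2 * th powr (p - 1)) * ennreal (g x powr p) \<partial>M)"
  proof (intro nn_integral_mono)
    fix x
    have "ennreal (th / 2 * g x * ?T x powr (p - 1)) \<le> ennreal (1 / 2 * ?T x powr p + th / 2 * th powr (p - 1) * g x powr p)"
      using pw[of x] by (intro ennreal_leI) simp
    also have "\<dots> = ennreal (1 / 2 * ?T x powr p) + ennreal (th / 2 * th powr (p - 1) * g x powr p)"
      using th(1) by (intro ennreal_plus) auto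
    also have "\<dots> = ennreal (1 / 2) * ennreal (?T x powr p) + ennreal (th / 2 * th powr (p - 1)) * ennreal (g x powr p)"
      using th(1) by (intro arg_cong2[where f = "(+)"] ennreal_mult) auto
    finally show "ennreal (th / 2 * g x * ?T x powr (p - 1)) \<le> \<dots>" .
  qed
  also have "\<dots> = ennreal (1 / 2) * I + ennreal (th / 2 * th powr (p - 1)) * J"
    unfolding I_def J_def by (subst nn_integral_add) (auto simp: nn_integral_cmult)
  finally have le: "I \<le> ennreal (1 / 2) * I + ennreal (th / 2 * th powr (p - 1)) * J" .
  have "I \<le> ennreal (th * th powr (p - 1)) * J"
  proof (cases "J = \<infinity>")
    case True then show ?thesis using th by (simp add: ennreal_mult_top)
  next
    case False
    then obtain j where j: "J = ennreal j" "0 \<le> j" by (cases J) auto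
    obtain i where i: "I = ennreal i" "0 \<le> i" using Ifin by (cases I) auto
    have "ennreal (1 / 2) * ennreal i + ennreal (th / 2 * th powr (p - 1)) * ennreal j
        = ennreal (1 / 2 * i + th / 2 * th powr (p - 1) * j)"
      using th(1) i(2) j(2)
      by (subst ennreal_plus; (intro arg_cong2[where f = "(+)"] ennreal_mult[symmetric])?) simp_all
    with le have "ennreal i \<le> ennreal (1 / 2 * i + th / 2 * th powr (p - 1) * j)"
      unfolding i(1) j(1) by (simp only:)
    moreover have "0 \<le> 1 / 2 * i + th / 2 * th powr (p - 1) * j" using th(1) i(2) j(2) by simp
    ultimately have "i \<le> 1 / 2 * i + th / 2 * th powr (p - 1) * j" by (simp only: ennreal_le_iff)
    then show ?thesis using th i j by (simp flip: ennreal_mult)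
  qed
  then show "(\<integral>\<^sup>+x. ennreal (?T x powr p) \<partial>M) \<le> ennreal (2 * (p / (p - 1)) * (2 * p / (p - 1)) powr (p - 1)) * (\<integral>\<^sup>+x. ennreal (g x powr p) \<partial>M)"
    unfolding I_def J_def th_def by simp
qed (use p in auto)

end

section \<open>Log-Hoelder exponents\<close>

lemma add_powr_le:
  fixes a b p :: real
  assumes "0 \<le> a" "0 \<le> b" "0 \<le> p"
  shows "(a + b) powr p \<le> 2 powr p * (a powr p + b powr p)"
proof -
  have "(a + b) powr p \<le> (2 * max a b) powr p" using assms by (intro powr_mono2) auto
  also have "\<dots> = 2 powr p * max a b powr p" using assms by (simp add: powr_mult)
  also have "\<dots> \<le> 2 powr p * (a powr p + b powr p)"
    by (intro mult_left_mono) (auto simp: max_def)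
  finally show ?thesis .
qed

text \<open>The basic exchange of exponents: \<open>a\<close> and \<open>b\<close> are values of
  \<open>q\<close> or nearby constants, \<open>\<bar>ln t\<bar>\<close> is bounded by a logarithmic
  scale, and log-Hoelder continuity then supplies \<open>k\<close>.\<close>

lemma powr_close:
  fixes t a b k :: real
  assumes "0 < t" "\<bar>a - b\<bar> * \<bar>ln t\<bar> \<le> k"
  shows "t powr a \<le> exp k * t powr b"
proof -
  have "(a - b) * ln t \<le> \<bar>(a - b) * ln t\<bar>" by simp
  also have "\<dots> \<le> k" using assms(2) by (simp add: abs_mult)
  finally have "a * ln t \<le> k + b * ln t" by (simp add: algebra_simps)
  then show ?thesis using assms(1) by (simp add: powr_def flip: exp_add)
qed

lemma powr_le_powr_self:
  fixes t a b :: real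
  assumes "0 \<le> t" "t \<le> 1" "a \<le> b" "0 < a" shows "t powr b \<le> t powr a"
proof (cases "t = 0")
  case False then show ?thesis using assms powr_mono'[of a b t] by auto
qed (use assms in auto)

text \<open>The tangent of the convex function \<open>t powr p\<close> at \<open>b\<close>, obtained
  from Young's inequality. Integrated, it gives Jensen's inequality without a division by the total
  mass.\<close>

lemma powr_tangent:
  fixes b g p :: real
  assumes "1 \<le> p" "0 \<le> b" "0 \<le> g"
  shows "p * b powr (p - 1) * g \<le> g powr p + (p - 1) * b powr p"
proof (cases "p = 1")
  case False
  then have p: "1 < p" using assms by simp
  have "g * b powr (p - 1) \<le> g powr p / p + (b powr (p - 1)) powr (p / (p - 1)) / (p / (p - 1))"
    using p assms by (intro Youngs_inequality) (auto simp: field_simps)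
  also have "(b powr (p - 1)) powr (p / (p - 1)) = b powr p" using p by (simp add: powr_powr)
  finally show ?thesis using p by (simp add: field_simps)
qed (use assms in \<open>auto simp: powr_def\<close>)

text \<open>Lower bounds for a cube of radius \<open>r\<close> containing \<open>x\<close> take the
  form \<open>exp (- B * logscale r x)\<close>: they degenerate for small radii and far from the
  origin, and both effects sit in one logarithm.\<close>

definition logscale :: "real \<Rightarrow> 'a::euclidean_space \<Rightarrow> real" where
  "logscale r x = ln (exp 1 + norm x + 1 / r)"

definition logtail :: "'a::euclidean_space \<Rightarrow> real" where
  "logtail x = ln (exp 1 + norm x)"

definition tail :: "real \<Rightarrow> 'a::euclidean_space \<Rightarrow> real" where
  "tail m x = (exp 1 + norm x) powr (- m)"

lemma one_le_exp_1: "1 \<le> exp (1::real)" by simp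

lemma exp_add_norm_pos [simp]: "0 < exp 1 + norm x" by (simp add: add_pos_nonneg)

lemma logtail_ge_1: "1 \<le> logtail x"
  unfolding logtail_def by (subst ln_ge_iff) auto

lemma logtail_le_logscale: "0 < r \<Longrightarrow> logtail x \<le> logscale r x"
  unfolding logtail_def logscale_def by (subst ln_le_cancel_iff) (auto intro: add_pos_nonneg)

lemma logscale_ge_1: "0 < r \<Longrightarrow> 1 \<le> logscale r x"
  using logtail_ge_1[of x] logtail_le_logscale[of r x] by simp

lemma logscale_le:
  assumes "0 < r" shows "logscale r x \<le> logtail x + ln (1 + 1 / r)"
proof -
  have "1 \<le> exp 1 + norm x" using one_le_exp_1 norm_ge_zero[of x] by linarith
  then have "1 * (1 / r) \<le> (exp 1 + norm x) * (1 / r)" using assms by (intro mult_right_mono) auto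
  then have "exp 1 + norm x + 1 / r \<le> (exp 1 + norm x) * (1 + 1 / r)" by (simp add: distrib_left)
  moreover have "0 < exp 1 + norm x + 1 / r" "0 < 1 + 1 / r" using exp_add_norm_pos[of x] assms by (auto intro: add_pos_pos)
  ultimately have "logscale r x \<le> ln ((exp 1 + norm x) * (1 + 1 / r))"
    unfolding logscale_def by (subst ln_le_cancel_iff) (auto intro: mult_pos_pos)
  also have "\<dots> = logtail x + ln (1 + 1 / r)"
    unfolding logtail_def using assms by (intro ln_mult_pos) (auto intro: add_pos_pos)
  finally show ?thesis .
qed

lemma tail_pos: "0 < tail m x"
  unfolding tail_def using exp_add_norm_pos[of x] by (simp only: powr_gt_zero)

lemma tail_le_1: "0 \<le> m \<Longrightarrow> tail m x \<le> 1"
  unfolding tail_def using one_le_exp_1 norm_ge_zero[of x] powr_mono[of "- m" 0 "exp 1 + norm x"]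
  by (simp add: add_increasing2 split: if_splits)

lemma ln_tail: "ln (tail m x) = - m * logtail x"
  unfolding tail_def logtail_def using exp_add_norm_pos[of x] by (subst ln_powr) auto

lemma tail_measurable [measurable]: "tail m \<in> borel_measurable lebesgue"
proof -
  have "tail m \<in> borel_measurable lborel" unfolding tail_def by measurable
  then show ?thesis by (rule measurable_completion)
qed

text \<open>The tangent inequality at \<open>b\<close> is integrated over \<open>A\<close>. A mass
  of \<open>A\<close> below \<open>V\<close> only lowers the constant term, so \<open>V\<close> can
  be an upper bound for it, as the measure of a tripled cube is.\<close>

lemma (in cube_measure) subprob_Jensen:
  assumes [measurable]: "A \<in> sets M" "g \<in> borel_measurable M"
    and V: "emeasure M A \<le> ennreal V" "0 \<le> V" and p: "1 \<le> p" and "0 \<le> b" "\<And>x. 0 \<le> g x"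
    and b: "ennreal (b * V) \<le> (\<integral>\<^sup>+x\<in>A. ennreal (g x) \<partial>M)"
  shows "ennreal (b powr p * V) \<le> (\<integral>\<^sup>+x\<in>A. ennreal (g x powr p) \<partial>M)"
proof (cases "(\<integral>\<^sup>+x\<in>A. ennreal (g x powr p) \<partial>M) = \<infinity>")
  case False
  then obtain G where G: "(\<integral>\<^sup>+x\<in>A. ennreal (g x powr p) \<partial>M) = ennreal G" "0 \<le> G"
    by (cases "(\<integral>\<^sup>+x\<in>A. ennreal (g x powr p) \<partial>M)") auto
  have "ennreal (p * b powr (p - 1) * (b * V)) = ennreal (p * b powr (p - 1)) * ennreal (b * V)"
    using assms by (simp add: ennreal_mult)
  also have "\<dots> \<le> ennreal (p * b powr (p - 1)) * (\<integral>\<^sup>+x\<in>A. ennreal (g x) \<partial>M)"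
    by (intro mult_left_mono b) auto
  also have "\<dots> = (\<integral>\<^sup>+x\<in>A. ennreal (p * b powr (p - 1) * g x) \<partial>M)"
    using p by (subst nn_integral_cmult[symmetric]) (auto simp: ennreal_mult' mult.assoc intro!: nn_integral_cong)
  also have "\<dots> \<le> (\<integral>\<^sup>+x\<in>A. ennreal (g x powr p + (p - 1) * b powr p) \<partial>M)"
    using p assms by (intro nn_integral_mono mult_right_mono ennreal_leI powr_tangent) auto
  also have "\<dots> = (\<integral>\<^sup>+x\<in>A. ennreal (g x powr p) \<partial>M) + ennreal ((p - 1) * b powr p) * emeasure M A"
  proof -
    have "(\<integral>\<^sup>+x\<in>A. ennreal (g x powr p + (p - 1) * b powr p) \<partial>M)
        = (\<integral>\<^sup>+x. ennreal (g x powr p) * indicator A x + ennreal ((p - 1) * b powr p) * indicator A x \<partial>M)"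
      using p by (intro nn_integral_cong) (auto simp: indicator_def)
    then show ?thesis using assms(1) by (subst (asm) nn_integral_add) (auto simp: nn_integral_cmult_indicator)
  qed
  also have "\<dots> \<le> ennreal G + ennreal ((p - 1) * b powr p) * ennreal V"
    unfolding G(1) by (intro add_left_mono mult_left_mono V) auto
  also have "\<dots> = ennreal (G + (p - 1) * b powr p * V)"
    using G(2) p V(2) by (simp add: ennreal_mult ennreal_plus del: ennreal_plus[symmetric])
  finally have "p * b powr (p - 1) * (b * V) \<le> G + (p - 1) * b powr p * V"
    using G(2) p V(2) by (subst (asm) ennreal_le_iff) auto
  also have "p * b powr (p - 1) * (b * V) = p * b powr p * V"
    using powr_mult_base[OF \<open>0 \<le> b\<close>, of "p - 1"] by (simp add: algebra_simps)
  finally have "b powr p * V \<le> G" by (simp add: algebra_simps)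
  then show ?thesis unfolding G(1) by (rule ennreal_leI)
qed simp

text \<open>Log-Hoelder continuity is put on \<open>q\<close> itself; for exponents between positive
  bounds this agrees up to constants with the condition on the reciprocal. \<open>qi\<close> is the
  value at infinity and \<open>N\<close> collects the exceptional points.\<close>

locale lh_exponent =
  fixes q :: "'a::euclidean_space \<Rightarrow> real" and N :: "'a set" and qi lo hi CL :: real
  assumes q_measurable [measurable]: "q \<in> borel_measurable lebesgue"
    and lo_ge_1: "1 \<le> lo" and lo_le_q: "lo \<le> q x" and q_le_hi: "q x \<le> hi"
    and lo_le_qi: "lo \<le> qi" and qi_le_hi: "qi \<le> hi"
    and null_N: "N \<in> null_sets lebesgue" and CL_nonneg: "0 \<le> CL"
    and log_Hoelder: "x \<notin> N \<Longrightarrow> y \<notin> N \<Longrightarrow> norm (x - y) < 1 / 2 \<Longrightarrow> \<bar>q x - q y\<bar> * (- ln (norm (x - y))) \<le> CL"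
    and log_decay: "x \<notin> N \<Longrightarrow> \<bar>q x - qi\<bar> * logtail x \<le> CL"
begin

lemma q_ge_1: "1 \<le> q x" using lo_ge_1 lo_le_q[of x] by linarith
lemma qi_ge_1: "1 \<le> qi" using lo_ge_1 lo_le_qi by linarith
lemma hi_ge_1: "1 \<le> hi" using qi_ge_1 qi_le_hi by linarith

lemma AE_not_N: "AE x in lebesgue. x \<notin> N" using null_N by (rule AE_not_in)

text \<open>The local and the global condition merge into one bound on cubes of every size. The
  scale is at most \<open>logtail\<close> plus \<open>ln (1 + 1 / r)\<close>: the first term is
  handled by decay towards \<open>qi\<close> at both points, the second by local continuity for
  small \<open>r\<close> and by the bounded oscillation of \<open>q\<close> otherwise.\<close>

lemma log_oscillation:
  "\<exists>K\<ge>0. \<forall>c r x y. 0 < r \<longrightarrow> x \<in> cube c r \<longrightarrow> y \<in> cube c r \<longrightarrow> x \<notin> N \<longrightarrow> y \<notin> N \<longrightarrow>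
    \<bar>q x - q y\<bar> * min (logscale r x) (logscale r y) \<le> K"
proof (intro exI conjI allI impI)
  define d where "d = real DIM('a)"
  \<comment> \<open>Below this radius two points of the cube are closer than \<open>1 / 2\<close>,
    and \<open>2 / r\<close> is at most the inverse square of \<open>2 * d * r\<close>, so that
    \<open>ln (1 + 1 / r)\<close> is at most twice \<open>- ln (2 * d * r)\<close>.\<close>
  define r0 where "r0 = 1 / (8 * d\<^sup>2)"
  have d: "1 \<le> d" by (simp add: d_def Suc_leI)
  then have "1 \<le> d\<^sup>2" by simp
  have r0: "0 < r0" using d by (simp add: r0_def)
  let ?K = "2 * CL * (1 + ln (1 + 1 / r0)) + 2 * CL"
  show "0 \<le> ?K" using CL_nonneg r0 by simp
  fix c :: 'a and r x y
  assume r: "0 < r" and xy: "x \<in> cube c r" "y \<in> cube c r" "x \<notin> N" "y \<notin> N"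
  define o' where "o' = \<bar>q x - q y\<bar>"
  define l where "l = min (logtail x) (logtail y)"
  have l1: "1 \<le> l" using logtail_ge_1[of x] logtail_ge_1[of y] by (simp add: l_def)
  have ol: "o' * l \<le> 2 * CL"
  proof -
    have "o' * l \<le> (\<bar>q x - qi\<bar> + \<bar>q y - qi\<bar>) * l" unfolding o'_def using l1 by (intro mult_right_mono) auto
    also have "\<dots> \<le> \<bar>q x - qi\<bar> * logtail x + \<bar>q y - qi\<bar> * logtail y"
      unfolding distrib_right l_def by (intro add_mono mult_left_mono) auto
    also have "\<dots> \<le> 2 * CL" using log_decay[OF xy(3)] log_decay[OF xy(4)] by simp
    finally show ?thesis .
  qed
  have min_le: "min (logscale r x) (logscale r y) \<le> l + ln (1 + 1 / r)"
    using logscale_le[OF r, of x] logscale_le[OF r, of y] unfolding l_def by linarith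
  have o0: "0 \<le> o'" by (simp add: o'_def)
  have le: "o' * min (logscale r x) (logscale r y) \<le> o' * l + o' * ln (1 + 1 / r)"
    using mult_left_mono[OF min_le o0] by (simp add: distrib_left)
  have oo: "o' \<le> 2 * CL" using ol mult_left_mono[OF l1 o0] by simp
  have "o' * ln (1 + 1 / r) \<le> 2 * CL * ln (1 + 1 / r0) + 2 * CL"
  proof (cases "r0 \<le> r")
    case True
    have "ln (1 + 1 / r) \<le> ln (1 + 1 / r0)"
      using r0 True by (subst ln_le_cancel_iff) (auto intro!: add_pos_pos divide_left_mono)
    then have "o' * ln (1 + 1 / r) \<le> 2 * CL * ln (1 + 1 / r0)"
      using oo o0 r CL_nonneg by (intro mult_mono) auto
    then show ?thesis using CL_nonneg by linarith
  next
    case False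
    have rd: "r < 1 / (8 * d\<^sup>2)" using False by (simp add: r0_def)
    have n: "norm (x - y) \<le> 2 * d * r" using norm_diff_cube[OF xy(1,2)] by (simp add: d_def)
    have "d * r * (8 * d) < 1" using rd d by (simp add: field_simps power2_eq_square)
    moreover have "d * r * 8 \<le> d * r * (8 * d)" using d r by (intro mult_left_mono) auto
    ultimately have small: "2 * d * r < 1 / 2" by linarith
    have "r \<le> 1"
    proof -
      have "r * 8 \<le> d * r * 8" using d r by (intro mult_right_mono) auto
      then show ?thesis using small by linarith
    qed
    then have "ln (1 + 1 / r) \<le> ln (2 / r)" using r by (subst ln_le_cancel_iff) (auto simp: field_simps intro: add_pos_pos)
    also have "2 / r \<le> 1 / (2 * d * r)\<^sup>2"
    proof -
      have "8 * d\<^sup>2 * r * r \<le> 1 * r" using rd r d by (intro mult_right_mono) (auto simp: field_simps)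
      then show ?thesis using r d by (simp add: field_simps power2_eq_square)
    qed
    then have "ln (2 / r) \<le> ln (1 / (2 * d * r)\<^sup>2)" using r d by (subst ln_le_cancel_iff) auto
    also have "\<dots> = 2 * (- ln (2 * d * r))" using r d by (simp add: ln_div ln_realpow)
    finally have A: "ln (1 + 1 / r) \<le> 2 * (- ln (2 * d * r))" .
    have B: "o' * (- ln (2 * d * r)) \<le> CL"
    proof (cases "x = y")
      case True then show ?thesis using CL_nonneg by (simp add: o'_def)
    next
      case False
      then have "- ln (2 * d * r) \<le> - ln (norm (x - y))" using n r d by (simp add: ln_le_cancel_iff)
      then have "o' * (- ln (2 * d * r)) \<le> o' * (- ln (norm (x - y)))" using o0 by (rule mult_left_mono)
      also have "\<dots> \<le> CL" unfolding o'_def using n small by (intro log_Hoelder xy) auto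
      finally show ?thesis .
    qed
    have "o' * ln (1 + 1 / r) \<le> 2 * (o' * (- ln (2 * d * r)))" using mult_left_mono[OF A o0] by (simp add: algebra_simps)
    also have "\<dots> \<le> 2 * CL" using B by simp
    also have "\<dots> \<le> 2 * CL * ln (1 + 1 / r0) + 2 * CL" using CL_nonneg r0 by simp
    finally show ?thesis .
  qed
  with le ol show "\<bar>q x - q y\<bar> * min (logscale r x) (logscale r y) \<le> ?K"
    unfolding o'_def by (simp add: algebra_simps)
qed

text \<open>If \<open>t\<close> is at most \<open>tail m x\<close>, so are its powers, the exponents
  being at least 1; otherwise \<open>\<bar>ln t\<bar>\<close> is at most
  \<open>m * logtail x\<close> and the decay of \<open>q\<close> permits the exchange. This
  dichotomy is the source of the tail errors.\<close>

lemma powr_decay: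
  assumes "x \<notin> N" "0 \<le> m" "0 \<le> t" "t \<le> 1"
  shows "t powr q x \<le> exp (m * CL) * t powr qi + tail m x"
    and "t powr qi \<le> exp (m * CL) * t powr q x + tail m x"
proof -
  have "t powr q x \<le> exp (m * CL) * t powr qi + tail m x \<and> t powr qi \<le> exp (m * CL) * t powr q x + tail m x"
  proof (cases "t \<le> tail m x")
    case True
    have "t powr q x \<le> t powr 1" "t powr qi \<le> t powr 1"
      using assms q_ge_1 qi_ge_1 by (intro powr_le_powr_self; simp)+
    moreover have "t powr 1 = t" using assms by simp
    moreover have "0 \<le> exp (m * CL) * t powr qi" "0 \<le> exp (m * CL) * t powr q x" by simp_all
    ultimately show ?thesis using True by linarith
  next
    case False
    then have t: "0 < t" using tail_pos[of m x] by linarith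
    have "ln (tail m x) \<le> ln t" using False t tail_pos[of m x] by (subst ln_le_cancel_iff) auto
    moreover have "ln t \<le> 0" using t assms by simp
    ultimately have "\<bar>ln t\<bar> \<le> m * logtail x" unfolding ln_tail by simp
    then have "\<bar>q x - qi\<bar> * \<bar>ln t\<bar> \<le> \<bar>q x - qi\<bar> * (m * logtail x)" by (intro mult_left_mono) auto
    also have "\<dots> \<le> m * CL" using mult_left_mono[OF log_decay[OF assms(1)] assms(2)] by (simp add: algebra_simps)
    finally have *: "\<bar>q x - qi\<bar> * \<bar>ln t\<bar> \<le> m * CL" .
    then have "t powr q x \<le> exp (m * CL) * t powr qi" "t powr qi \<le> exp (m * CL) * t powr q x"
      using t by (auto intro!: powr_close simp: abs_minus_commute)
    then show ?thesis using tail_pos[of m x] by linarith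
  qed
  then show "t powr q x \<le> exp (m * CL) * t powr qi + tail m x"
    and "t powr qi \<le> exp (m * CL) * t powr q x + tail m x" by auto
qed

text \<open>The comparison passes through the exponent at infinity, so it holds for points
  arbitrarily far apart; it serves the values of a function below 1.\<close>

lemma powr_compare:
  assumes "x \<notin> N" "y \<notin> N" "0 \<le> m" "0 \<le> t" "t \<le> 1"
  shows "t powr q x \<le> (exp (m * CL))\<^sup>2 * (t powr q y + tail m y) + tail m x"
proof -
  have C1: "1 \<le> exp (m * CL)" using assms CL_nonneg by simp
  have "t powr q x \<le> exp (m * CL) * t powr qi + tail m x" using assms by (intro powr_decay)
  also have "\<dots> \<le> exp (m * CL) * (exp (m * CL) * t powr q y + tail m y) + tail m x"
    using assms by (intro add_mono mult_left_mono powr_decay) auto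
  also have "\<dots> \<le> exp (m * CL) * (exp (m * CL) * t powr q y + exp (m * CL) * tail m y) + tail m x"
    using mult_right_mono[OF C1, of "tail m y"] tail_pos[of m y] by (intro add_mono mult_left_mono) auto
  finally show ?thesis by (simp add: power2_eq_square algebra_simps)
qed

text \<open>Jensen's inequality with a variable exponent. \<open>g\<close> is split at the value 1.
  For the large part the exponent is lowered to a constant close enough to \<open>q x\<close>; for
  the small part the exponents are exchanged pointwise by \<open>powr_compare\<close>. The
  finiteness hypothesis excludes that the average on the right is 0 by convention.\<close>

lemma key_estimate:
  fixes M :: "'a measure"
  assumes M: "cube_measure M" and ac: "absolutely_continuous lebesgue M"
    and B: "0 \<le> B" "\<And>c r x. 0 < r \<Longrightarrow> x \<in> cube c r \<Longrightarrow> - B * logscale r x \<le> ln (measure M (cube c r))"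
    and m: "0 \<le> m"
  shows "\<exists>K\<ge>0. \<forall>c r x g. 0 < r \<longrightarrow> x \<in> cube c r \<longrightarrow> x \<notin> N \<longrightarrow> g \<in> borel_measurable M \<longrightarrow> (\<forall>y. 0 \<le> g y) \<longrightarrow>
    (\<integral>\<^sup>+y. ennreal (g y) * indicator {y. 1 \<le> g y} y \<partial>M) \<le> 1 \<longrightarrow>
    (\<integral>\<^sup>+y\<in>cube c r. ennreal (g y powr q y + tail m y) \<partial>M) < \<infinity> \<longrightarrow>
    avg M g c r powr q x \<le> K * (avg M (\<lambda>y. g y powr q y + tail m y) c r + tail m x)"
proof -
  interpret cube_measure M by (rule M)
  obtain Ko where Ko: "0 \<le> Ko" "\<And>c r x y. 0 < r \<Longrightarrow> x \<in> cube c r \<Longrightarrow> y \<in> cube c r \<Longrightarrow> x \<notin> N \<Longrightarrow> y \<notin> N \<Longrightarrow>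
    \<bar>q x - q y\<bar> * min (logscale r x) (logscale r y) \<le> Ko"
    using log_oscillation by metis
  have nN: "AE y in M. y \<notin> N"
    using null_N ac by (intro AE_not_in) (auto simp: absolutely_continuous_def)
  define C where "C = exp (m * CL)"
  have C1: "1 \<le> C" unfolding C_def using m CL_nonneg by simp
  define K0 where "K0 = B * Ko"
  have K0: "0 \<le> K0" unfolding K0_def using B Ko by simp
  show ?thesis
  proof (intro exI[of _ "2 powr hi * (exp K0 + C\<^sup>2 + 1)"] conjI allI impI)
    show "0 \<le> 2 powr hi * (exp K0 + C\<^sup>2 + 1)" by (simp add: add_nonneg_nonneg)
    fix c :: 'a and r x g
    assume r: "0 < r" and x: "x \<in> cube c r" "x \<notin> N" and [measurable]: "g \<in> borel_measurable M"
      and g: "\<forall>y. 0 \<le> g y" and g1: "(\<integral>\<^sup>+y. ennreal (g y) * indicator {y. 1 \<le> g y} y \<partial>M) \<le> 1"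
      and fin: "(\<integral>\<^sup>+y\<in>cube c r. ennreal (g y powr q y + tail m y) \<partial>M) < \<infinity>"
    have [measurable]: "g \<in> borel_measurable lebesgue" "tail m \<in> borel_measurable M" "q \<in> borel_measurable M"
      by (simp_all cong: measurable_cong_sets)
    let ?Q = "cube c r" and ?P = "cube c (3 * r)"
    have QP: "?Q \<subseteq> ?P" using r by (intro cube_mono) simp
    define V where "V = measure M ?P"
    have V: "0 < V" unfolding V_def using r by (intro measure_cube_pos) simp
    have MQ: "emeasure M ?Q \<le> ennreal V"
      unfolding V_def using emeasure_mono[OF QP, of M] by (simp add: emeasure_cube_eq)
    define k where "k y = g y powr q y + tail m y" for y
    have [measurable]: "k \<in> borel_measurable M" unfolding k_def by measurable
    have k0: "0 \<le> k y" for y unfolding k_def using tail_pos[of m y] by simp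
    define R where "R = avg M k c r"
    have R0: "0 \<le> R" unfolding R_def by (rule avg_nonneg)
    have RV: "(\<integral>\<^sup>+y\<in>?Q. ennreal (k y) \<partial>M) = ennreal (R * V)"
      using fin V unfolding R_def avg_def V_def[symmetric] k_def by (simp add: less_top)
    define h1 where "h1 y = g y * indicator {y. 1 \<le> g y} y" for y
    define h2 where "h2 y = g y * indicator {y. g y < 1} y" for y
    have [measurable]: "h1 \<in> borel_measurable M" "h2 \<in> borel_measurable M" unfolding h1_def h2_def by measurable
    have h0: "0 \<le> h1 y" "0 \<le> h2 y" for y using g by (auto simp: h1_def h2_def)
    have h1k: "h1 y powr a \<le> k y" if "1 \<le> a" "a \<le> q y" for a y
      using that tail_pos[of m y] powr_mono[of a "q y" "g y"] k0[of y] unfolding h1_def k_def by (auto simp: indicator_def)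
    define I1 where "I1 = (\<integral>\<^sup>+y\<in>?Q. ennreal (h1 y) \<partial>M)"
    define I2 where "I2 = (\<integral>\<^sup>+y\<in>?Q. ennreal (h2 y) \<partial>M)"
    have I1_le: "I1 \<le> ennreal (R * V)" unfolding I1_def RV[symmetric]
    proof (intro nn_integral_mono mult_right_mono ennreal_leI)
      show "h1 y \<le> k y" for y using h1k[of 1 y] q_ge_1[of y] h0[of y] by simp
    qed simp
    have "I2 \<le> (\<integral>\<^sup>+y. indicator ?Q y \<partial>M)" unfolding I2_def
      by (intro nn_integral_mono) (auto simp: h2_def indicator_def)
    then have I2_le: "I2 \<le> ennreal V" using MQ by simp
    obtain i1 where i1: "I1 = ennreal i1" "0 \<le> i1" using I1_le by (cases I1) (auto simp: top_unique)
    obtain i2 where i2: "I2 = ennreal i2" "0 \<le> i2" using I2_le by (cases I2) (auto simp: top_unique)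
    have "(\<integral>\<^sup>+y\<in>?Q. ennreal (g y) \<partial>M) = (\<integral>\<^sup>+y. ennreal (h1 y) * indicator ?Q y + ennreal (h2 y) * indicator ?Q y \<partial>M)"
      by (intro nn_integral_cong) (auto simp: h1_def h2_def indicator_def)
    also have "\<dots> = I1 + I2" unfolding I1_def I2_def by (subst nn_integral_add) auto
    finally have avg_eq: "avg M g c r = i1 / V + i2 / V"
      unfolding avg_def V_def[symmetric] using i1 i2 by (simp add: add_divide_distrib flip: ennreal_plus)
    have p1: "(i1 / V) powr q x \<le> exp K0 * R"
    proof -
      define b where "b = i1 / V"
      have b0: "0 \<le> b" unfolding b_def using i1 V by simp
      have bV: "ennreal (b * V) = I1" unfolding b_def i1(1) using V by simp
      \<comment> \<open>Stands in for the essential infimum of \<open>q\<close> on the cube: a lower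
        bound almost everywhere, within \<open>K0 / ln b\<close> of \<open>q x\<close> if
        \<open>b > 1\<close>. For \<open>b <= 1\<close> the exponent 1 does, since lowering an
        exponent then only raises the power.\<close>
      define m0 where "m0 = (if b \<le> 1 then 1 else max 1 (q x - K0 / ln b))"
      have m01: "1 \<le> m0" by (simp add: m0_def)
      have m0q: "m0 \<le> q y" if "y \<in> ?Q" "y \<notin> N" for y
      proof (cases "b \<le> 1")
        case False
        have "I1 \<le> (\<integral>\<^sup>+y. ennreal (g y) * indicator {y. 1 \<le> g y} y \<partial>M)"
          unfolding I1_def h1_def by (intro nn_integral_mono) (auto simp: indicator_def)
        \<comment> \<open>The normalisation of the large part gives \<open>b <= 1 / V\<close>, and
          the polynomial lower bound for \<open>V\<close> makes \<open>ln b\<close> at most a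
          multiple of the logarithmic scale.\<close>
        with g1 have "ennreal (b * V) \<le> 1" unfolding bV by (rule order_trans[rotated])
        then have "b * V \<le> 1" by simp
        then have "ln (b * V) \<le> 0" using False V by (subst ln_le_zero_iff) (auto intro: mult_pos_pos)
        then have "ln b \<le> - ln V" using False V by (simp add: ln_mult_pos)
        moreover have "- ln V \<le> B * logscale (3 * r) z" if "z \<in> ?Q" for z
          unfolding V_def using B(2)[of "3 * r" z c] r that QP by auto
        ultimately have "ln b \<le> B * logscale (3 * r) x" "ln b \<le> B * logscale (3 * r) y"
          using x(1) \<open>y \<in> ?Q\<close> by (auto intro: order_trans)
        then have "ln b \<le> B * min (logscale (3 * r) x) (logscale (3 * r) y)" by (auto simp: min_def)
        then have "\<bar>q x - q y\<bar> * ln b \<le> \<bar>q x - q y\<bar> * (B * min (logscale (3 * r) x) (logscale (3 * r) y))"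
          by (intro mult_left_mono) auto
        also have "\<dots> = B * (\<bar>q x - q y\<bar> * min (logscale (3 * r) x) (logscale (3 * r) y))" by simp
        also have "\<dots> \<le> K0" unfolding K0_def
          using Ko(2)[of "3 * r" x c y] r x that QP B(1) by (intro mult_left_mono) auto
        finally have "\<bar>q x - q y\<bar> \<le> K0 / ln b" using False by (simp add: field_simps)
        then have "q x - K0 / ln b \<le> q y" by linarith
        then show ?thesis using q_ge_1[of y] by (simp add: m0_def)
      qed (use q_ge_1[of y] in \<open>simp add: m0_def\<close>)
      have "b powr q x \<le> exp K0 * b powr m0"
      proof (cases "b \<le> 1")
        case True
        then have "b powr q x \<le> b powr m0" using b0 q_ge_1[of x] by (intro powr_le_powr_self) (auto simp: m0_def)
        also have "\<dots> \<le> exp K0 * b powr m0" using K0 by (simp add: mult_le_cancel_right1)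
        finally show ?thesis .
      next
        case False
        have "\<bar>q x - m0\<bar> * \<bar>ln b\<bar> \<le> K0"
        proof -
          have "\<bar>q x - m0\<bar> \<le> K0 / ln b" using False q_ge_1[of x] K0 by (auto simp: m0_def max_def)
          then show ?thesis using False by (simp add: field_simps)
        qed
        then show ?thesis using False by (intro powr_close) auto
      qed
      moreover have "b powr m0 \<le> R"
      proof -
        have "ennreal (b powr m0 * V) \<le> (\<integral>\<^sup>+y\<in>?Q. ennreal (h1 y powr m0) \<partial>M)"
          using MQ V m01 b0 h0 bV by (intro subprob_Jensen) (auto simp: I1_def)
        also have "\<dots> \<le> (\<integral>\<^sup>+y\<in>?Q. ennreal (k y) \<partial>M)"
        proof (intro nn_integral_mono_AE)
          show "AE y in M. ennreal (h1 y powr m0) * indicator ?Q y \<le> ennreal (k y) * indicator ?Q y"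
            using nN by eventually_elim (auto simp: indicator_def intro!: ennreal_leI h1k m01 m0q)
        qed
        also have "\<dots> = ennreal (R * V)" by (rule RV)
        finally show ?thesis using V R0 by (simp add: ennreal_le_iff)
      qed
      ultimately show ?thesis unfolding b_def by (meson exp_ge_zero mult_left_mono order_trans)
    qed
    have p2: "(i2 / V) powr q x \<le> C\<^sup>2 * R + tail m x"
    proof -
      define b where "b = i2 / V"
      have b0: "0 \<le> b" unfolding b_def using i2 V by simp
      have bV: "ennreal (b * V) = I2" unfolding b_def i2(1) using V by simp
      have tx: "0 \<le> tail m x" using tail_pos[of m x] by simp
      have "ennreal (b powr q x * V) \<le> (\<integral>\<^sup>+y\<in>?Q. ennreal (h2 y powr q x) \<partial>M)"
        using MQ V q_ge_1[of x] b0 h0 bV by (intro subprob_Jensen) (auto simp: I2_def)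
      also have "\<dots> \<le> (\<integral>\<^sup>+y. ennreal (C\<^sup>2) * (ennreal (k y) * indicator ?Q y) + ennreal (tail m x) * indicator ?Q y \<partial>M)"
      proof (intro nn_integral_mono_AE)
        show "AE y in M. ennreal (h2 y powr q x) * indicator ?Q y \<le>
          ennreal (C\<^sup>2) * (ennreal (k y) * indicator ?Q y) + ennreal (tail m x) * indicator ?Q y"
          using nN
        proof eventually_elim
          case (elim y)
          have "h2 y \<le> 1" using h0[of y] by (auto simp: h2_def indicator_def)
          then have "h2 y powr q x \<le> C\<^sup>2 * (h2 y powr q y + tail m y) + tail m x"
            unfolding C_def using elim x m h0 by (intro powr_compare) auto
          also have "h2 y powr q y \<le> g y powr q y" by (auto simp: h2_def indicator_def)
          finally have "h2 y powr q x \<le> C\<^sup>2 * k y + tail m x" by (simp add: k_def mult_left_mono)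
          then have "ennreal (h2 y powr q x) \<le> ennreal (C\<^sup>2 * k y + tail m x)" by (rule ennreal_leI)
          also have "\<dots> = ennreal (C\<^sup>2) * ennreal (k y) + ennreal (tail m x)"
            using k0[of y] tx by (simp add: ennreal_mult)
          finally show ?case by (auto simp: indicator_def)
        qed
      qed
      also have "\<dots> = ennreal (C\<^sup>2) * ennreal (R * V) + ennreal (tail m x) * emeasure M ?Q"
        by (subst nn_integral_add) (auto simp: nn_integral_cmult nn_integral_cmult_indicator RV)
      also have "\<dots> \<le> ennreal (C\<^sup>2) * ennreal (R * V) + ennreal (tail m x) * ennreal V"
        by (intro add_left_mono mult_left_mono MQ) auto
      also have "\<dots> = ennreal ((C\<^sup>2 * R + tail m x) * V)"
        using R0 V tx by (simp add: distrib_right ennreal_mult mult.assoc)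
      finally have "b powr q x * V \<le> (C\<^sup>2 * R + tail m x) * V"
        using V R0 tx by (subst (asm) ennreal_le_iff) auto
      then show ?thesis unfolding b_def using V by simp
    qed
    have "avg M g c r powr q x \<le> 2 powr q x * ((i1 / V) powr q x + (i2 / V) powr q x)"
      unfolding avg_eq using i1 i2 V q_ge_1[of x] by (intro add_powr_le) auto
    also have "\<dots> \<le> 2 powr hi * (exp K0 * R + (C\<^sup>2 * R + tail m x))"
      using p1 p2 q_le_hi[of x] by (intro mult_mono add_mono powr_mono) auto
    also have "\<dots> \<le> 2 powr hi * ((exp K0 + C\<^sup>2 + 1) * (R + tail m x))"
      using R0 tail_pos[of m x] C1 by (intro mult_left_mono) (auto simp: algebra_simps)
    finally show "avg M g c r powr q x \<le> 2 powr hi * (exp K0 + C\<^sup>2 + 1) *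
        (avg M (\<lambda>y. g y powr q y + tail m y) c r + tail m x)"
      unfolding R_def k_def by (simp add: mult.assoc)
  qed
qed

end

section \<open>The maximal inequality with a variable exponent\<close>

lemma powr_le_1_plus:
  fixes t a b :: real
  assumes "0 \<le> t" "0 \<le> a" "a \<le> b" shows "t powr a \<le> 1 + t powr b"
proof (cases "1 \<le> t")
  case True then show ?thesis using powr_mono[OF assms(3) True] by simp
next
  case False
  then have "t powr a \<le> 1" using assms by (intro powr_le1) auto
  then show ?thesis by (simp add: add_increasing2)
qed

context lh_exponent
begin

text \<open>Division by \<open>lo\<close> leaves exponents at least 1, enough for Jensen's
  inequality, and keeps the power \<open>lo\<close> in reserve for the strong type bound.\<close>

lemma lh_exponent_scaled: "lh_exponent (\<lambda>x. q x / lo) N (qi / lo) 1 (hi / lo) CL"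
proof -
  have le: "\<bar>a / lo - b / lo\<bar> \<le> \<bar>a - b\<bar>" for a b
  proof -
    have "\<bar>a / lo - b / lo\<bar> = \<bar>a - b\<bar> / lo" using lo_ge_1 by (simp add: abs_divide flip: diff_divide_distrib)
    also have "\<dots> \<le> \<bar>a - b\<bar> / 1" using lo_ge_1 by (intro divide_left_mono) auto
    finally show ?thesis by simp
  qed
  show ?thesis
  proof
    show "\<bar>q x / lo - q y / lo\<bar> * - ln (norm (x - y)) \<le> CL"
      if "x \<notin> N" "y \<notin> N" "norm (x - y) < 1 / 2" for x y
    proof (cases "x = y")
      case False
      then have "0 \<le> - ln (norm (x - y))" using that by simp
      from mult_right_mono[OF le this, of "q x" "q y"] log_Hoelder[OF that] show ?thesis by linarith
    qed (simp add: CL_nonneg)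
    show "\<bar>q x / lo - qi / lo\<bar> * logtail x \<le> CL" if "x \<notin> N" for x
      using mult_right_mono[OF le, of "logtail x" "q x" qi] log_decay[OF that] logtail_ge_1[of x] by linarith
  qed (use lo_ge_1 lo_le_q q_le_hi lo_le_qi qi_le_hi null_N CL_nonneg in \<open>auto intro!: divide_right_mono simp: le_divide_eq_1_pos\<close>)
qed

text \<open>\<open>maxop M F g powr q\<close> is the power \<open>lo\<close> of a quantity that
  \<open>key_estimate\<close>, applied to \<open>q / lo\<close>, bounds by a multiple of
  \<open>maxop M F k\<close> plus a tail, with \<open>k = g powr (q / lo) + tail m\<close>. The
  strong type bound for the constant exponent \<open>lo > 1\<close> then applies to
  \<open>k\<close>, and the tail, being at most 1, dominates its own power
  \<open>lo\<close>.\<close>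

lemma maxop_variable_strong_type:
  fixes M :: "'a measure"
  assumes lo: "1 < lo" and M: "cube_measure M" and ac: "absolutely_continuous lebesgue M"
    and B: "0 \<le> B" "\<And>c r x. 0 < r \<Longrightarrow> x \<in> cube c r \<Longrightarrow> - B * logscale r x \<le> ln (measure M (cube c r))"
    and m: "0 \<le> m" "(\<integral>\<^sup>+x. ennreal (tail m x) \<partial>M) < \<infinity>"
  shows "\<exists>K\<ge>0. \<forall>F g. finite F \<longrightarrow> (\<forall>(c, r)\<in>F. 0 < r) \<longrightarrow> g \<in> borel_measurable M \<longrightarrow> (\<forall>y. 0 \<le> g y) \<longrightarrow>
    (\<integral>\<^sup>+x. ennreal (g x powr q x) \<partial>M) \<le> 1 \<longrightarrow>
    (\<integral>\<^sup>+x. ennreal (maxop M F g x powr q x) \<partial>M) \<le> ennreal K"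
proof -
  interpret cube_measure M by (rule M)
  define u where "u x = q x / lo" for x
  interpret U: lh_exponent u N "qi / lo" 1 "hi / lo" CL
    unfolding u_def by (rule lh_exponent_scaled)
  have uq: "u x * lo = q x" for x using lo by (simp add: u_def)
  have uleq: "u x \<le> q x" for x
    using lo q_ge_1[of x] unfolding u_def by (simp add: divide_le_eq)
  obtain K1 where K1: "0 \<le> K1" and key: "\<forall>c r x g. 0 < r \<longrightarrow> x \<in> cube c r \<longrightarrow> x \<notin> N \<longrightarrow> g \<in> borel_measurable M \<longrightarrow> (\<forall>y. 0 \<le> g y) \<longrightarrow>
    (\<integral>\<^sup>+y. ennreal (g y) * indicator {y. 1 \<le> g y} y \<partial>M) \<le> 1 \<longrightarrow>
    (\<integral>\<^sup>+y\<in>cube c r. ennreal (g y powr u y + tail m y) \<partial>M) < \<infinity> \<longrightarrow>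
    avg M g c r powr u x \<le> K1 * (avg M (\<lambda>y. g y powr u y + tail m y) c r + tail m x)"
    by (rule exE[OF U.key_estimate[OF M ac B m(1)]]; (assumption | (elim conjE, rule that; assumption)))
  obtain Ks where Ks: "0 \<le> Ks" and strong: "\<forall>F g. finite F \<longrightarrow> (\<forall>(c, r)\<in>F. 0 < r) \<longrightarrow> g \<in> borel_measurable M \<longrightarrow> (\<forall>x. 0 \<le> g x) \<longrightarrow>
    (\<integral>\<^sup>+x. ennreal (maxop M F g x powr lo) \<partial>M) \<le> ennreal Ks * (\<integral>\<^sup>+x. ennreal (g x powr lo) \<partial>M)"
    using maxop_strong_type[OF lo] by (elim exE conjE) (rule that)
  define e where "e = enn2real (\<integral>\<^sup>+x. ennreal (tail m x) \<partial>M)"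
  have e: "(\<integral>\<^sup>+x. ennreal (tail m x) \<partial>M) = ennreal e" "0 \<le> e" using m(2) by (auto simp: e_def)
  define D where "D = K1 powr lo * 2 powr lo"
  have D0: "0 \<le> D" by (simp add: D_def)
  have [measurable]: "tail m \<in> borel_measurable M" "q \<in> borel_measurable M" "u \<in> borel_measurable M"
    by (simp_all cong: measurable_cong_sets)
  have tail_lo: "(\<integral>\<^sup>+x. ennreal (tail m x powr lo) \<partial>M) \<le> ennreal e" unfolding e(1)[symmetric]
  proof (intro nn_integral_mono ennreal_leI)
    fix x :: 'a
    have "tail m x powr lo \<le> tail m x powr 1"
      using lo tail_pos[of m x] tail_le_1[OF m(1), of x] by (intro powr_le_powr_self) auto
    then show "tail m x powr lo \<le> tail m x" using tail_pos[of m x] by simp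
  qed
  have nN: "AE y in M. y \<notin> N"
    using null_N ac by (intro AE_not_in) (auto simp: absolutely_continuous_def)
  show ?thesis
  proof (intro exI[of _ "D * (Ks * (2 powr lo * (1 + e)) + e)"] conjI allI impI)
    show "0 \<le> D * (Ks * (2 powr lo * (1 + e)) + e)" using D0 Ks e(2) by simp
    fix F :: "('a \<times> real) set" and g :: "'a \<Rightarrow> real"
    assume F: "finite F" "\<forall>(c, r)\<in>F. 0 < r" and [measurable]: "g \<in> borel_measurable M"
      and g: "\<forall>y. 0 \<le> g y" and g1: "(\<integral>\<^sup>+x. ennreal (g x powr q x) \<partial>M) \<le> 1"
    define k where "k y = g y powr u y + tail m y" for y
    have [measurable]: "k \<in> borel_measurable M" unfolding k_def by measurable
    have k0: "0 \<le> k y" for y unfolding k_def using tail_pos[of m y] by simp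
    let ?T = "maxop M F"
    have [measurable]: "?T h \<in> borel_measurable M" for h using F(1) sets_M by (rule borel_measurable_maxop)
    have T0: "0 \<le> ?T h x" for h x using F(1) by (rule maxop_nonneg)
    have large: "(\<integral>\<^sup>+y. ennreal (g y) * indicator {y. 1 \<le> g y} y \<partial>M) \<le> 1"
    proof -
      have "(\<integral>\<^sup>+y. ennreal (g y) * indicator {y. 1 \<le> g y} y \<partial>M) \<le> (\<integral>\<^sup>+x. ennreal (g x powr q x) \<partial>M)"
      proof (intro nn_integral_mono)
        fix y
        show "ennreal (g y) * indicator {y. 1 \<le> g y} y \<le> ennreal (g y powr q y)"
          using powr_mono[of 1 "q y" "g y"] q_ge_1[of y] by (auto simp: indicator_def intro!: ennreal_leI)
      qed
      then show ?thesis using g1 by simp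
    qed
    have fin: "(\<integral>\<^sup>+y\<in>cube c r. ennreal (k y) \<partial>M) < \<infinity>" for c r
    proof -
      have "(\<integral>\<^sup>+y\<in>cube c r. ennreal (k y) \<partial>M) \<le> (\<integral>\<^sup>+y. ennreal (g y powr q y) + ennreal 2 * indicator (cube c r) y \<partial>M)"
      proof (intro nn_integral_mono)
        fix y
        have "k y \<le> g y powr q y + 2" unfolding k_def
          using powr_le_1_plus[of "g y" "u y" "q y"] g uleq[of y] U.q_ge_1[of y] tail_le_1[OF m(1), of y] by force
        then have "ennreal (k y) \<le> ennreal (g y powr q y + 2)" by (rule ennreal_leI)
        then show "ennreal (k y) * indicator (cube c r) y \<le> ennreal (g y powr q y) + ennreal 2 * indicator (cube c r) y"
          by (auto simp: indicator_def)
      qed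
      also have "\<dots> = (\<integral>\<^sup>+y. ennreal (g y powr q y) \<partial>M) + ennreal 2 * emeasure M (cube c r)"
        by (subst nn_integral_add) (auto simp: nn_integral_cmult_indicator)
      also have "\<dots> < \<infinity>"
        using g1 emeasure_cube_finite[of c r] by (auto simp: ennreal_mult_less_top intro: le_less_trans)
      finally show ?thesis .
    qed
    have pw: "?T g x powr q x \<le> D * (?T k x powr lo + tail m x powr lo)" if x: "x \<notin> N" for x
    proof (cases rule: maxop_cases[OF F(1), of M g x])
      case 1 then show ?thesis using D0 by simp
    next
      case (2 c r)
      have tx: "0 < tail m x" by (rule tail_pos)
      have r: "0 < r" using F(2) 2(1) by auto
      have "avg M g c r powr u x \<le> K1 * (avg M k c r + tail m x)"
        unfolding k_def using r 2(2) x g large fin[unfolded k_def] by (intro key[rule_format]) auto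
      also have "\<dots> \<le> K1 * (?T k x + tail m x)"
        using avg_le_maxop[OF F(1) 2(1,2), of M k] K1 by (intro mult_left_mono) auto
      finally have "(avg M g c r powr u x) powr lo \<le> (K1 * (?T k x + tail m x)) powr lo"
        using lo by (intro powr_mono2) auto
      also have "\<dots> = K1 powr lo * (?T k x + tail m x) powr lo"
        using K1 T0[of k x] tx by (simp add: powr_mult)
      also have "\<dots> \<le> K1 powr lo * (2 powr lo * (?T k x powr lo + tail m x powr lo))"
        using T0[of k x] tx lo by (intro mult_left_mono add_powr_le) auto
      finally show ?thesis unfolding 2(3) by (simp add: powr_powr uq D_def mult.assoc)
    qed
    have "(\<integral>\<^sup>+x. ennreal (?T g x powr q x) \<partial>M)
        \<le> (\<integral>\<^sup>+x. ennreal D * (ennreal (?T k x powr lo) + ennreal (tail m x powr lo)) \<partial>M)"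
    proof (intro nn_integral_mono_AE)
      show "AE x in M. ennreal (?T g x powr q x) \<le> ennreal D * (ennreal (?T k x powr lo) + ennreal (tail m x powr lo))"
        using nN
      proof eventually_elim
        case (elim x)
        have "ennreal (?T g x powr q x) \<le> ennreal (D * (?T k x powr lo + tail m x powr lo))"
          using pw[OF elim] by (rule ennreal_leI)
        then show ?case using D0 by (simp add: ennreal_mult)
      qed
    qed
    also have "\<dots> = ennreal D * ((\<integral>\<^sup>+x. ennreal (?T k x powr lo) \<partial>M) + (\<integral>\<^sup>+x. ennreal (tail m x powr lo) \<partial>M))"
      by (subst nn_integral_cmult) (auto simp: nn_integral_add)
    also have "\<dots> \<le> ennreal D * (ennreal Ks * ennreal (2 powr lo * (1 + e)) + ennreal e)"
    proof (intro mult_left_mono add_mono tail_lo)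
      have "(\<integral>\<^sup>+x. ennreal (?T k x powr lo) \<partial>M) \<le> ennreal Ks * (\<integral>\<^sup>+x. ennreal (k x powr lo) \<partial>M)"
        using F k0 by (intro strong[rule_format]) auto
      also have "(\<integral>\<^sup>+x. ennreal (k x powr lo) \<partial>M) \<le> (\<integral>\<^sup>+x. ennreal (2 powr lo) * (ennreal (g x powr q x) + ennreal (tail m x powr lo)) \<partial>M)"
      proof (intro nn_integral_mono)
        fix x
        have "k x powr lo \<le> 2 powr lo * ((g x powr u x) powr lo + tail m x powr lo)"
          unfolding k_def using lo tail_pos[of m x] by (intro add_powr_le) auto
        then have "ennreal (k x powr lo) \<le> ennreal (2 powr lo * (g x powr q x + tail m x powr lo))"
          by (intro ennreal_leI) (simp add: powr_powr uq)
        then show "ennreal (k x powr lo) \<le> ennreal (2 powr lo) * (ennreal (g x powr q x) + ennreal (tail m x powr lo))"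
          by (simp add: ennreal_mult)
      qed
      also have "\<dots> = ennreal (2 powr lo) * ((\<integral>\<^sup>+x. ennreal (g x powr q x) \<partial>M) + (\<integral>\<^sup>+x. ennreal (tail m x powr lo) \<partial>M))"
        by (subst nn_integral_cmult) (auto simp: nn_integral_add)
      also have "\<dots> \<le> ennreal (2 powr lo) * (1 + ennreal e)"
        by (intro mult_left_mono add_mono g1 tail_lo) auto
      also have "\<dots> = ennreal (2 powr lo * (1 + e))" using e(2) by (simp add: ennreal_mult)
      finally show "(\<integral>\<^sup>+x. ennreal (?T k x powr lo) \<partial>M) \<le> ennreal Ks * ennreal (2 powr lo * (1 + e))"
        by (simp add: mult_left_mono)
    qed simp
    also have "\<dots> = ennreal (D * (Ks * (2 powr lo * (1 + e)) + e))"
      using D0 Ks e(2) by (simp add: ennreal_mult)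
    finally show "(\<integral>\<^sup>+x. ennreal (?T g x powr q x) \<partial>M) \<le> ennreal (D * (Ks * (2 powr lo * (1 + e)) + e))" .
  qed
qed

end

section \<open>Conjugate exponents\<close>

definition conjexp :: "real \<Rightarrow> real" where
  "conjexp t = t / (t - 1)"

lemma conjexp_gt_1: "1 < t \<Longrightarrow> 1 < conjexp t"
  by (simp add: conjexp_def)

lemma conjexp_conjexp [simp]: "1 < t \<Longrightarrow> conjexp (conjexp t) = t"
  by (simp add: conjexp_def field_simps)

lemma conjexp_antimono: "1 < s \<Longrightarrow> s \<le> t \<Longrightarrow> conjexp t \<le> conjexp s"
  by (simp add: conjexp_def field_simps)

lemma inverse_conjexp: "1 < t \<Longrightarrow> 1 / t + 1 / conjexp t = 1"
  by (simp add: conjexp_def field_simps)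

lemma mult_le_conj_powr:
  assumes "1 < p" "0 \<le> a" "0 \<le> b" shows "a * b \<le> a powr p + b powr conjexp p"
proof -
  have "a * b \<le> a powr p / p + b powr conjexp p / conjexp p"
    using assms conjexp_gt_1[OF assms(1)] inverse_conjexp[OF assms(1)] by (intro Youngs_inequality) auto
  also have "\<dots> \<le> a powr p / 1 + b powr conjexp p / 1"
    using assms conjexp_gt_1[OF assms(1)] by (intro add_mono divide_left_mono) auto
  finally show ?thesis by simp
qed

text \<open>On \<open>t >= lo\<close> the decreasing map \<open>t / (t - 1)\<close> is Lipschitz
  with constant \<open>1 / (lo - 1)^2\<close>; this is the factor in the new constant, and the two
  bounds change places.\<close>

lemma (in lh_exponent) lh_exponent_conjexp:
  assumes lo: "1 < lo"
  shows "lh_exponent (\<lambda>x. conjexp (q x)) N (conjexp qi) (conjexp hi) (conjexp lo) (CL / (lo - 1)\<^sup>2)"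
proof -
  have q1: "1 < q x" for x using lo lo_le_q[of x] by simp
  have qi1: "1 < qi" using lo lo_le_qi by simp
  have hi1: "1 < hi" using qi1 qi_le_hi by simp
  have le: "\<bar>conjexp a - conjexp b\<bar> \<le> \<bar>a - b\<bar> / (lo - 1)\<^sup>2" if "lo \<le> a" "lo \<le> b" for a b
  proof -
    have "conjexp a - conjexp b = (b - a) / ((a - 1) * (b - 1))"
      using that lo unfolding conjexp_def by (simp add: field_simps)
    then have "\<bar>conjexp a - conjexp b\<bar> = \<bar>a - b\<bar> / ((a - 1) * (b - 1))"
      using that lo by (simp add: abs_mult abs_minus_commute)
    also have "\<dots> \<le> \<bar>a - b\<bar> / (lo - 1)\<^sup>2"
      using that lo unfolding power2_eq_square by (intro divide_left_mono mult_mono mult_pos_pos) auto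
    finally show ?thesis .
  qed
  have mul: "\<bar>conjexp a - conjexp b\<bar> * l \<le> CL / (lo - 1)\<^sup>2"
    if "lo \<le> a" "lo \<le> b" "0 \<le> l" "\<bar>a - b\<bar> * l \<le> CL" for a b l
  proof -
    have "\<bar>conjexp a - conjexp b\<bar> * l \<le> \<bar>a - b\<bar> / (lo - 1)\<^sup>2 * l"
      using that le by (intro mult_right_mono) auto
    also have "\<dots> = (\<bar>a - b\<bar> * l) / (lo - 1)\<^sup>2" by simp
    also have "\<dots> \<le> CL / (lo - 1)\<^sup>2" using that by (intro divide_right_mono) auto
    finally show ?thesis .
  qed
  show ?thesis
  proof
    show "\<bar>conjexp (q x) - conjexp (q y)\<bar> * - ln (norm (x - y)) \<le> CL / (lo - 1)\<^sup>2"
      if "x \<notin> N" "y \<notin> N" "norm (x - y) < 1 / 2" for x y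
    proof (cases "x = y")
      case False
      then have "0 \<le> - ln (norm (x - y))" using that by simp
      then show ?thesis using log_Hoelder[OF that] lo_le_q by (intro mul) auto
    qed (simp add: CL_nonneg)
    show "\<bar>conjexp (q x) - conjexp qi\<bar> * logtail x \<le> CL / (lo - 1)\<^sup>2" if "x \<notin> N" for x
      using log_decay[OF that] lo_le_q lo_le_qi logtail_ge_1[of x] by (intro mul) auto
    show "(\<lambda>x. conjexp (q x)) \<in> borel_measurable lebesgue" unfolding conjexp_def by measurable
    show "1 \<le> conjexp hi" using conjexp_gt_1[OF hi1] by simp
  qed (use q1 qi1 hi1 lo lo_le_q q_le_hi lo_le_qi qi_le_hi null_N CL_nonneg in \<open>auto intro!: conjexp_antimono\<close>)
qed

section \<open>Weights satisfying the Muckenhoupt condition\<close>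

text \<open>Counterpart of \<open>logscale\<close> for upper bounds: norms over cubes grow at most
  polynomially in the radius and in the distance from the origin.\<close>

definition bigscale :: "real \<Rightarrow> 'a::euclidean_space \<Rightarrow> real" where
  "bigscale r x = ln (exp 1 + norm x + r)"

lemma logtail_le_bigscale: "0 \<le> r \<Longrightarrow> logtail x \<le> bigscale r x"
  unfolding logtail_def bigscale_def using exp_add_norm_pos[of x] by (subst ln_le_cancel_iff) (auto intro: add_pos_nonneg)

lemma bigscale_ge_1: "0 \<le> r \<Longrightarrow> 1 \<le> bigscale r x"
  using logtail_ge_1[of x] logtail_le_bigscale[of r x] by linarith

text \<open>\<open>lam c r\<close> and \<open>mu c r\<close> stand for the norms of \<open>w\<close>
  and \<open>1 / w\<close> on the cube, for the exponent \<open>q\<close> and its conjugate. Any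
  admissible scale in the definition of these norms serves, so they enter only through modulars at
  most 1; \<open>lam_mu\<close> is then the Muckenhoupt condition.\<close>

locale A_weight = lh_exponent q N qi lo hi CL
  for q :: "'a::euclidean_space \<Rightarrow> real" and N qi lo hi CL +
  fixes w :: "'a \<Rightarrow> real" and lam mu :: "'a \<Rightarrow> real \<Rightarrow> real" and CA :: real
  assumes lo_gt_1: "1 < lo"
    and w_measurable [measurable]: "w \<in> borel_measurable lebesgue" and w_pos: "0 < w x"
    and lam_pos: "0 < r \<Longrightarrow> 0 < lam c r" and mu_pos: "0 < r \<Longrightarrow> 0 < mu c r"
    and lam_modular: "0 < r \<Longrightarrow> (\<integral>\<^sup>+x\<in>cube c r. ennreal ((w x / lam c r) powr q x) \<partial>lebesgue) \<le> 1"
    and mu_modular: "0 < r \<Longrightarrow> (\<integral>\<^sup>+x\<in>cube c r. ennreal ((1 / (w x * mu c r)) powr conjexp (q x)) \<partial>lebesgue) \<le> 1"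
    and lam_mu: "0 < r \<Longrightarrow> lam c r * mu c r \<le> CA * r ^ DIM('a)"
begin

abbreviation W :: "'a measure" where
  "W \<equiv> density lebesgue (\<lambda>x. ennreal (w x powr q x))"

lemma q_gt_1: "1 < q x" using lo_gt_1 lo_le_q[of x] by linarith
lemma qi_gt_1: "1 < qi" using lo_gt_1 lo_le_qi by linarith

lemma CA_pos: "0 < CA"
proof -
  have "0 < lam 0 1 * mu 0 1" by (intro mult_pos_pos lam_pos mu_pos) auto
  with lam_mu[of 1 0] show ?thesis by simp
qed

text \<open>Interpreting this instance turns each result about \<open>W\<close> and
  \<open>lam\<close> into one about the dual measure \<open>Sg\<close> and
  \<open>mu\<close>.\<close>

lemma A_weight_dual:
  "A_weight (\<lambda>x. conjexp (q x)) N (conjexp qi) (conjexp hi) (conjexp lo) (CL / (lo - 1)\<^sup>2) (\<lambda>x. 1 / w x) mu lam CA"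
proof (intro A_weight.intro A_weight_axioms.intro)
  show "1 < conjexp hi" using qi_gt_1 qi_le_hi by (intro conjexp_gt_1) simp
  show "(\<integral>\<^sup>+x\<in>cube c r. ennreal ((1 / w x / mu c r) powr conjexp (q x)) \<partial>lebesgue) \<le> 1" if "0 < r" for c r
    using mu_modular[OF that, of c] by simp
  show "(\<integral>\<^sup>+x\<in>cube c r. ennreal ((1 / (1 / w x * lam c r)) powr conjexp (conjexp (q x))) \<partial>lebesgue) \<le> 1" if "0 < r" for c r
    using lam_modular[OF that, of c] q_gt_1 by simp
  show "mu c r * lam c r \<le> CA * r ^ DIM('a)" if "0 < r" for c r using lam_mu[OF that, of c] by (simp add: mult.commute)
qed (use lh_exponent_conjexp[OF lo_gt_1] w_pos lam_pos mu_pos in auto)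

lemma nn_integral_W:
  "f \<in> borel_measurable lebesgue \<Longrightarrow> (\<integral>\<^sup>+x. f x \<partial>W) = (\<integral>\<^sup>+x. ennreal (w x powr q x) * f x \<partial>lebesgue)"
  by (subst nn_integral_density) auto

text \<open>Hoelder's inequality for \<open>1 = w * (1 / w)\<close> in modular form: Young's
  inequality after division by \<open>lam\<close> and \<open>mu\<close>, whence the factor 2. The
  two larger cubes may differ, which \<open>lam_lower\<close> exploits.\<close>

lemma cube_measure_le:
  assumes "0 < r" "0 < r1" "0 < r2" "cube c r \<subseteq> cube c1 r1" "cube c r \<subseteq> cube c2 r2"
  shows "(2 * r) ^ DIM('a) \<le> 2 * (lam c1 r1 * mu c2 r2)"
proof -
  define l where "l = lam c1 r1"
  define m where "m = mu c2 r2"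
  have lm: "0 < l" "0 < m" unfolding l_def m_def using assms lam_pos mu_pos by auto
  have "ennreal ((2 * r) ^ DIM('a)) = (\<integral>\<^sup>+x. indicator (cube c r) x \<partial>lebesgue)"
    using assms(1) emeasure_cube[of r c] by simp
  also have "\<dots> \<le> (\<integral>\<^sup>+x. ennreal (l * m) * (ennreal ((w x / l) powr q x) * indicator (cube c1 r1) x
      + ennreal ((1 / (w x * m)) powr conjexp (q x)) * indicator (cube c2 r2) x) \<partial>lebesgue)"
  proof (intro nn_integral_mono)
    fix x
    show "indicator (cube c r) x \<le> ennreal (l * m) * (ennreal ((w x / l) powr q x) * indicator (cube c1 r1) x
      + ennreal ((1 / (w x * m)) powr conjexp (q x)) * indicator (cube c2 r2) x)"
    proof (cases "x \<in> cube c r")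
      case True
      have "l * m * ((w x / l) * (1 / (w x * m))) \<le> l * m * ((w x / l) powr q x + (1 / (w x * m)) powr conjexp (q x))"
        using lm w_pos[of x] q_gt_1[of x] by (intro mult_left_mono mult_le_conj_powr) auto
      moreover have "l * m * ((w x / l) * (1 / (w x * m))) = 1" using lm w_pos[of x] by simp
      ultimately have "ennreal 1 \<le> ennreal (l * m * ((w x / l) powr q x + (1 / (w x * m)) powr conjexp (q x)))"
        by (intro ennreal_leI) simp
      also have "\<dots> = ennreal (l * m) * (ennreal ((w x / l) powr q x) + ennreal ((1 / (w x * m)) powr conjexp (q x)))"
        using lm by (simp add: ennreal_mult)
      finally show ?thesis using True assms(4,5) by (auto simp: indicator_def)
    qed simp
  qed
  also have "\<dots> = ennreal (l * m) * ((\<integral>\<^sup>+x\<in>cube c1 r1. ennreal ((w x / l) powr q x) \<partial>lebesgue)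
      + (\<integral>\<^sup>+x\<in>cube c2 r2. ennreal ((1 / (w x * m)) powr conjexp (q x)) \<partial>lebesgue))"
    unfolding conjexp_def by (subst nn_integral_cmult, measurable) (subst nn_integral_add, auto)
  also have "\<dots> \<le> ennreal (l * m) * (1 + 1)"
    using assms(2,3) unfolding l_def m_def by (intro mult_left_mono add_mono lam_modular mu_modular) auto
  also have "\<dots> = ennreal (2 * (l * m))" using lm by (simp add: ennreal_mult mult.commute)
  finally show ?thesis using lm unfolding l_def m_def by (subst (asm) ennreal_le_iff) auto
qed

lemma cube_subset_origin:
  fixes x :: 'a
  assumes "x \<in> cube c r" "0 < r" shows "cube c r \<subseteq> cube 0 (norm x + 2 * r + 1)"
proof
  fix y assume y: "y \<in> cube c r"
  show "y \<in> cube 0 (norm x + 2 * r + 1)" unfolding mem_cube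
  proof
    fix i :: 'a assume i: "i \<in> Basis"
    have "\<bar>x \<bullet> i\<bar> \<le> norm x" using i by (rule Basis_le_norm)
    moreover have "\<bar>x \<bullet> i - c \<bullet> i\<bar> \<le> r" "\<bar>y \<bullet> i - c \<bullet> i\<bar> \<le> r" using assms y i unfolding mem_cube by auto
    ultimately show "\<bar>y \<bullet> i - 0 \<bullet> i\<bar> \<le> norm x + 2 * r + 1" unfolding inner_zero_left by linarith
  qed
qed

text \<open>The cube \<open>cube 0 R\<close> contains both the given cube and
  \<open>cube 0 1\<close>. By \<open>cube_measure_le\<close> their measures are at most
  \<open>2 * lam c r * mu 0 R\<close> and \<open>2 * lam 0 R * mu 0 1\<close>; in the product of the
  two bounds, \<open>lam 0 R * mu 0 R\<close> is eliminated by the Muckenhoupt condition on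
  \<open>cube 0 R\<close>.\<close>

lemma lam_lower:
  "\<exists>k>0. \<forall>c r x. 0 < r \<longrightarrow> x \<in> cube c r \<longrightarrow> k * (r / (norm x + 2 * r + 1)) ^ DIM('a) \<le> lam c r"
proof (intro exI[of _ "4 ^ DIM('a) / (4 * CA * mu 0 1)"] conjI allI impI)
  have mu1: "0 < mu 0 1" using mu_pos by simp
  then show "0 < 4 ^ DIM('a) / (4 * CA * mu 0 1)" using CA_pos by simp
  fix c :: 'a and r x assume r: "0 < r" and x: "x \<in> cube c r"
  define R where "R = norm x + 2 * r + 1"
  have R: "1 \<le> R" "cube c r \<subseteq> cube 0 R" using r cube_subset_origin[OF x r] by (auto simp: R_def)
  have R': "0 < R" using R by simp
  have RD: "0 < R ^ DIM('a)" using R' by simp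
  have a1: "2 ^ DIM('a) \<le> 2 * (lam 0 R * mu 0 1)"
    using R cube_mono[of 1 R "0::'a"] cube_measure_le[of 1 R 1 0 0 0] by auto
  have a2: "(2 * r) ^ DIM('a) \<le> 2 * (lam c r * mu 0 R)"
    using R r by (intro cube_measure_le[of r r R c c 0]) auto
  have lR: "0 < lam 0 R" using R lam_pos by simp
  have lc: "0 < lam c r" using r lam_pos by simp
  have "(2 * r) ^ DIM('a) * 2 ^ DIM('a) \<le> (2 * (lam c r * mu 0 R)) * (2 * (lam 0 R * mu 0 1))"
    using a1 a2 r lc mu_pos[of R 0] R by (intro mult_mono) auto
  also have "\<dots> = 4 * lam c r * mu 0 1 * (lam 0 R * mu 0 R)" by simp
  also have "\<dots> \<le> 4 * lam c r * mu 0 1 * (CA * R ^ DIM('a))"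
    using lc mu1 R by (intro mult_left_mono lam_mu) auto
  finally have "4 ^ DIM('a) * r ^ DIM('a) \<le> lam c r * (4 * CA * mu 0 1 * R ^ DIM('a))"
    by (simp add: power_mult_distrib algebra_simps flip: power_mult_distrib[of 2 2])
  then have "4 ^ DIM('a) * r ^ DIM('a) / (4 * CA * mu 0 1 * R ^ DIM('a)) \<le> lam c r"
    using CA_pos mu1 R' by (subst pos_divide_le_eq) auto
  moreover have "4 ^ DIM('a) / (4 * CA * mu 0 1) * (r / R) ^ DIM('a) = 4 ^ DIM('a) * r ^ DIM('a) / (4 * CA * mu 0 1 * R ^ DIM('a))"
    by (simp add: power_divide)
  ultimately show "4 ^ DIM('a) / (4 * CA * mu 0 1) * (r / (norm x + 2 * r + 1)) ^ DIM('a) \<le> lam c r"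
    unfolding R_def by simp
qed

text \<open>The upper bound is the lower bound for \<open>mu\<close>, from the dual instance,
  inserted in \<open>lam_mu\<close>. Squaring the argument of the logarithm absorbs the numerical
  factors, whence the summand \<open>2 * d\<close> in \<open>B\<close>.\<close>

lemma lam_bounds:
  "\<exists>B\<ge>0. \<forall>c r x. 0 < r \<longrightarrow> x \<in> cube c r \<longrightarrow> - B * logscale r x \<le> ln (lam c r) \<and> ln (lam c r) \<le> B * bigscale r x"
proof -
  interpret dual: A_weight "\<lambda>x. conjexp (q x)" N "conjexp qi" "conjexp hi" "conjexp lo" "CL / (lo - 1)\<^sup>2" "\<lambda>x. 1 / w x" mu lam CA
    by (rule A_weight_dual)
  obtain k where k: "0 < k" "\<And>c r x. 0 < r \<Longrightarrow> x \<in> cube c r \<Longrightarrow> k * (r / (norm x + 2 * r + 1)) ^ DIM('a) \<le> lam c r"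
    using lam_lower by metis
  obtain k' where k': "0 < k'" "\<And>c r x. 0 < r \<Longrightarrow> x \<in> cube c r \<Longrightarrow> k' * (r / (norm x + 2 * r + 1)) ^ DIM('a) \<le> mu c r"
    using dual.lam_lower by metis
  define d where "d = real DIM('a)"
  have d0: "0 \<le> d" by (simp add: d_def)
  define B where "B = \<bar>ln k\<bar> + \<bar>ln (CA / k')\<bar> + 2 * d"
  have "- B * logscale r x \<le> ln (lam c r) \<and> ln (lam c r) \<le> B * bigscale r x" if r: "0 < r" and x: "x \<in> cube c r" for c r x
  proof
    define R where "R = norm x + 2 * r + 1"
    have R: "0 < R" using r by (simp add: R_def add_nonneg_pos)
    have lc: "0 < lam c r" using r lam_pos by simp
    have L1: "1 \<le> logscale r x" using r by (rule logscale_ge_1)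
    have L2: "1 \<le> bigscale r x" using r by (intro bigscale_ge_1) simp
    have S0: "0 < exp 1 + norm x + 1 / r" using exp_add_norm_pos[of x] r by (simp add: add_pos_pos)
    have e2: "(2::real) \<le> exp 1" using exp_ge_add_one_self[of 1] by simp
    have "R / r \<le> (exp 1 + norm x + 1 / r)\<^sup>2"
    proof -
      have "R / r = (norm x + 1) * (1 / r) + 2" using r by (simp add: R_def field_simps)
      also have "\<dots> \<le> 2 * (exp 1 + norm x) * (1 / r) + 2 * 2"
      proof (intro add_mono mult_right_mono)
        show "norm x + 1 \<le> 2 * (exp 1 + norm x)" using e2 norm_ge_zero[of x] unfolding distrib_left by linarith
      qed (use r in auto)
      also have "\<dots> \<le> 2 * (exp 1 + norm x) * (1 / r) + (exp 1 + norm x) * (exp 1 + norm x)"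
        using e2 norm_ge_zero[of x] by (intro add_left_mono mult_mono) linarith+
      also have "\<dots> \<le> (exp 1 + norm x + 1 / r)\<^sup>2" using r by (simp add: power2_eq_square algebra_simps)
      finally show ?thesis .
    qed
    then have "ln (R / r) \<le> ln ((exp 1 + norm x + 1 / r)\<^sup>2)" using S0 R r by (subst ln_le_cancel_iff) auto
    also have "\<dots> = 2 * logscale r x" unfolding logscale_def using S0 by (simp add: ln_realpow)
    finally have lnR: "ln (R / r) \<le> 2 * logscale r x" .
    have "ln (k * (r / R) ^ DIM('a)) \<le> ln (lam c r)"
      using k(2)[OF r x] k(1) r R lc unfolding R_def by (subst ln_le_cancel_iff) auto
    moreover have "ln (k * (r / R) ^ DIM('a)) = ln k - d * ln (R / r)"
      using k(1) r R by (simp add: ln_mult_pos ln_realpow ln_div d_def algebra_simps)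
    moreover have "d * ln (R / r) \<le> d * (2 * logscale r x)" using lnR d0 by (rule mult_left_mono)
    moreover have "\<bar>ln k\<bar> * 1 \<le> \<bar>ln k\<bar> * logscale r x" "0 \<le> \<bar>ln (CA / k')\<bar> * logscale r x"
      using L1 mult_left_mono[OF L1, of "\<bar>ln k\<bar>"] by auto
    ultimately show "- B * logscale r x \<le> ln (lam c r)" unfolding B_def by (simp add: algebra_simps; linarith)
    have mc: "0 < mu c r" using r mu_pos by simp
    have "lam c r * (k' * (r / R) ^ DIM('a)) \<le> lam c r * mu c r"
      using k'(2)[OF r x] lc unfolding R_def by (intro mult_left_mono) auto
    also have "\<dots> \<le> CA * r ^ DIM('a)" by (rule lam_mu[OF r])
    finally have "lam c r \<le> CA / k' * R ^ DIM('a)"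
      using r R k'(1) by (simp add: power_divide field_simps)
    then have "ln (lam c r) \<le> ln (CA / k' * R ^ DIM('a))" using lc CA_pos k'(1) R by (subst ln_le_cancel_iff) auto
    also have "\<dots> = ln (CA / k') + d * ln R" using CA_pos k'(1) R by (subst ln_mult_pos) (auto simp: ln_realpow d_def)
    also have "ln R \<le> 2 * bigscale r x"
    proof -
      have S: "2 \<le> exp 1 + norm x + r" using e2 norm_ge_zero[of x] r by linarith
      have "R \<le> 2 * (exp 1 + norm x + r)" using e2 norm_ge_zero[of x] r unfolding R_def by (simp add: algebra_simps; linarith)
      also have "\<dots> \<le> (exp 1 + norm x + r)\<^sup>2" unfolding power2_eq_square using S by (intro mult_right_mono) auto
      finally have "ln R \<le> ln ((exp 1 + norm x + r)\<^sup>2)" using R S by (subst ln_le_cancel_iff) auto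
      also have "\<dots> = 2 * bigscale r x" unfolding bigscale_def using S by (simp add: ln_realpow)
      finally show ?thesis .
    qed
    then have "ln (CA / k') + d * ln R \<le> ln (CA / k') + d * (2 * bigscale r x)" using d0 by (intro add_left_mono mult_left_mono)
    also have "\<dots> \<le> B * bigscale r x"
    proof -
      have "\<bar>ln (CA / k')\<bar> * 1 \<le> \<bar>ln (CA / k')\<bar> * bigscale r x" "0 \<le> \<bar>ln k\<bar> * bigscale r x"
        using L2 mult_left_mono[OF L2, of "\<bar>ln (CA / k')\<bar>"] by auto
      then show ?thesis unfolding B_def by (simp add: algebra_simps; linarith)
    qed
    finally show "ln (lam c r) \<le> B * bigscale r x" .
  qed
  moreover have "0 \<le> B" using d0 by (simp add: B_def)
  ultimately show ?thesis by blast
qed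

text \<open>Crude, as it uses the largest exponent, but enough for finiteness on cubes and
  polynomial growth. Bounds with the right exponent come once a tail is known to be
  integrable.\<close>

lemma W_cube_le:
  assumes "0 < r" shows "emeasure W (cube c r) \<le> ennreal (max 1 (lam c r) powr hi)"
proof -
  have l: "0 < lam c r" using lam_pos assms .
  have "emeasure W (cube c r) = (\<integral>\<^sup>+x\<in>cube c r. ennreal (w x powr q x) \<partial>lebesgue)"
    by (subst emeasure_density) auto
  also have "\<dots> \<le> (\<integral>\<^sup>+x. ennreal (max 1 (lam c r) powr hi) * (ennreal ((w x / lam c r) powr q x) * indicator (cube c r) x) \<partial>lebesgue)"
  proof (intro nn_integral_mono)
    fix x
    have "w x powr q x = lam c r powr q x * (w x / lam c r) powr q x"
      using l w_pos[of x] by (simp add: powr_divide)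
    also have "lam c r powr q x \<le> max 1 (lam c r) powr q x"
      using l q_ge_1[of x] by (intro powr_mono2) auto
    also have "max 1 (lam c r) powr q x \<le> max 1 (lam c r) powr hi"
      using q_le_hi by (intro powr_mono) auto
    finally have "w x powr q x \<le> max 1 (lam c r) powr hi * (w x / lam c r) powr q x"
      by (simp add: mult_right_mono)
    then have "ennreal (w x powr q x) \<le> ennreal (max 1 (lam c r) powr hi * (w x / lam c r) powr q x)"
      by (rule ennreal_leI)
    then show "ennreal (w x powr q x) * indicator (cube c r) x
        \<le> ennreal (max 1 (lam c r) powr hi) * (ennreal ((w x / lam c r) powr q x) * indicator (cube c r) x)"
      by (auto simp: indicator_def ennreal_mult)
  qed
  also have "\<dots> = ennreal (max 1 (lam c r) powr hi) * (\<integral>\<^sup>+x\<in>cube c r. ennreal ((w x / lam c r) powr q x) \<partial>lebesgue)"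
    by (subst nn_integral_cmult) auto
  also have "\<dots> \<le> ennreal (max 1 (lam c r) powr hi) * 1"
    by (intro mult_left_mono lam_modular assms) auto
  finally show ?thesis by simp
qed

lemma cube_measure_W: "cube_measure W"
proof
  show "sets W = sets lebesgue" by simp
  show "emeasure W (cube c r) < \<infinity>" for c r
  proof (cases "0 < r")
    case True
    show ?thesis using W_cube_le[OF True, of c] by (rule le_less_trans) simp
  next
    case False
    have "emeasure W (cube c r) \<le> emeasure W (cube c 1)"
      using False by (intro emeasure_mono cube_mono) auto
    also have "\<dots> < \<infinity>" using W_cube_le[of 1 c] by (rule le_less_trans) auto
    finally show ?thesis .
  qed
  show "0 < emeasure W (cube c r)" if "0 < r" for c r
  proof (rule ccontr)
    assume "\<not> 0 < emeasure W (cube c r)"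
    then have "cube c r \<in> null_sets W" by (auto simp: null_sets_def)
    then have "AE x in lebesgue. x \<in> cube c r \<longrightarrow> ennreal (w x powr q x) = 0"
      by (subst (asm) null_sets_density_iff) auto
    then have "AE x in lebesgue. x \<notin> cube c r"
      by eventually_elim (use w_pos in \<open>auto simp: less_le\<close>)
    then have "cube c r \<in> null_sets lebesgue" using AE_iff_null_sets[of "cube c r" lebesgue] by simp
    from null_setsD1[OF this] show False using that by (subst (asm) emeasure_cube) auto
  qed
qed

lemma absolutely_continuous_W: "absolutely_continuous lebesgue W"
  by (rule absolutely_continuousI_density) measurable

text \<open>If the measure \<open>V\<close> of the cube is below 1, then
  \<open>t = V powr (1 / hi)\<close> replaces the norm of \<open>w\<close>: as
  \<open>t <= 1\<close>, the modular of \<open>w / t\<close> on the cube is at most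
  \<open>V / V = 1\<close>. Hoelder's inequality against \<open>mu\<close> bounds \<open>lam\<close>
  by a multiple of \<open>t\<close>, and the lower bound for \<open>lam\<close> passes to
  \<open>V\<close>.\<close>

lemma W_lower: "\<exists>B\<ge>0. \<forall>c r x. 0 < r \<longrightarrow> x \<in> cube c r \<longrightarrow> - B * logscale r x \<le> ln (measure W (cube c r))"
proof -
  interpret cube_measure W by (rule cube_measure_W)
  obtain B where B: "0 \<le> B" "\<And>c r x. 0 < r \<Longrightarrow> x \<in> cube c r \<Longrightarrow> - B * logscale r x \<le> ln (lam c r)"
    using lam_bounds by metis
  define b where "b = ln (2 ^ DIM('a) / (2 * CA))"
  have hi: "1 \<le> hi" by (rule hi_ge_1)
  have "- (hi * (\<bar>b\<bar> + B)) * logscale r x \<le> ln (measure W (cube c r))" if r: "0 < r" and x: "x \<in> cube c r" for c r x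
  proof -
    define V where "V = measure W (cube c r)"
    have V: "0 < V" unfolding V_def using r by (rule measure_cube_pos)
    have L1: "1 \<le> logscale r x" using r by (rule logscale_ge_1)
    have lc: "0 < lam c r" and mc: "0 < mu c r" using r lam_pos mu_pos by auto
    show ?thesis
    proof (cases "1 \<le> V")
      case True
      then have "0 \<le> ln V" by simp
      moreover have "0 \<le> (hi * (\<bar>b\<bar> + B)) * logscale r x" using hi B(1) L1 by simp
      ultimately show ?thesis unfolding V_def by (simp only: mult_minus_left)
    next
      case False
      define t where "t = V powr (1 / hi)"
      have t: "0 < t" "t \<le> 1" using V False hi by (auto simp: t_def intro: powr_le1)
      have tV: "t powr hi = V" unfolding t_def using V hi by (simp add: powr_powr)
      have "ennreal ((2 * r) ^ DIM('a)) = (\<integral>\<^sup>+x. indicator (cube c r) x \<partial>lebesgue)"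
        using r emeasure_cube[of r c] by simp
      also have "\<dots> \<le> (\<integral>\<^sup>+x. ennreal (t * mu c r) * (ennreal (1 / V) * (ennreal (w x powr q x) * indicator (cube c r) x)
          + ennreal ((1 / (w x * mu c r)) powr conjexp (q x)) * indicator (cube c r) x) \<partial>lebesgue)"
      proof (intro nn_integral_mono)
        fix x
        have "t * mu c r * ((w x / t) * (1 / (w x * mu c r))) \<le> t * mu c r * ((w x / t) powr q x + (1 / (w x * mu c r)) powr conjexp (q x))"
          using t mc w_pos[of x] q_gt_1[of x] by (intro mult_left_mono mult_le_conj_powr) auto
        also have "(w x / t) powr q x = w x powr q x / t powr q x" using w_pos[of x] t by (simp add: powr_divide)
        also have "\<dots> \<le> w x powr q x / t powr hi"
          using t q_ge_1[of x] q_le_hi[of x] by (intro divide_left_mono powr_le_powr_self) auto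
        finally have "t * mu c r * ((w x / t) * (1 / (w x * mu c r))) \<le> t * mu c r * (1 / V * w x powr q x + (1 / (w x * mu c r)) powr conjexp (q x))"
          unfolding tV using t mc by (simp add: mult_left_mono)
        moreover have "t * mu c r * ((w x / t) * (1 / (w x * mu c r))) = 1" using t mc w_pos[of x] by simp
        ultimately have "ennreal 1 \<le> ennreal (t * mu c r * (1 / V * w x powr q x + (1 / (w x * mu c r)) powr conjexp (q x)))"
          by (intro ennreal_leI) simp
        also have "\<dots> = ennreal (t * mu c r) * (ennreal (1 / V) * ennreal (w x powr q x) + ennreal ((1 / (w x * mu c r)) powr conjexp (q x)))"
          using t mc V by (simp only: ennreal_mult ennreal_plus less_imp_le mult_nonneg_nonneg
            add_nonneg_nonneg powr_ge_zero zero_le_divide_1_iff)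
        finally show "indicator (cube c r) x \<le> ennreal (t * mu c r) * (ennreal (1 / V) * (ennreal (w x powr q x) * indicator (cube c r) x)
          + ennreal ((1 / (w x * mu c r)) powr conjexp (q x)) * indicator (cube c r) x)"
          by (auto simp: indicator_def)
      qed
      also have "\<dots> = ennreal (t * mu c r) * (ennreal (1 / V) * (\<integral>\<^sup>+x\<in>cube c r. ennreal (w x powr q x) \<partial>lebesgue)
          + (\<integral>\<^sup>+x\<in>cube c r. ennreal ((1 / (w x * mu c r)) powr conjexp (q x)) \<partial>lebesgue))"
        unfolding conjexp_def by (subst nn_integral_cmult, measurable) (subst nn_integral_add, auto simp: nn_integral_cmult)
      also have "(\<integral>\<^sup>+x\<in>cube c r. ennreal (w x powr q x) \<partial>lebesgue) = ennreal V"
        unfolding V_def emeasure_cube_eq[symmetric] by (subst emeasure_density) auto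
      also have "ennreal (t * mu c r) * (ennreal (1 / V) * ennreal V
          + (\<integral>\<^sup>+x\<in>cube c r. ennreal ((1 / (w x * mu c r)) powr conjexp (q x)) \<partial>lebesgue)) \<le> ennreal (t * mu c r) * (1 + 1)"
        using V by (intro mult_left_mono add_mono mu_modular r) (auto simp flip: ennreal_mult)
      also have "\<dots> = ennreal (2 * (t * mu c r))" using t mc by (simp add: ennreal_mult mult.commute)
      finally have "(2 * r) ^ DIM('a) \<le> 2 * (t * mu c r)" using t mc by (subst (asm) ennreal_le_iff) auto
      then have "(2 * r) ^ DIM('a) * lam c r \<le> 2 * (t * mu c r) * lam c r" using lc by (intro mult_right_mono) auto
      also have "\<dots> = 2 * t * (lam c r * mu c r)" by simp
      also have "\<dots> \<le> 2 * t * (CA * r ^ DIM('a))" using t by (intro mult_left_mono lam_mu r) auto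
      finally have "2 ^ DIM('a) / (2 * CA) * lam c r \<le> t"
        using r CA_pos by (simp add: power_mult_distrib field_simps)
      then have "ln (2 ^ DIM('a) / (2 * CA) * lam c r) \<le> ln t"
        using t lc CA_pos by (subst ln_le_cancel_iff) auto
      also have "ln (2 ^ DIM('a) / (2 * CA) * lam c r) = b + ln (lam c r)"
        unfolding b_def using lc CA_pos by (intro ln_mult_pos) auto
      also have "ln t = ln V / hi" unfolding t_def using V by (simp add: ln_powr)
      finally have "hi * (b + ln (lam c r)) \<le> ln V" using hi by (simp add: field_simps)
      moreover have "hi * (- \<bar>b\<bar> * logscale r x + - B * logscale r x) \<le> hi * (b + ln (lam c r))"
      proof (intro mult_left_mono add_mono B(2) r x)
        have "\<bar>b\<bar> * 1 \<le> \<bar>b\<bar> * logscale r x" using L1 by (intro mult_left_mono) auto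
        then show "- \<bar>b\<bar> * logscale r x \<le> b" by simp
      qed (use hi in simp)
      ultimately show ?thesis unfolding V_def by (simp add: algebra_simps)
    qed
  qed
  moreover have "0 \<le> hi * (\<bar>b\<bar> + B)" using hi B(1) by simp
  ultimately show ?thesis by blast
qed

text \<open>The cube of radius \<open>n + 1\<close> about the origin has measure at most
  \<open>(exp 1 + n + 1) powr (B * hi)\<close>, so the exponent \<open>B * hi + 2\<close> of the
  tail leaves a series of inverse squares.\<close>

lemma tail_integrable: "\<exists>m\<ge>0. (\<integral>\<^sup>+x. ennreal (tail m x) \<partial>W) < \<infinity>"
proof -
  interpret cube_measure W by (rule cube_measure_W)
  obtain B where B: "0 \<le> B" "\<And>c r x. 0 < r \<Longrightarrow> x \<in> cube c r \<Longrightarrow> ln (lam c r) \<le> B * bigscale r x"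
    using lam_bounds by metis
  define m where "m = B * hi + 2"
  have m: "0 \<le> m" unfolding m_def using B(1) hi_ge_1 by simp
  define A where "A n = cube (0::'a) (real n + 1)" for n
  define a where "a n = (exp 1 + real n) powr (- m)" for n
  have mA: "emeasure W (A n) \<le> ennreal ((exp 1 + (real n + 1)) powr (B * hi))" for n
  proof -
    define l where "l = lam (0::'a) (real n + 1)"
    have l: "0 < l" unfolding l_def by (rule lam_pos) simp
    have "ln l \<le> B * bigscale (real n + 1) (0::'a)" unfolding l_def by (intro B(2) cube_center) auto
    then have "ln l \<le> B * ln (exp 1 + (real n + 1))" by (simp add: bigscale_def)
    then have "exp (ln l) \<le> exp (B * ln (exp 1 + (real n + 1)))" by simp
    then have "l \<le> (exp 1 + (real n + 1)) powr B" using l exp_gt_zero[of "1::real"] unfolding powr_def by (simp del: exp_gt_zero)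
    moreover have "1 \<le> (exp 1 + (real n + 1)) powr B" using B(1) by (intro ge_one_powr_ge_zero) (auto simp: add_increasing)
    ultimately have "max 1 l powr hi \<le> ((exp 1 + (real n + 1)) powr B) powr hi"
      using hi_ge_1 by (intro powr_mono2) auto
    then have "ennreal (max 1 l powr hi) \<le> ennreal ((exp 1 + (real n + 1)) powr (B * hi))"
      by (intro ennreal_leI) (simp add: powr_powr)
    with W_cube_le[of "real n + 1" 0] show ?thesis unfolding A_def l_def by (auto intro: order_trans)
  qed
  have "(\<integral>\<^sup>+x. ennreal (tail m x) \<partial>W) \<le> (\<integral>\<^sup>+x. (\<Sum>n. ennreal (a n) * indicator (A n) x) \<partial>W)"
  proof (intro nn_integral_mono)
    fix x :: 'a
    define n where "n = nat \<lfloor>norm x\<rfloor>"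
    have n: "real n \<le> norm x" "norm x \<le> real n + 1" unfolding n_def by (auto simp: of_nat_nat)
    have "x \<in> A n" unfolding A_def mem_cube using Basis_le_norm[of _ x] n by (auto intro: order_trans)
    moreover have "tail m x \<le> a n" unfolding tail_def a_def
      using n m by (intro powr_mono2') (auto simp: add_pos_nonneg)
    ultimately have "ennreal (tail m x) \<le> ennreal (a n) * indicator (A n) x" by (simp add: ennreal_leI)
    also have "\<dots> = (\<Sum>n\<in>{n}. ennreal (a n) * indicator (A n) x)"
      by (subst sum.insert) (simp_all only: finite.emptyI sum.empty add_0_right empty_iff not_False_eq_True)
    also have "\<dots> \<le> (\<Sum>n. ennreal (a n) * indicator (A n) x)" by (intro sum_le_suminf) auto
    finally show "ennreal (tail m x) \<le> (\<Sum>n. ennreal (a n) * indicator (A n) x)" .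
  qed
  also have "\<dots> = (\<Sum>n. ennreal (a n) * emeasure W (A n))"
    unfolding A_def by (subst nn_integral_suminf) (auto simp: nn_integral_cmult_indicator)
  also have "\<dots> \<le> (\<Sum>n. ennreal (2 powr (B * hi) * (1 / (real (Suc n))\<^sup>2)))"
  proof (intro suminf_le)
    fix n
    have e1: "(1::real) \<le> exp 1" by simp
    have "ennreal (a n) * emeasure W (A n) \<le> ennreal (a n) * ennreal ((exp 1 + (real n + 1)) powr (B * hi))"
      by (intro mult_left_mono mA) auto
    also have "\<dots> = ennreal (a n * (exp 1 + (real n + 1)) powr (B * hi))" by (simp add: ennreal_mult a_def)
    also have "\<dots> \<le> ennreal (2 powr (B * hi) * (1 / (real (Suc n))\<^sup>2))"
    proof (intro ennreal_leI)
      let ?s = "exp 1 + real n"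
      have s: "0 < ?s" by (simp add: add_pos_nonneg)
      have "(exp 1 + (real n + 1)) powr (B * hi) \<le> (2 * ?s) powr (B * hi)"
        using B(1) hi_ge_1 e1 by (intro powr_mono2) (auto simp: add_increasing)
      then have "a n * (exp 1 + (real n + 1)) powr (B * hi) \<le> a n * (2 * ?s) powr (B * hi)"
        by (intro mult_left_mono) (auto simp: a_def)
      also have "\<dots> = 2 powr (B * hi) * (?s powr (- m) * ?s powr (B * hi))"
        unfolding a_def by (subst powr_mult) (use s in \<open>simp_all only: mult_ac less_imp_le zero_le_numeral\<close>)
      also have "?s powr (- m) * ?s powr (B * hi) = ?s powr (- 2)" by (simp add: m_def flip: powr_add)
      also have "?s powr (- 2) \<le> real (Suc n) powr (- 2)"
        using e1 by (intro powr_mono2') auto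
      also have "real (Suc n) powr (- 2) = 1 / (real (Suc n))\<^sup>2" by (simp add: powr_minus_divide powr_numeral)
      finally show "a n * (exp 1 + (real n + 1)) powr (B * hi) \<le> 2 powr (B * hi) * (1 / (real (Suc n))\<^sup>2)"
        by (simp add: mult_left_mono)
    qed
    finally show "ennreal (a n) * emeasure W (A n) \<le> ennreal (2 powr (B * hi) * (1 / (real (Suc n))\<^sup>2))" .
  qed auto
  also have "\<dots> < \<infinity>"
  proof -
    have "summable (\<lambda>n. 2 powr (B * hi) * (1 / (real (Suc n))\<^sup>2))"
      using inverse_power_summable[of 2, where ?'a = real] summable_Suc_iff[of "\<lambda>n. 1 / (real n)\<^sup>2"]
      by (intro summable_mult) (simp add: inverse_eq_divide del: of_nat_Suc)
    then show ?thesis by (subst suminf_ennreal2) auto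
  qed
  finally show ?thesis using m by blast
qed


text \<open>The exchange \<open>pw\<close> is multiplied by \<open>w powr q\<close> and integrated
  over the cube: its first term becomes a modular, at most 1, and its second is dominated by the
  integral \<open>e\<close> of the tail.\<close>

lemma W_cube_le_powr:
  assumes r: "0 < r" and C: "0 \<le> C" and e: "(\<integral>\<^sup>+x. ennreal (tail m x) \<partial>W) = ennreal e" "0 \<le> e"
    and pw: "\<And>y. y \<in> cube c r \<Longrightarrow> y \<notin> N \<Longrightarrow> (1 / lam c r) powr b \<le> C * (1 / lam c r) powr q y + tail m y"
  shows "measure W (cube c r) \<le> (C + e) * lam c r powr b"
proof -
  interpret cube_measure W by (rule cube_measure_W)
  define l where "l = lam c r"
  have l: "0 < l" unfolding l_def using r by (rule lam_pos)
  define V where "V = measure W (cube c r)"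
  have V: "0 \<le> V" by (simp add: V_def)
  have "ennreal ((1 / l) powr b * V) = ennreal ((1 / l) powr b) * (\<integral>\<^sup>+x\<in>cube c r. ennreal (w x powr q x) \<partial>lebesgue)"
    unfolding V_def by (subst ennreal_mult) (auto simp: emeasure_cube_eq[symmetric] emeasure_density)
  also have "\<dots> = (\<integral>\<^sup>+x. ennreal ((1 / l) powr b) * (ennreal (w x powr q x) * indicator (cube c r) x) \<partial>lebesgue)"
    by (subst nn_integral_cmult) auto
  also have "\<dots> \<le> (\<integral>\<^sup>+x. ennreal C * (ennreal ((w x / l) powr q x) * indicator (cube c r) x) + ennreal (w x powr q x) * ennreal (tail m x) \<partial>lebesgue)"
  proof (intro nn_integral_mono_AE)
    show "AE x in lebesgue. ennreal ((1 / l) powr b) * (ennreal (w x powr q x) * indicator (cube c r) x)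
      \<le> ennreal C * (ennreal ((w x / l) powr q x) * indicator (cube c r) x) + ennreal (w x powr q x) * ennreal (tail m x)"
      using AE_not_N
    proof eventually_elim
      case (elim x)
      show ?case
      proof (cases "x \<in> cube c r")
        case True
        have "(1 / l) powr b * w x powr q x \<le> (C * (1 / l) powr q x + tail m x) * w x powr q x"
          using pw[OF True elim] unfolding l_def by (intro mult_right_mono) auto
        also have "\<dots> = C * (w x / l) powr q x + w x powr q x * tail m x"
          using l w_pos[of x] by (simp add: powr_divide algebra_simps)
        finally have "ennreal ((1 / l) powr b * w x powr q x) \<le> ennreal (C * (w x / l) powr q x + w x powr q x * tail m x)"
          by (rule ennreal_leI)
        also have "\<dots> = ennreal C * ennreal ((w x / l) powr q x) + ennreal (w x powr q x) * ennreal (tail m x)"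
          using C tail_pos[of m x] by (subst ennreal_plus) (auto simp: ennreal_mult)
        finally show ?thesis using True by (simp add: ennreal_mult)
      qed simp
    qed
  qed
  also have "\<dots> = ennreal C * (\<integral>\<^sup>+x\<in>cube c r. ennreal ((w x / l) powr q x) \<partial>lebesgue) + (\<integral>\<^sup>+x. ennreal (tail m x) \<partial>W)"
    by (subst nn_integral_add) (auto simp: nn_integral_cmult nn_integral_W)
  also have "\<dots> \<le> ennreal C * 1 + ennreal e"
    unfolding e(1) l_def by (intro add_right_mono mult_left_mono lam_modular r) auto
  also have "\<dots> = ennreal (C + e)" using C e by simp
  finally have "(1 / l) powr b * V \<le> C + e" using C e by (subst (asm) ennreal_le_iff) auto
  then show ?thesis using l unfolding V_def[symmetric] l_def[symmetric] by (simp add: powr_divide field_simps)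
qed

text \<open>For radius at most 1, \<open>bigscale\<close> is below \<open>logscale\<close>, so
  \<open>\<bar>ln (lam c r)\<bar>\<close> is at most a multiple of the scale in
  \<open>log_oscillation\<close>, and the exponent may be taken at any good point of the
  cube.\<close>

lemma W_cube_le_small:
  "\<exists>K\<ge>0. \<forall>c r x. 0 < r \<longrightarrow> r \<le> 1 \<longrightarrow> x \<in> cube c r \<longrightarrow> x \<notin> N \<longrightarrow> measure W (cube c r) \<le> K * lam c r powr q x"
proof -
  obtain m where m: "0 \<le> m" "(\<integral>\<^sup>+x. ennreal (tail m x) \<partial>W) < \<infinity>" using tail_integrable by blast
  define e where "e = enn2real (\<integral>\<^sup>+x. ennreal (tail m x) \<partial>W)"
  have e: "(\<integral>\<^sup>+x. ennreal (tail m x) \<partial>W) = ennreal e" "0 \<le> e" using m(2) by (auto simp: e_def)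
  obtain B where B: "0 \<le> B" "\<And>c r x. 0 < r \<Longrightarrow> x \<in> cube c r \<Longrightarrow> - B * logscale r x \<le> ln (lam c r)"
      "\<And>c r x. 0 < r \<Longrightarrow> x \<in> cube c r \<Longrightarrow> ln (lam c r) \<le> B * bigscale r x"
    using lam_bounds by metis
  obtain Ko where Ko: "0 \<le> Ko" "\<And>c r x y. 0 < r \<Longrightarrow> x \<in> cube c r \<Longrightarrow> y \<in> cube c r \<Longrightarrow> x \<notin> N \<Longrightarrow> y \<notin> N \<Longrightarrow>
    \<bar>q x - q y\<bar> * min (logscale r x) (logscale r y) \<le> Ko"
    using log_oscillation by metis
  have "measure W (cube c r) \<le> (exp (B * Ko) + e) * lam c r powr q x"
    if r: "0 < r" "r \<le> 1" and x: "x \<in> cube c r" "x \<notin> N" for c r x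
  proof (rule W_cube_le_powr[OF r(1) _ e])
    fix y assume y: "y \<in> cube c r" "y \<notin> N"
    have big: "bigscale r z \<le> logscale r z" for z :: 'a
    proof -
      have "r \<le> 1 / r" using r by (simp add: field_simps mult_le_one)
      then show ?thesis unfolding bigscale_def logscale_def using r
        by (subst ln_le_cancel_iff) (auto intro: add_pos_pos add_pos_nonneg)
    qed
    have bl: "\<bar>ln (lam c r)\<bar> \<le> B * logscale r z" if "z \<in> cube c r" for z
    proof -
      have "B * bigscale r z \<le> B * logscale r z" using big B(1) by (rule mult_left_mono)
      then show ?thesis using B(2)[OF r(1) that] B(3)[OF r(1) that] by (simp add: abs_le_iff)
    qed
    from bl[OF x(1)] bl[OF y(1)] have "\<bar>ln (lam c r)\<bar> \<le> B * min (logscale r x) (logscale r y)"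
      using x y by (auto simp: min_def)
    then have "\<bar>q x - q y\<bar> * \<bar>ln (lam c r)\<bar> \<le> \<bar>q x - q y\<bar> * (B * min (logscale r x) (logscale r y))"
      by (intro mult_left_mono) auto
    also have "\<dots> = B * (\<bar>q x - q y\<bar> * min (logscale r x) (logscale r y))" by simp
    also have "\<dots> \<le> B * Ko" using r x y B(1) by (intro mult_left_mono Ko(2)) auto
    finally have "(1 / lam c r) powr q x \<le> exp (B * Ko) * (1 / lam c r) powr q y"
      using lam_pos[OF r(1), of c] by (intro powr_close) (auto simp: ln_div)
    then show "(1 / lam c r) powr q x \<le> exp (B * Ko) * (1 / lam c r) powr q y + tail m y"
      using tail_pos[of m y] by linarith
  qed simp
  moreover have "0 \<le> exp (B * Ko) + e" using e(2) by simp
  ultimately show ?thesis by blast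
qed

lemma logscale_le_logtail:
  assumes "1 \<le> r" shows "logscale r x \<le> 2 * logtail x"
proof -
  have "1 / r \<le> 1" using assms by simp
  then have "1 + 1 / r \<le> exp 1" using exp_ge_add_one_self[of 1] by linarith
  then have "ln (1 + 1 / r) \<le> ln (exp 1)"
    using assms by (subst ln_le_cancel_iff) (auto intro: add_pos_pos)
  then show ?thesis using logscale_le[of r x] logtail_ge_1[of x] assms by simp
qed

text \<open>If \<open>lam >= 1\<close>, its logarithm can be as large as that of the radius, beyond
  the control of \<open>logtail y\<close> near the origin; but then \<open>1 / lam <= 1\<close>, and
  \<open>powr_decay\<close> applies with a tail error. If \<open>lam < 1\<close>, the lower bound
  gives \<open>\<bar>ln lam\<bar> <= 2 * B * logtail y\<close>, and the exchange is direct.\<close>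

lemma W_cube_le_large:
  "\<exists>K\<ge>0. \<forall>c r. 1 \<le> r \<longrightarrow> measure W (cube c r) \<le> K * lam c r powr qi"
proof -
  obtain m where m: "0 \<le> m" "(\<integral>\<^sup>+x. ennreal (tail m x) \<partial>W) < \<infinity>" using tail_integrable by blast
  define e where "e = enn2real (\<integral>\<^sup>+x. ennreal (tail m x) \<partial>W)"
  have e: "(\<integral>\<^sup>+x. ennreal (tail m x) \<partial>W) = ennreal e" "0 \<le> e" using m(2) by (auto simp: e_def)
  obtain B where B: "0 \<le> B" "\<And>c r x. 0 < r \<Longrightarrow> x \<in> cube c r \<Longrightarrow> - B * logscale r x \<le> ln (lam c r)"
    using lam_bounds by metis
  let ?C = "exp (m * CL) + exp (2 * B * CL)"
  have "measure W (cube c r) \<le> (?C + e) * lam c r powr qi" if r: "1 \<le> r" for c r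
  proof (rule W_cube_le_powr[OF _ _ e])
    fix y assume y: "y \<in> cube c r" "y \<notin> N"
    have l: "0 < lam c r" using r by (intro lam_pos) simp
    have ty: "0 < tail m y" by (rule tail_pos)
    show "(1 / lam c r) powr qi \<le> ?C * (1 / lam c r) powr q y + tail m y"
    proof (cases "1 \<le> lam c r")
      case True
      then have "(1 / lam c r) powr qi \<le> exp (m * CL) * (1 / lam c r) powr q y + tail m y"
        using y m l by (intro powr_decay) auto
      also have "\<dots> \<le> ?C * (1 / lam c r) powr q y + tail m y" by (intro add_right_mono mult_right_mono) auto
      finally show ?thesis .
    next
      case False
      have "- B * (2 * logtail y) \<le> - B * logscale r y"
        using mult_left_mono[OF logscale_le_logtail[OF r, of y] B(1)] by simp
      also have "\<dots> \<le> ln (lam c r)" using r y by (intro B(2)) auto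
      finally have "\<bar>ln (lam c r)\<bar> \<le> 2 * B * logtail y" using False l by simp
      then have "\<bar>qi - q y\<bar> * \<bar>ln (lam c r)\<bar> \<le> \<bar>qi - q y\<bar> * (2 * B * logtail y)" by (intro mult_left_mono) auto
      also have "\<dots> = 2 * B * (\<bar>q y - qi\<bar> * logtail y)" by (simp add: abs_minus_commute)
      also have "\<dots> \<le> 2 * B * CL" using y B(1) by (intro mult_left_mono log_decay) auto
      finally have "(1 / lam c r) powr qi \<le> exp (2 * B * CL) * (1 / lam c r) powr q y"
        using l by (intro powr_close) (auto simp: ln_div)
      also have "\<dots> \<le> ?C * (1 / lam c r) powr q y" by (intro mult_right_mono) auto
      finally show ?thesis using ty by linarith
    qed
  qed (use r in \<open>auto intro: add_nonneg_nonneg\<close>)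
  moreover have "0 \<le> ?C + e" using e(2) by (simp add: add_nonneg_nonneg)
  ultimately show ?thesis by blast
qed

end

section \<open>The estimate for the average over a single cube\<close>

context A_weight
begin

abbreviation Sg :: "'a measure" where
  "Sg \<equiv> density lebesgue (\<lambda>x. ennreal ((1 / w x) powr conjexp (q x)))"

lemma cube_measure_Sg: "cube_measure Sg"
proof -
  interpret dual: A_weight "\<lambda>x. conjexp (q x)" N "conjexp qi" "conjexp hi" "conjexp lo" "CL / (lo - 1)\<^sup>2" "\<lambda>x. 1 / w x" mu lam CA
    by (rule A_weight_dual)
  show ?thesis by (rule dual.cube_measure_W)
qed

lemma nn_integral_cube_le:
  assumes r: "0 < r" and [measurable]: "f \<in> borel_measurable lebesgue" and f: "\<And>x. 0 \<le> f x"
    and f1: "(\<integral>\<^sup>+x. ennreal ((f x * w x) powr q x) \<partial>lebesgue) \<le> 1" and A: "A \<subseteq> cube c r"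
    and [measurable]: "A \<in> sets lebesgue"
  shows "(\<integral>\<^sup>+x\<in>A. ennreal (f x) \<partial>lebesgue) \<le> ennreal (2 * mu c r)"
proof -
  have m: "0 < mu c r" using r by (rule mu_pos)
  have "(\<integral>\<^sup>+x\<in>A. ennreal (f x) \<partial>lebesgue)
      \<le> (\<integral>\<^sup>+x. ennreal (mu c r) * (ennreal ((f x * w x) powr q x)
        + ennreal ((1 / (w x * mu c r)) powr conjexp (q x)) * indicator (cube c r) x) \<partial>lebesgue)"
  proof (intro nn_integral_mono)
    fix x
    show "ennreal (f x) * indicator A x \<le> ennreal (mu c r) * (ennreal ((f x * w x) powr q x)
        + ennreal ((1 / (w x * mu c r)) powr conjexp (q x)) * indicator (cube c r) x)"
    proof (cases "x \<in> A")
      case True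
      have "mu c r * ((f x * w x) * (1 / (w x * mu c r))) \<le> mu c r * ((f x * w x) powr q x + (1 / (w x * mu c r)) powr conjexp (q x))"
        using m f w_pos[of x] q_gt_1[of x] by (intro mult_left_mono mult_le_conj_powr) (auto simp: less_imp_le)
      moreover have "mu c r * ((f x * w x) * (1 / (w x * mu c r))) = f x" using m w_pos[of x] by simp
      ultimately have "ennreal (f x) \<le> ennreal (mu c r * ((f x * w x) powr q x + (1 / (w x * mu c r)) powr conjexp (q x)))"
        by (intro ennreal_leI) simp
      also have "\<dots> = ennreal (mu c r) * (ennreal ((f x * w x) powr q x) + ennreal ((1 / (w x * mu c r)) powr conjexp (q x)))"
        using m by (simp add: ennreal_mult)
      finally show ?thesis using True A by (auto simp: indicator_def)
    qed simp
  qed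
  also have "\<dots> = ennreal (mu c r) * ((\<integral>\<^sup>+x. ennreal ((f x * w x) powr q x) \<partial>lebesgue)
      + (\<integral>\<^sup>+x\<in>cube c r. ennreal ((1 / (w x * mu c r)) powr conjexp (q x)) \<partial>lebesgue))"
    unfolding conjexp_def by (subst nn_integral_cmult, measurable) (subst nn_integral_add, auto)
  also have "\<dots> \<le> ennreal (mu c r) * (1 + 1)" by (intro mult_left_mono add_mono f1 mu_modular r) auto
  also have "\<dots> = ennreal (2 * mu c r)" using m by (simp add: ennreal_mult mult.commute)
  finally show ?thesis .
qed

text \<open>The integral is bounded by \<open>mu\<close> of the triple, and the Muckenhoupt
  condition on the triple cancels the denominator of \<open>avg\<close>. This controls the logarithm
  of an average from above; from below it is controlled by the assumption that the average is at
  least \<open>tail m x\<close>.\<close>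

lemma avg_le_lam:
  assumes r: "0 < r" and "f \<in> borel_measurable lebesgue" "\<And>x. 0 \<le> f x"
    and "(\<integral>\<^sup>+x. ennreal ((f x * w x) powr q x) \<partial>lebesgue) \<le> 1"
  shows "avg lebesgue f c r \<le> 2 * CA / 2 ^ DIM('a) / lam c (3 * r)"
proof -
  let ?D = "(2 * (3 * r)) ^ DIM('a)"
  have l: "0 < lam c (3 * r)" and m: "0 < mu c (3 * r)" using r lam_pos mu_pos by auto
  have D: "0 < ?D" using r by simp
  have "(\<integral>\<^sup>+x\<in>cube c r. ennreal (f x) \<partial>lebesgue) \<le> ennreal (2 * mu c (3 * r))"
    using assms cube_mono[of r "3 * r" c] by (intro nn_integral_cube_le) auto
  then have "enn2real (\<integral>\<^sup>+x\<in>cube c r. ennreal (f x) \<partial>lebesgue) \<le> 2 * mu c (3 * r)"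
    using m by (intro enn2real_leI) auto
  then have "avg lebesgue f c r \<le> 2 * mu c (3 * r) / ?D"
    unfolding avg_def using r D by (simp add: measure_cube divide_right_mono)
  also have "2 * mu c (3 * r) = 2 * (lam c (3 * r) * mu c (3 * r)) / lam c (3 * r)" using l by simp
  also have "\<dots> / ?D \<le> 2 * (CA * (3 * r) ^ DIM('a)) / lam c (3 * r) / ?D"
    using l D r by (intro divide_right_mono mult_left_mono lam_mu) auto
  also have "\<dots> = 2 * CA / 2 ^ DIM('a) / lam c (3 * r)" using r l unfolding power_mult_distrib[of 2 "3 * r"] by simp
  finally show ?thesis .
qed

text \<open>The comparison exponent \<open>b\<close> is \<open>q x\<close> on small cubes and the limit exponent on large ones.\<close>

lemma avg_powr_core:
  fixes b :: real
  assumes r: "0 < r" and A: "0 < A" and b: "1 < b" "b \<le> hi"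
    and K: "0 \<le> K1" "1 \<le> K2" "0 \<le> K3" "0 < K4"
    and KW: "measure W (cube c (3 * r)) \<le> K1 * lam c (3 * r) powr b"
    and KS: "measure Sg (cube c (3 * r)) \<le> K2 * mu c (3 * r) powr conjexp b"
    and KA: "A powr (q x - 1) \<le> K3 * A powr (b - 1)"
    and H: "H \<in> sets lebesgue" "H \<subseteq> cube c r" "ennreal ((2 * r) ^ DIM('a) / 2) \<le> emeasure lebesgue H"
    and t: "t = A * (6 * r) ^ DIM('a) / (K2 * mu c (3 * r) powr conjexp b)"
    and tH: "\<And>y. y \<in> H \<Longrightarrow> y \<notin> N \<Longrightarrow> t powr (b - 1) \<le> K4 * t powr (q y - 1)"
  shows "ennreal (A powr (q x - 1) * measure W (cube c (3 * r)))
    \<le> ennreal (K1 * K3 * K4 * 2 * 3 ^ DIM('a) * K2 powr hi * (max 1 (CA / 2 ^ DIM('a))) powr hi) *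
      (\<integral>\<^sup>+y\<in>cube c r. ennreal ((A * (6 * r) ^ DIM('a) / measure Sg (cube c (3 * r))) powr (q y - 1)) \<partial>lebesgue)"
proof -
  interpret S: cube_measure Sg by (rule cube_measure_Sg)
  define V where "V = (6 * r) ^ DIM('a)"
  define l where "l = lam c (3 * r)"
  define u where "u = mu c (3 * r)"
  define S where "S = measure Sg (cube c (3 * r))"
  define ka where "ka = max 1 (CA / 2 ^ DIM('a))"
  have pos: "0 < V" "0 < l" "0 < u" "0 < S" "1 \<le> ka"
    unfolding V_def l_def u_def S_def ka_def using r lam_pos mu_pos S.measure_cube_pos by auto
  have tpos: "0 < t" unfolding t V_def[symmetric] u_def[symmetric] using A pos K by simp
  \<comment> \<open>With the measure of the triple replaced by its bound in terms of
    \<open>mu\<close>, \<open>t\<close> is an explicit product whose logarithm can be estimated, and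
    it stays below the base of the powers under the integral.\<close>
  have tS: "t \<le> A * V / S"
    unfolding t using KS A pos K unfolding V_def[symmetric] u_def[symmetric] S_def[symmetric]
    by (intro divide_left_mono mult_pos_pos) auto
  \<comment> \<open>\<open>V\<close> is the Lebesgue measure of the triple, and this is the
    Muckenhoupt condition; \<open>ka\<close> is kept at least 1 so that its power \<open>b\<close>
    is at most its power \<open>hi\<close>.\<close>
  have luV: "l / ka \<le> V / u"
  proof -
    have "l * u \<le> CA * (3 * r) ^ DIM('a)" unfolding l_def u_def using r by (intro lam_mu) simp
    also have "V = 2 ^ DIM('a) * (3 * r) ^ DIM('a)" unfolding V_def power_mult_distrib[symmetric] by simp
    then have "CA * (3 * r) ^ DIM('a) = CA / 2 ^ DIM('a) * V" by simp
    also have "\<dots> \<le> ka * V" using pos by (intro mult_right_mono) (auto simp: ka_def)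
    finally show ?thesis using pos by (simp add: field_simps)
  qed
  \<comment> \<open>The constant-exponent argument with exponent \<open>b\<close>: since
    \<open>conjexp b * (b - 1) = b\<close>, the left-hand side is
    \<open>A powr (b - 1) * (V / u) powr b\<close> up to a power of \<open>K2\<close>, and
    \<open>V / u\<close> dominates \<open>l / ka\<close>.\<close>
  have tb: "t powr (b - 1) * V \<ge> A powr (b - 1) * l powr b / (K2 powr hi * ka powr hi)"
  proof -
    have bb: "conjexp b * (b - 1) = b" using b by (simp add: conjexp_def)
    have "t powr (b - 1) = A powr (b - 1) * V powr (b - 1) / (K2 powr (b - 1) * u powr b)"
      unfolding t V_def[symmetric] u_def[symmetric] using A pos K by (simp add: powr_divide powr_mult powr_powr bb)
    then have tV: "t powr (b - 1) * V = A powr (b - 1) / K2 powr (b - 1) * (V / u) powr b"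
      using pos powr_mult_base[of V "b - 1"] by (simp add: powr_divide field_simps)
    have "(l / ka) powr b \<le> (V / u) powr b" using luV pos b by (intro powr_mono2) auto
    moreover have "A powr (b - 1) / K2 powr hi \<le> A powr (b - 1) / K2 powr (b - 1)"
      using K b by (intro divide_left_mono powr_mono) auto
    moreover have "l powr b / ka powr hi \<le> (l / ka) powr b"
      using pos b by (subst powr_divide) (auto intro!: divide_left_mono powr_mono)
    ultimately have "A powr (b - 1) / K2 powr hi * (l powr b / ka powr hi) \<le> A powr (b - 1) / K2 powr (b - 1) * (V / u) powr b"
      by (intro mult_mono) auto
    also have "\<dots> = t powr (b - 1) * V" by (rule tV[symmetric])
    finally show ?thesis by simp
  qed
  \<comment> \<open>Only \<open>H\<close> contributes. Its measure is at least half of that of the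
    cube, and \<open>V\<close> is recovered from this half at the price of the factor
    \<open>2 * 3 ^ DIM('a)\<close>.\<close>
  have "ennreal (t powr (b - 1) * ((2 * r) ^ DIM('a) / 2) / K4) = ennreal (t powr (b - 1) / K4) * ennreal ((2 * r) ^ DIM('a) / 2)"
    using K r by (simp flip: ennreal_mult)
  also have "\<dots> \<le> ennreal (t powr (b - 1) / K4) * emeasure lebesgue H" by (intro mult_left_mono H) auto
  also have "\<dots> = (\<integral>\<^sup>+y\<in>H. ennreal (t powr (b - 1) / K4) \<partial>lebesgue)" using H(1) by (simp add: nn_integral_cmult_indicator)
  also have "\<dots> \<le> (\<integral>\<^sup>+y\<in>cube c r. ennreal ((A * V / S) powr (q y - 1)) \<partial>lebesgue)"
  proof (intro nn_integral_mono_AE)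
    show "AE y in lebesgue. ennreal (t powr (b - 1) / K4) * indicator H y \<le> ennreal ((A * V / S) powr (q y - 1)) * indicator (cube c r) y"
      using AE_not_N
    proof eventually_elim
      case (elim y)
      show ?case
      proof (cases "y \<in> H")
        case True
        have "t powr (b - 1) / K4 \<le> t powr (q y - 1)" using tH[OF True elim] K(4) by (simp add: field_simps)
        also have "\<dots> \<le> (A * V / S) powr (q y - 1)" using tS tpos q_ge_1[of y] by (intro powr_mono2) auto
        finally show ?thesis using True H(2) by (auto simp: indicator_def intro: ennreal_leI)
      qed simp
    qed
  qed
  finally have I: "ennreal (t powr (b - 1) * ((2 * r) ^ DIM('a) / 2) / K4)
      \<le> (\<integral>\<^sup>+y\<in>cube c r. ennreal ((A * V / S) powr (q y - 1)) \<partial>lebesgue)" (is "_ \<le> ?I") .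
  let ?K = "K1 * K3 * K4 * 2 * 3 ^ DIM('a) * K2 powr hi * ka powr hi"
  have gen: "T * (h * v) = k * 2 * h * (T * (v / 2) / k)" if "k \<noteq> 0" for T h v k :: real
    using that by simp
  define Z where "Z = K2 powr hi * ka powr hi"
  have Z: "0 < Z" unfolding Z_def using K pos by simp
  have VK: "V = 3 ^ DIM('a) * (2 * r) ^ DIM('a)" unfolding V_def power_mult_distrib[symmetric] by simp
  have tV: "t powr (b - 1) * V = K4 * 2 * 3 ^ DIM('a) * (t powr (b - 1) * ((2 * r) ^ DIM('a) / 2) / K4)"
    unfolding VK using K(4) by (intro gen) simp
  have "A powr (q x - 1) * measure W (cube c (3 * r)) \<le> (K3 * A powr (b - 1)) * (K1 * l powr b)"
    using KA KW K unfolding l_def by (intro mult_mono) auto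
  also have "\<dots> = K1 * K3 * (Z * (A powr (b - 1) * l powr b / Z))"
    using Z by simp
  also have "\<dots> \<le> K1 * K3 * (Z * (t powr (b - 1) * V))"
    using K Z tb unfolding Z_def[symmetric] by (intro mult_left_mono) auto
  also have "\<dots> = ?K * (t powr (b - 1) * ((2 * r) ^ DIM('a) / 2) / K4)"
    unfolding tV Z_def by (simp only: mult_ac)
  finally have "ennreal (A powr (q x - 1) * measure W (cube c (3 * r))) \<le> ennreal \<dots>" by (rule ennreal_leI)
  also have "\<dots> = ennreal ?K * ennreal (t powr (b - 1) * ((2 * r) ^ DIM('a) / 2) / K4)"
    using K r by (intro ennreal_mult) auto
  also have "\<dots> \<le> ennreal ?K * ?I" by (intro mult_left_mono I) auto
  finally show ?thesis unfolding V_def S_def ka_def .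
qed

text \<open>Here \<open>b = q x\<close>, \<open>H\<close> is the whole cube and
  \<open>K3 = 1\<close>. It remains to bound \<open>\<bar>ln t\<bar>\<close> by the logarithmic
  scale: the average lies between \<open>tail m x\<close> and the bound of
  \<open>avg_le_lam\<close>, and \<open>mu\<close> obeys \<open>lam_bounds\<close>.\<close>

lemma avg_powr_small:
  assumes m: "0 \<le> m"
  shows "\<exists>K\<ge>0. \<forall>c r x f. 0 < r \<longrightarrow> 3 * r \<le> 1 \<longrightarrow> x \<in> cube c r \<longrightarrow> x \<notin> N \<longrightarrow> f \<in> borel_measurable lebesgue \<longrightarrow> (\<forall>y. 0 \<le> f y) \<longrightarrow>
    (\<integral>\<^sup>+y. ennreal ((f y * w y) powr q y) \<partial>lebesgue) \<le> 1 \<longrightarrow> tail m x \<le> avg lebesgue f c r \<longrightarrow>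
    ennreal (avg lebesgue f c r powr (q x - 1) * measure W (cube c (3 * r)))
    \<le> ennreal K * (\<integral>\<^sup>+y\<in>cube c r. ennreal ((avg lebesgue f c r * (6 * r) ^ DIM('a) / measure Sg (cube c (3 * r))) powr (q y - 1)) \<partial>lebesgue)"
proof -
  interpret dual: A_weight "\<lambda>x. conjexp (q x)" N "conjexp qi" "conjexp hi" "conjexp lo" "CL / (lo - 1)\<^sup>2" "\<lambda>x. 1 / w x" mu lam CA
    by (rule A_weight_dual)
  obtain K1 where K1: "0 \<le> K1" "\<And>c r x. 0 < r \<Longrightarrow> r \<le> 1 \<Longrightarrow> x \<in> cube c r \<Longrightarrow> x \<notin> N \<Longrightarrow> measure W (cube c r) \<le> K1 * lam c r powr q x"
    using W_cube_le_small by metis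
  obtain K2 where K2: "0 \<le> K2" "\<And>c r x. 0 < r \<Longrightarrow> r \<le> 1 \<Longrightarrow> x \<in> cube c r \<Longrightarrow> x \<notin> N \<Longrightarrow> measure Sg (cube c r) \<le> K2 * mu c r powr conjexp (q x)"
    using dual.W_cube_le_small by metis
  define k2 where "k2 = max 1 K2"
  obtain B where B: "0 \<le> B" "\<And>c r x. 0 < r \<Longrightarrow> x \<in> cube c r \<Longrightarrow> - B * logscale r x \<le> ln (lam c r)"
    using lam_bounds by metis
  obtain B' where B': "0 \<le> B'" "\<And>c r x. 0 < r \<Longrightarrow> x \<in> cube c r \<Longrightarrow> - B' * logscale r x \<le> ln (mu c r)"
      "\<And>c r x. 0 < r \<Longrightarrow> x \<in> cube c r \<Longrightarrow> ln (mu c r) \<le> B' * bigscale r x"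
    using dual.lam_bounds by metis
  obtain Ko where Ko: "0 \<le> Ko" "\<And>c r x y. 0 < r \<Longrightarrow> x \<in> cube c r \<Longrightarrow> y \<in> cube c r \<Longrightarrow> x \<notin> N \<Longrightarrow> y \<notin> N \<Longrightarrow>
    \<bar>q x - q y\<bar> * min (logscale r x) (logscale r y) \<le> Ko"
    using log_oscillation by metis
  define d where "d = real DIM('a)"
  have d0: "1 \<le> d" by (simp add: d_def Suc_leI)
  define c1 where "c1 = 2 * CA / 2 ^ DIM('a)"
  have c1: "0 < c1" unfolding c1_def using CA_pos by simp
  \<comment> \<open>Factor between \<open>logtail\<close> at two points of a cube of radius at most
    1, whose norms differ by at most \<open>2 * d\<close>.\<close>
  define cd where "cd = 1 + ln (1 + 2 * d)"
  have cd: "1 \<le> cd" unfolding cd_def using d0 by simp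
  \<comment> \<open>One summand for each factor of \<open>t\<close>: the average, the measure of the
    triple, \<open>k2\<close> and the power of \<open>mu\<close>.\<close>
  define Kt where "Kt = (\<bar>ln c1\<bar> + B + m * cd) + d * (ln 2 + 1) + ln k2 + conjexp lo * B'"
  define K4 where "K4 = exp (Kt * Ko)"
  have clo: "1 < conjexp lo" using lo_gt_1 by (rule conjexp_gt_1)
  have k2: "1 \<le> k2" by (simp add: k2_def)
  have Kt0: "0 \<le> Kt" unfolding Kt_def using B(1) B'(1) m cd d0 k2 clo by simp
  let ?K = "K1 * 1 * K4 * 2 * 3 ^ DIM('a) * k2 powr hi * (max 1 (CA / 2 ^ DIM('a))) powr hi"
  show ?thesis
  proof (intro exI[of _ ?K] conjI allI impI)
    show "0 \<le> ?K" using K1 by (simp add: K4_def)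
    fix c :: 'a and r x f
    assume r: "0 < r" "3 * r \<le> 1" and x: "x \<in> cube c r" "x \<notin> N" and f: "f \<in> borel_measurable lebesgue" "\<forall>y. 0 \<le> f y"
      "(\<integral>\<^sup>+y. ennreal ((f y * w y) powr q y) \<partial>lebesgue) \<le> 1" and ge: "tail m x \<le> avg lebesgue f c r"
    define A where "A = avg lebesgue f c r"
    have A: "0 < A" using ge tail_pos[of m x] unfolding A_def by linarith
    define l where "l = lam c (3 * r)"
    define u where "u = mu c (3 * r)"
    have pos: "0 < l" "0 < u" unfolding l_def u_def using r lam_pos mu_pos by auto
    have QP: "cube c r \<subseteq> cube c (3 * r)" using r by (intro cube_mono) simp
    define t where "t = A * (6 * r) ^ DIM('a) / (k2 * u powr conjexp (q x))"
    have t0: "0 < t" unfolding t_def using A r pos k2 by simp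
    have lnt: "ln t = ln A + d * ln (6 * r) - ln k2 - conjexp (q x) * ln u"
      unfolding t_def using A r pos k2 by (simp add: ln_mult_pos ln_div ln_realpow ln_powr d_def algebra_simps)
    have big: "bigscale (3 * r) z \<le> logscale (3 * r) z" for z :: 'a
    proof -
      have "1 \<le> 1 / (3 * r)" using r by (simp add: field_simps)
      then have "3 * r \<le> 1 / (3 * r)" using r by linarith
      then show ?thesis unfolding bigscale_def logscale_def using r
        by (subst ln_le_cancel_iff) (auto intro: add_pos_pos add_pos_nonneg)
    qed
    have cq: "1 \<le> conjexp (q x)" "conjexp (q x) \<le> conjexp lo"
      using q_gt_1[of x] conjexp_gt_1[of "q x"] conjexp_antimono[OF lo_gt_1 lo_le_q] by auto
    \<comment> \<open>Wanted at every point \<open>z\<close> of the cube, since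
      \<open>log_oscillation\<close> offers only the smaller of the scales at two points.\<close>
    have tbound: "\<bar>ln t\<bar> \<le> Kt * logscale (3 * r) z" if z: "z \<in> cube c r" for z
    proof -
      let ?L = "logscale (3 * r) z"
      have zP: "z \<in> cube c (3 * r)" using z QP by blast
      have L1: "1 \<le> ?L" using r by (intro logscale_ge_1) simp
      have "A \<le> c1 / l" unfolding A_def c1_def l_def using r f by (intro avg_le_lam) auto
      then have "ln A \<le> ln (c1 / l)" using A c1 pos by (subst ln_le_cancel_iff) auto
      also have "\<dots> = ln c1 - ln l" using c1 pos by (simp add: ln_div)
      also have "\<dots> \<le> \<bar>ln c1\<bar> * ?L + B * ?L"
        using B(2)[OF _ zP] r mult_left_mono[OF L1, of "\<bar>ln c1\<bar>"] unfolding l_def by simp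
      finally have A1: "ln A \<le> (\<bar>ln c1\<bar> + B) * ?L" by (simp add: algebra_simps)
      have "norm x \<le> norm z + 2 * d"
      proof -
        have "norm x - norm z \<le> norm (x - z)" by (rule norm_triangle_ineq2)
        also have "\<dots> \<le> 2 * d * r" unfolding d_def using norm_diff_cube[OF x(1) z] by simp
        also have "\<dots> \<le> 2 * d * 1" using r d0 by (intro mult_left_mono) auto
        finally show ?thesis by simp
      qed
      then have "exp 1 + norm x \<le> (exp 1 + norm z) + 2 * d * 1" by simp
      also have "\<dots> \<le> (exp 1 + norm z) + 2 * d * (exp 1 + norm z)"
        using d0 one_le_exp_1 by (intro add_left_mono mult_left_mono) (auto simp: add_increasing2)
      finally have "exp 1 + norm x \<le> (exp 1 + norm z) * (1 + 2 * d)" by (simp add: algebra_simps)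
      then have "logtail x \<le> ln ((exp 1 + norm z) * (1 + 2 * d))"
        unfolding logtail_def using d0 exp_add_norm_pos[of x] exp_add_norm_pos[of z]
        by (subst ln_le_cancel_iff) (auto intro!: mult_pos_pos)
      also have "\<dots> = logtail z + ln (1 + 2 * d)"
        unfolding logtail_def using d0 exp_add_norm_pos[of z] by (intro ln_mult_pos) auto
      also have "\<dots> \<le> logtail z + ln (1 + 2 * d) * logtail z"
        using d0 mult_left_mono[OF logtail_ge_1[of z], of "ln (1 + 2 * d)"] by simp
      also have "\<dots> = cd * logtail z" by (simp add: cd_def algebra_simps)
      also have "\<dots> \<le> cd * ?L" using cd r by (intro mult_left_mono logtail_le_logscale) auto
      finally have "m * logtail x \<le> m * (cd * ?L)" using m by (rule mult_left_mono)
      moreover have "- m * logtail x \<le> ln A"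
        using ge A tail_pos[of m x] unfolding ln_tail[symmetric] A_def by (subst ln_le_cancel_iff) auto
      ultimately have A2: "- (m * cd) * ?L \<le> ln A" by simp
      have lr: "\<bar>ln (6 * r)\<bar> \<le> (ln 2 + 1) * ?L"
      proof -
        have e: "ln (6 * r) = ln 2 + ln (3 * r)" using ln_mult_pos[of 2 "3 * r"] r by simp
        have "- ln (3 * r) = ln (1 / (3 * r))" using r by (simp add: ln_div)
        also have "\<dots> \<le> ?L" unfolding logscale_def using r exp_add_norm_pos[of z]
          by (subst ln_le_cancel_iff) (auto intro: add_pos_pos)
        finally have "- ln (3 * r) \<le> ?L" .
        moreover have "ln (3 * r) \<le> 0" using r by simp
        moreover have "0 \<le> ln (2::real)" by simp
        moreover have "ln (2::real) * 1 \<le> ln 2 * ?L" using L1 by (intro mult_left_mono) auto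
        ultimately show ?thesis unfolding e distrib_right by (simp add: abs_le_iff; linarith)
      qed
      have lu: "\<bar>ln u\<bar> \<le> B' * ?L"
        using B'(2)[OF _ zP] B'(3)[OF _ zP] r mult_left_mono[OF big[of z] B'(1)] unfolding u_def by (auto simp: abs_le_iff)
      have "\<bar>ln t\<bar> \<le> \<bar>ln A\<bar> + d * \<bar>ln (6 * r)\<bar> + ln k2 + conjexp (q x) * \<bar>ln u\<bar>"
      proof -
        have "\<bar>d * ln (6 * r)\<bar> = d * \<bar>ln (6 * r)\<bar>" "\<bar>conjexp (q x) * ln u\<bar> = conjexp (q x) * \<bar>ln u\<bar>" "0 \<le> ln k2"
          using d0 cq k2 by (auto simp: abs_mult)
        then show ?thesis unfolding lnt by linarith
      qed
      also have "\<dots> \<le> (\<bar>ln c1\<bar> + B + m * cd) * ?L + d * ((ln 2 + 1) * ?L) + ln k2 * ?L + conjexp lo * (B' * ?L)"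
      proof (intro add_mono mult_mono lr lu)
        have "0 \<le> (m * cd) * ?L" "0 \<le> (\<bar>ln c1\<bar> + B) * ?L" using m cd L1 B(1) by auto
        then show "\<bar>ln A\<bar> \<le> (\<bar>ln c1\<bar> + B + m * cd) * ?L"
          using A1 A2 by (simp add: abs_le_iff distrib_right; linarith)
        show "ln k2 \<le> ln k2 * ?L" using mult_left_mono[OF L1, of "ln k2"] k2 by simp
      qed (use d0 cq in auto)
      also have "\<dots> = Kt * ?L" unfolding Kt_def by (simp add: algebra_simps)
      finally show ?thesis .
    qed
    have "ennreal (A powr (q x - 1) * measure W (cube c (3 * r))) \<le> ennreal ?K *
      (\<integral>\<^sup>+y\<in>cube c r. ennreal ((A * (6 * r) ^ DIM('a) / measure Sg (cube c (3 * r))) powr (q y - 1)) \<partial>lebesgue)"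
    proof (rule avg_powr_core[where b = "q x" and H = "cube c r" and t = t])
      show "measure Sg (cube c (3 * r)) \<le> k2 * mu c (3 * r) powr conjexp (q x)"
      proof -
        have "measure Sg (cube c (3 * r)) \<le> K2 * mu c (3 * r) powr conjexp (q x)" using r x QP by (intro K2) auto
        also have "\<dots> \<le> k2 * mu c (3 * r) powr conjexp (q x)" by (intro mult_right_mono) (auto simp: k2_def)
        finally show ?thesis .
      qed
      show "ennreal ((2 * r) ^ DIM('a) / 2) \<le> emeasure lebesgue (cube c r)"
        using r by (subst emeasure_cube) (auto intro!: ennreal_leI)
      show "t powr (q x - 1) \<le> K4 * t powr (q y - 1)" if y: "y \<in> cube c r" "y \<notin> N" for y
        unfolding K4_def
      proof (rule powr_close[OF t0])
        have "\<bar>ln t\<bar> \<le> Kt * min (logscale (3 * r) x) (logscale (3 * r) y)"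
          using tbound[OF x(1)] tbound[OF y(1)] by (auto simp: min_def)
        then have "\<bar>q x - q y\<bar> * \<bar>ln t\<bar> \<le> \<bar>q x - q y\<bar> * (Kt * min (logscale (3 * r) x) (logscale (3 * r) y))"
          by (intro mult_left_mono) auto
        also have "\<dots> = Kt * (\<bar>q x - q y\<bar> * min (logscale (3 * r) x) (logscale (3 * r) y))" by simp
        also have "\<dots> \<le> Kt * Ko" using r x y QP Kt0 by (intro mult_left_mono Ko(2)) auto
        finally show "\<bar>q x - 1 - (q y - 1)\<bar> * \<bar>ln t\<bar> \<le> Kt * Ko" by simp
      qed
    qed (use r x A QP q_gt_1 q_le_hi K1 k2 in \<open>auto simp: K4_def t_def u_def\<close>)
    then show "ennreal (avg lebesgue f c r powr (q x - 1) * measure W (cube c (3 * r)))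
      \<le> ennreal ?K * (\<integral>\<^sup>+y\<in>cube c r. ennreal ((avg lebesgue f c r * (6 * r) ^ DIM('a) / measure Sg (cube c (3 * r))) powr (q y - 1)) \<partial>lebesgue)"
      unfolding A_def .
  qed
qed

text \<open>Here \<open>b = qi\<close>. The exchange at \<open>x\<close> on the left is possible
  because \<open>\<bar>ln A\<bar>\<close> is at most a multiple of \<open>logtail x\<close>. Under
  the integral, \<open>\<bar>ln t\<bar>\<close> can be as large as
  \<open>bigscale (3 * r) x\<close>, which \<open>logtail y\<close> matches only for
  \<open>y\<close> away from the origin; hence the set \<open>H\<close>.\<close>

lemma avg_powr_large:
  assumes m: "0 \<le> m"
  shows "\<exists>K\<ge>0. \<forall>c r x f. 0 < r \<longrightarrow> 1 \<le> 3 * r \<longrightarrow> x \<in> cube c r \<longrightarrow> x \<notin> N \<longrightarrow> f \<in> borel_measurable lebesgue \<longrightarrow> (\<forall>y. 0 \<le> f y) \<longrightarrow>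
    (\<integral>\<^sup>+y. ennreal ((f y * w y) powr q y) \<partial>lebesgue) \<le> 1 \<longrightarrow> tail m x \<le> avg lebesgue f c r \<longrightarrow>
    ennreal (avg lebesgue f c r powr (q x - 1) * measure W (cube c (3 * r)))
    \<le> ennreal K * (\<integral>\<^sup>+y\<in>cube c r. ennreal ((avg lebesgue f c r * (6 * r) ^ DIM('a) / measure Sg (cube c (3 * r))) powr (q y - 1)) \<partial>lebesgue)"
proof -
  interpret dual: A_weight "\<lambda>x. conjexp (q x)" N "conjexp qi" "conjexp hi" "conjexp lo" "CL / (lo - 1)\<^sup>2" "\<lambda>x. 1 / w x" mu lam CA
    by (rule A_weight_dual)
  obtain K1 where K1: "0 \<le> K1" "\<And>c r. 1 \<le> r \<Longrightarrow> measure W (cube c r) \<le> K1 * lam c r powr qi"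
    using W_cube_le_large by metis
  obtain K2 where K2: "0 \<le> K2" "\<And>c r. 1 \<le> r \<Longrightarrow> measure Sg (cube c r) \<le> K2 * mu c r powr conjexp qi"
    using dual.W_cube_le_large by metis
  define k2 where "k2 = max 1 K2"
  obtain B where B: "0 \<le> B" "\<And>c r x. 0 < r \<Longrightarrow> x \<in> cube c r \<Longrightarrow> - B * logscale r x \<le> ln (lam c r)"
    using lam_bounds by metis
  obtain B' where B': "0 \<le> B'" "\<And>c r x. 0 < r \<Longrightarrow> x \<in> cube c r \<Longrightarrow> - B' * logscale r x \<le> ln (mu c r)"
      "\<And>c r x. 0 < r \<Longrightarrow> x \<in> cube c r \<Longrightarrow> ln (mu c r) \<le> B' * bigscale r x"
    using dual.lam_bounds by metis
  define d where "d = real DIM('a)"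
  have d0: "1 \<le> d" by (simp add: d_def Suc_leI)
  define c1 where "c1 = 2 * CA / 2 ^ DIM('a)"
  have c1: "0 < c1" unfolding c1_def using CA_pos by simp
  \<comment> \<open>For \<open>y\<close> in \<open>H\<close> one has \<open>r <= 2 * norm y\<close>,
    so \<open>norm x + 3 * r\<close> is at most \<open>(1 + 4 * d + 6) * norm y\<close>.\<close>
  define cd where "cd = 1 + ln (7 + 4 * d)"
  have cd: "1 \<le> cd" unfolding cd_def using d0 by simp
  define KA where "KA = m + \<bar>ln c1\<bar> + 2 * B"
  have KA: "0 \<le> KA" unfolding KA_def using m B(1) by simp
  have cqi: "1 < conjexp qi" using qi_gt_1 by (rule conjexp_gt_1)
  define Kt where "Kt = KA + d * (ln 2 + 1) + ln k2 + conjexp qi * (2 * B')"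
  have k2: "1 \<le> k2" by (simp add: k2_def)
  have Kt0: "0 \<le> Kt" unfolding Kt_def using KA B'(1) d0 k2 cqi by simp
  define K3 where "K3 = exp (KA * CL)"
  define K4 where "K4 = exp (Kt * cd * CL)"
  let ?K = "K1 * K3 * K4 * 2 * 3 ^ DIM('a) * k2 powr hi * (max 1 (CA / 2 ^ DIM('a))) powr hi"
  show ?thesis
  proof (intro exI[of _ ?K] conjI allI impI)
    show "0 \<le> ?K" using K1 by (simp add: K4_def K3_def)
    fix c :: 'a and r x f
    assume r: "0 < r" "1 \<le> 3 * r" and x: "x \<in> cube c r" "x \<notin> N" and f: "f \<in> borel_measurable lebesgue" "\<forall>y. 0 \<le> f y"
      "(\<integral>\<^sup>+y. ennreal ((f y * w y) powr q y) \<partial>lebesgue) \<le> 1" and ge: "tail m x \<le> avg lebesgue f c r"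
    define A where "A = avg lebesgue f c r"
    have A: "0 < A" using ge tail_pos[of m x] unfolding A_def by linarith
    define l where "l = lam c (3 * r)"
    define u where "u = mu c (3 * r)"
    have pos: "0 < l" "0 < u" unfolding l_def u_def using r lam_pos mu_pos by auto
    have QP: "cube c r \<subseteq> cube c (3 * r)" using r by (intro cube_mono) simp
    have xP: "x \<in> cube c (3 * r)" using x QP by blast
    define t where "t = A * (6 * r) ^ DIM('a) / (k2 * u powr conjexp qi)"
    have t0: "0 < t" unfolding t_def using A r pos k2 by simp
    have lnt: "ln t = ln A + d * ln (6 * r) - ln k2 - conjexp qi * ln u"
      unfolding t_def using A r pos k2 by (simp add: ln_mult_pos ln_div ln_realpow ln_powr d_def algebra_simps)
    let ?b = "bigscale (3 * r) x" and ?s = "logtail x"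
    have sb: "?s \<le> ?b" using r by (intro logtail_le_bigscale) simp
    have s1: "1 \<le> ?s" by (rule logtail_ge_1)
    have Ls: "logscale (3 * r) x \<le> 2 * ?s" using r by (intro logscale_le_logtail)
    have lnA: "\<bar>ln A\<bar> \<le> KA * ?s"
    proof -
      have "A \<le> c1 / l" unfolding A_def c1_def l_def using r f by (intro avg_le_lam) auto
      then have "ln A \<le> ln (c1 / l)" using A c1 pos by (subst ln_le_cancel_iff) auto
      also have "\<dots> = ln c1 - ln l" using c1 pos by (simp add: ln_div)
      also have "\<dots> \<le> \<bar>ln c1\<bar> * ?s + B * (2 * ?s)"
        using B(2)[OF _ xP] r mult_left_mono[OF s1, of "\<bar>ln c1\<bar>"] mult_left_mono[OF Ls B(1)] unfolding l_def by simp
      finally have "ln A \<le> \<bar>ln c1\<bar> * ?s + B * (2 * ?s)" .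
      moreover have "- m * ?s \<le> ln A"
        using ge A tail_pos[of m x] unfolding ln_tail[symmetric] A_def by (subst ln_le_cancel_iff) auto
      moreover have "0 \<le> m * ?s" "0 \<le> \<bar>ln c1\<bar> * ?s + B * (2 * ?s)" using m B(1) s1 by auto
      ultimately show ?thesis unfolding KA_def by (simp add: abs_le_iff algebra_simps)
    qed
    have lr: "\<bar>ln (6 * r)\<bar> \<le> (ln 2 + 1) * ?b"
    proof -
      have e: "ln (6 * r) = ln 2 + ln (3 * r)" using ln_mult_pos[of 2 "3 * r"] r by simp
      have "ln (3 * r) \<le> ?b" unfolding bigscale_def using r exp_add_norm_pos[of x]
        by (subst ln_le_cancel_iff) (auto intro: add_pos_pos)
      moreover have "0 \<le> ln (3 * r)" "0 \<le> ln (2::real)" using r by auto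
      moreover have "ln (2::real) * 1 \<le> ln 2 * ?b" using s1 sb by (intro mult_left_mono) auto
      ultimately show ?thesis unfolding e distrib_right by linarith
    qed
    have lu: "\<bar>ln u\<bar> \<le> 2 * B' * ?b"
    proof -
      have "B' * logscale (3 * r) x \<le> B' * (2 * ?b)" using Ls sb B'(1) by (intro mult_left_mono) auto
      moreover have "B' * ?b \<le> B' * (2 * ?b)" using s1 sb B'(1) by (intro mult_left_mono) auto
      ultimately show ?thesis using B'(2)[OF _ xP] B'(3)[OF _ xP] r unfolding u_def by (auto simp: abs_le_iff)
    qed
    have tbound: "\<bar>ln t\<bar> \<le> Kt * ?b"
    proof -
      have "\<bar>d * ln (6 * r)\<bar> = d * \<bar>ln (6 * r)\<bar>" "\<bar>conjexp qi * ln u\<bar> = conjexp qi * \<bar>ln u\<bar>" "0 \<le> ln k2"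
        using d0 cqi k2 by (auto simp: abs_mult)
      then have "\<bar>ln t\<bar> \<le> \<bar>ln A\<bar> + d * \<bar>ln (6 * r)\<bar> + ln k2 + conjexp qi * \<bar>ln u\<bar>"
        unfolding lnt by linarith
      also have "\<dots> \<le> KA * ?b + d * ((ln 2 + 1) * ?b) + ln k2 * ?b + conjexp qi * (2 * B' * ?b)"
      proof (intro add_mono mult_mono lr lu)
        show "\<bar>ln A\<bar> \<le> KA * ?b" using lnA mult_left_mono[OF sb KA] by linarith
        show "ln k2 \<le> ln k2 * ?b" using mult_left_mono[of 1 ?b "ln k2"] s1 sb k2 by simp
      qed (use d0 cqi in auto)
      also have "\<dots> = Kt * ?b" unfolding Kt_def by (simp add: algebra_simps)
      finally show ?thesis .
    qed
    \<comment> \<open>The removed cube has half the side of \<open>cube c r\<close>, hence at most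
      half of its measure, and every remaining point has norm at least \<open>r / 2\<close>.\<close>
    define H where "H = cube c r - cube 0 (r / 2)"
    have far: "?b \<le> cd * logtail y" if y: "y \<in> H" for y
    proof -
      from y have "y \<notin> cube 0 (r / 2)" by (simp add: H_def)
      then obtain i where i: "i \<in> Basis" "r / 2 < \<bar>y \<bullet> i\<bar>" unfolding mem_cube by (auto simp: not_le)
      then have yr: "r \<le> 2 * norm y" using Basis_le_norm[OF i(1), of y] by linarith
      have "norm x - norm y \<le> norm (x - y)" by (rule norm_triangle_ineq2)
      also have "\<dots> \<le> 2 * d * r" unfolding d_def using y norm_diff_cube[OF x(1), of y] by (simp add: H_def)
      also have "\<dots> \<le> 2 * d * (2 * norm y)" using yr d0 by (intro mult_left_mono) auto
      finally have "norm x + 3 * r \<le> (7 + 4 * d) * norm y" using yr by (simp add: algebra_simps)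
      moreover have "exp 1 \<le> (7 + 4 * d) * exp (1::real)" using d0 by (simp add: mult_le_cancel_right1)
      ultimately have "exp 1 + norm x + 3 * r \<le> (7 + 4 * d) * (exp 1 + norm y)" unfolding distrib_left by linarith
      moreover have "0 < exp 1 + norm x + 3 * r" using exp_add_norm_pos[of x] r by linarith
      ultimately have "?b \<le> ln ((7 + 4 * d) * (exp 1 + norm y))"
        unfolding bigscale_def using d0 exp_add_norm_pos[of y]
        by (subst ln_le_cancel_iff) (auto intro!: mult_pos_pos)
      also have "\<dots> = ln (7 + 4 * d) + logtail y"
        unfolding logtail_def using d0 exp_add_norm_pos[of y] by (intro ln_mult_pos) auto
      also have "\<dots> \<le> ln (7 + 4 * d) * logtail y + logtail y"
        using d0 mult_left_mono[OF logtail_ge_1[of y], of "ln (7 + 4 * d)"] by simp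
      finally show ?thesis by (simp add: cd_def algebra_simps)
    qed
    have "ennreal (A powr (q x - 1) * measure W (cube c (3 * r))) \<le> ennreal ?K *
      (\<integral>\<^sup>+y\<in>cube c r. ennreal ((A * (6 * r) ^ DIM('a) / measure Sg (cube c (3 * r))) powr (q y - 1)) \<partial>lebesgue)"
    proof (rule avg_powr_core[where b = qi and H = H and t = t])
      show "measure Sg (cube c (3 * r)) \<le> k2 * mu c (3 * r) powr conjexp qi"
      proof -
        have "measure Sg (cube c (3 * r)) \<le> K2 * mu c (3 * r) powr conjexp qi" using r by (intro K2) auto
        also have "\<dots> \<le> k2 * mu c (3 * r) powr conjexp qi" by (intro mult_right_mono) (auto simp: k2_def)
        finally show ?thesis .
      qed
      show "A powr (q x - 1) \<le> K3 * A powr (qi - 1)" unfolding K3_def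
      proof (rule powr_close[OF A])
        have "\<bar>q x - qi\<bar> * \<bar>ln A\<bar> \<le> \<bar>q x - qi\<bar> * (KA * ?s)" using lnA by (intro mult_left_mono) auto
        also have "\<dots> = KA * (\<bar>q x - qi\<bar> * ?s)" by simp
        also have "\<dots> \<le> KA * CL" using KA x by (intro mult_left_mono log_decay) auto
        finally show "\<bar>q x - 1 - (qi - 1)\<bar> * \<bar>ln A\<bar> \<le> KA * CL" by simp
      qed
      show "ennreal ((2 * r) ^ DIM('a) / 2) \<le> emeasure lebesgue H"
      proof -
        have e: "emeasure lebesgue (cube (0::'a) (r / 2)) = ennreal (r ^ DIM('a))"
          using r emeasure_cube[of "r / 2" "0::'a"] by simp
        have p2: "2 * r ^ DIM('a) \<le> (2 * r) ^ DIM('a)"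
        proof -
          have "(2::real) ^ 1 \<le> 2 ^ DIM('a)" by (intro power_increasing) (auto simp: Suc_leI)
          then show ?thesis using r by (simp add: power_mult_distrib)
        qed
        have "ennreal ((2 * r) ^ DIM('a)) = emeasure lebesgue (cube c r)" using r by (subst emeasure_cube) auto
        also have "\<dots> \<le> emeasure lebesgue (H \<union> cube 0 (r / 2))" by (intro emeasure_mono) (auto simp: H_def)
        also have "\<dots> \<le> emeasure lebesgue H + emeasure lebesgue (cube (0::'a) (r / 2))"
          by (intro emeasure_subadditive) (auto simp: H_def)
        finally have sub: "ennreal ((2 * r) ^ DIM('a)) \<le> emeasure lebesgue H + ennreal (r ^ DIM('a))" unfolding e .
        show ?thesis
        proof (cases "emeasure lebesgue H")
          case (real h)
          then have "ennreal ((2 * r) ^ DIM('a)) \<le> ennreal (h + r ^ DIM('a))" using sub r by (simp add: real(2))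
          then have "(2 * r) ^ DIM('a) \<le> h + r ^ DIM('a)" using real r by (subst (asm) ennreal_le_iff) auto
          then have "(2 * r) ^ DIM('a) / 2 \<le> h" using p2 by linarith
          then show ?thesis using real by (simp add: ennreal_leI)
        qed simp
      qed
      show "t powr (qi - 1) \<le> K4 * t powr (q y - 1)" if y: "y \<in> H" "y \<notin> N" for y
        unfolding K4_def
      proof (rule powr_close[OF t0])
        have "\<bar>ln t\<bar> \<le> Kt * (cd * logtail y)" using tbound mult_left_mono[OF far[OF y(1)] Kt0] by linarith
        then have "\<bar>qi - q y\<bar> * \<bar>ln t\<bar> \<le> \<bar>qi - q y\<bar> * (Kt * (cd * logtail y))" by (intro mult_left_mono) auto
        also have "\<dots> = Kt * cd * (\<bar>q y - qi\<bar> * logtail y)" by (simp add: abs_minus_commute)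
        also have "\<dots> \<le> Kt * cd * CL" using y Kt0 cd by (intro mult_left_mono log_decay) auto
        finally show "\<bar>qi - 1 - (q y - 1)\<bar> * \<bar>ln t\<bar> \<le> Kt * cd * CL" by simp
      qed
    qed (use r x A QP qi_gt_1 qi_le_hi K1 k2 in \<open>auto simp: K4_def K3_def t_def u_def H_def\<close>)
    then show "ennreal (avg lebesgue f c r powr (q x - 1) * measure W (cube c (3 * r)))
      \<le> ennreal ?K * (\<integral>\<^sup>+y\<in>cube c r. ennreal ((avg lebesgue f c r * (6 * r) ^ DIM('a) / measure Sg (cube c (3 * r))) powr (q y - 1)) \<partial>lebesgue)"
      unfolding A_def .
  qed
qed

end

section \<open>The maximal operator on weighted variable Lebesgue spaces\<close>

context A_weight
begin

text \<open>Both maximal bounds are available on unit balls of modulars only, so the function fed to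
  the second, \<open>G powr (q - 1) / w powr q\<close>, is divided by the bound \<open>k\<close> of
  the first. Points where the maximal function is below \<open>tail m\<close> go to the error
  term.\<close>

lemma maxop_weighted_bound:
  "\<exists>K\<ge>0. \<forall>F f. finite F \<longrightarrow> (\<forall>(c, r)\<in>F. 0 < r) \<longrightarrow> f \<in> borel_measurable lebesgue \<longrightarrow> (\<forall>y. 0 \<le> f y) \<longrightarrow>
    (\<integral>\<^sup>+y. ennreal ((f y * w y) powr q y) \<partial>lebesgue) \<le> 1 \<longrightarrow>
    (\<integral>\<^sup>+y. ennreal ((maxop lebesgue F f y * w y) powr q y) \<partial>lebesgue) \<le> ennreal K"
proof -
  interpret dual: A_weight "\<lambda>x. conjexp (q x)" N "conjexp qi" "conjexp hi" "conjexp lo" "CL / (lo - 1)\<^sup>2" "\<lambda>x. 1 / w x" mu lam CA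
    by (rule A_weight_dual)
  interpret CW: cube_measure W by (rule cube_measure_W)
  interpret CS: cube_measure Sg by (rule cube_measure_Sg)
  obtain m where m: "0 \<le> m" "(\<integral>\<^sup>+x. ennreal (tail m x) \<partial>W) < \<infinity>" using tail_integrable by blast
  obtain m' where m': "0 \<le> m'" "(\<integral>\<^sup>+x. ennreal (tail m' x) \<partial>Sg) < \<infinity>" using dual.tail_integrable by blast
  obtain B where B: "0 \<le> B" "\<forall>c r x. 0 < r \<longrightarrow> x \<in> cube c r \<longrightarrow> - B * logscale r x \<le> ln (measure W (cube c r))"
    using W_lower by blast
  obtain B' where B': "0 \<le> B'" "\<forall>c r x. 0 < r \<longrightarrow> x \<in> cube c r \<longrightarrow> - B' * logscale r x \<le> ln (measure Sg (cube c r))"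
    using dual.W_lower by blast
  have "\<exists>K\<ge>0. \<forall>F g. finite F \<longrightarrow> (\<forall>(c, r)\<in>F. 0 < r) \<longrightarrow> g \<in> borel_measurable Sg \<longrightarrow> (\<forall>y. 0 \<le> g y) \<longrightarrow>
    (\<integral>\<^sup>+x. ennreal (g x powr q x) \<partial>Sg) \<le> 1 \<longrightarrow>
    (\<integral>\<^sup>+x. ennreal (maxop Sg F g x powr q x) \<partial>Sg) \<le> ennreal K"
    using B' by (intro maxop_variable_strong_type[OF lo_gt_1 cube_measure_Sg dual.absolutely_continuous_W B'(1) _ m']) auto
  then obtain k1 where k1: "0 \<le> k1" "\<forall>F g. finite F \<longrightarrow> (\<forall>(c, r)\<in>F. 0 < r) \<longrightarrow> g \<in> borel_measurable Sg \<longrightarrow> (\<forall>y. 0 \<le> g y) \<longrightarrow>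
    (\<integral>\<^sup>+x. ennreal (g x powr q x) \<partial>Sg) \<le> 1 \<longrightarrow>
    (\<integral>\<^sup>+x. ennreal (maxop Sg F g x powr q x) \<partial>Sg) \<le> ennreal k1"
    by (elim exE conjE) (rule that)
  have "\<exists>K\<ge>0. \<forall>F g. finite F \<longrightarrow> (\<forall>(c, r)\<in>F. 0 < r) \<longrightarrow> g \<in> borel_measurable W \<longrightarrow> (\<forall>y. 0 \<le> g y) \<longrightarrow>
    (\<integral>\<^sup>+x. ennreal (g x powr conjexp (q x)) \<partial>W) \<le> 1 \<longrightarrow>
    (\<integral>\<^sup>+x. ennreal (maxop W F g x powr conjexp (q x)) \<partial>W) \<le> ennreal K"
    using B by (intro dual.maxop_variable_strong_type[OF dual.lo_gt_1 cube_measure_W absolutely_continuous_W B(1) _ m]) auto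
  then obtain k2 where k2: "0 \<le> k2" "\<forall>F g. finite F \<longrightarrow> (\<forall>(c, r)\<in>F. 0 < r) \<longrightarrow> g \<in> borel_measurable W \<longrightarrow> (\<forall>y. 0 \<le> g y) \<longrightarrow>
    (\<integral>\<^sup>+x. ennreal (g x powr conjexp (q x)) \<partial>W) \<le> 1 \<longrightarrow>
    (\<integral>\<^sup>+x. ennreal (maxop W F g x powr conjexp (q x)) \<partial>W) \<le> ennreal k2"
    by (elim exE conjE) (rule that)
  let ?I = "\<lambda>f c r. \<integral>\<^sup>+y\<in>cube c r. ennreal ((avg lebesgue f c r * (6 * r) ^ DIM('a) / measure Sg (cube c (3 * r))) powr (q y - 1)) \<partial>lebesgue"
  obtain ks where ks: "0 \<le> ks" "\<forall>c r x f. 0 < r \<longrightarrow> 3 * r \<le> 1 \<longrightarrow> x \<in> cube c r \<longrightarrow> x \<notin> N \<longrightarrow> f \<in> borel_measurable lebesgue \<longrightarrow> (\<forall>y. 0 \<le> f y) \<longrightarrow>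
    (\<integral>\<^sup>+y. ennreal ((f y * w y) powr q y) \<partial>lebesgue) \<le> 1 \<longrightarrow> tail m x \<le> avg lebesgue f c r \<longrightarrow>
    ennreal (avg lebesgue f c r powr (q x - 1) * measure W (cube c (3 * r))) \<le> ennreal ks * ?I f c r"
    using avg_powr_small[OF m(1)] by (elim exE conjE) (rule that)
  obtain kl where kl: "0 \<le> kl" "\<forall>c r x f. 0 < r \<longrightarrow> 1 \<le> 3 * r \<longrightarrow> x \<in> cube c r \<longrightarrow> x \<notin> N \<longrightarrow> f \<in> borel_measurable lebesgue \<longrightarrow> (\<forall>y. 0 \<le> f y) \<longrightarrow>
    (\<integral>\<^sup>+y. ennreal ((f y * w y) powr q y) \<partial>lebesgue) \<le> 1 \<longrightarrow> tail m x \<le> avg lebesgue f c r \<longrightarrow>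
    ennreal (avg lebesgue f c r powr (q x - 1) * measure W (cube c (3 * r))) \<le> ennreal kl * ?I f c r"
    using avg_powr_large[OF m(1)] by (elim exE conjE) (rule that)
  define K where "K = ks + kl"
  have K0: "0 \<le> K" using ks(1) kl(1) by (simp add: K_def)
  have main: "ennreal (avg lebesgue f c r powr (q x - 1) * measure W (cube c (3 * r))) \<le> ennreal K * ?I f c r"
    if "0 < r" "x \<in> cube c r" "x \<notin> N" "f \<in> borel_measurable lebesgue" "\<forall>y. 0 \<le> f y"
      "(\<integral>\<^sup>+y. ennreal ((f y * w y) powr q y) \<partial>lebesgue) \<le> 1" "tail m x \<le> avg lebesgue f c r" for c r x f
  proof (cases "3 * r \<le> 1")
    case True
    have "ennreal (avg lebesgue f c r powr (q x - 1) * measure W (cube c (3 * r))) \<le> ennreal ks * ?I f c r"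
      using that True by (intro ks(2)[rule_format]) auto
    also have "\<dots> \<le> ennreal K * ?I f c r" using kl(1) by (intro mult_right_mono ennreal_leI) (auto simp: K_def)
    finally show ?thesis .
  next
    case False
    then have "ennreal (avg lebesgue f c r powr (q x - 1) * measure W (cube c (3 * r))) \<le> ennreal kl * ?I f c r"
      using that by (intro kl(2)[rule_format]) auto
    also have "\<dots> \<le> ennreal K * ?I f c r" using ks(1) by (intro mult_right_mono ennreal_leI) (auto simp: K_def)
    finally show ?thesis .
  qed
  define k where "k = max 1 k1"
  have k: "1 \<le> k" "k1 \<le> k" by (auto simp: k_def)
  define e where "e = enn2real (\<integral>\<^sup>+x. ennreal (tail m x) \<partial>W)"
  have e: "(\<integral>\<^sup>+x. ennreal (tail m x) \<partial>W) = ennreal e" "0 \<le> e" using m(2) by (auto simp: e_def)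
  \<comment> \<open>The estimate for the power \<open>q x - 1\<close> is raised to the power
    \<open>conjexp (q x)\<close>, at most \<open>conjexp lo\<close>; the maximum with 1 makes the
    constant uniform in \<open>x\<close>.\<close>
  define Kb where "Kb = max 1 (K * k) powr conjexp lo"
  define s where "s y = (1 / w y) powr conjexp (q y)" for y
  have s_pos: "0 < s y" for y unfolding s_def using w_pos[of y] by (simp only: powr_gt_zero) simp
  have cq: "1 < conjexp (q y)" for y using q_gt_1 by (rule conjexp_gt_1)
  have cq_mult: "conjexp (q y) * (q y - 1) = q y" for y using q_gt_1[of y] by (simp add: conjexp_def)
  have [measurable]: "(\<lambda>y. conjexp (q y)) \<in> borel_measurable lebesgue" unfolding conjexp_def by measurable
  show ?thesis
  proof (intro exI[of _ "Kb * k2 + e"] conjI allI impI)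
    show "0 \<le> Kb * k2 + e" using k2(1) e(2) by (simp add: Kb_def)
    fix F :: "('a \<times> real) set" and f :: "'a \<Rightarrow> real"
    assume F: "finite F" "\<forall>(c, r)\<in>F. 0 < r" and fm [measurable]: "f \<in> borel_measurable lebesgue" and f0: "\<forall>y. 0 \<le> f y"
      and f1: "(\<integral>\<^sup>+y. ennreal ((f y * w y) powr q y) \<partial>lebesgue) \<le> 1"
    \<comment> \<open>\<open>s\<close> is the density of \<open>Sg\<close>, so integrals of
      \<open>f\<close> become integrals of \<open>g\<close> over \<open>Sg\<close>; as
      \<open>s powr (1 - q) = w powr q\<close>, the modulars agree as well.\<close>
    define g where "g y = f y / s y" for y
    have [measurable]: "g \<in> borel_measurable lebesgue" unfolding g_def s_def by measurable
    have g0: "0 \<le> g y" for y using f0 s_pos[of y] by (simp add: g_def)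
    define G where "G = maxop Sg F g"
    have [measurable]: "G \<in> borel_measurable lebesgue"
      using borel_measurable_maxop[OF F(1), of Sg g] unfolding G_def by (simp cong: measurable_cong_sets)
    have G0: "0 \<le> G y" for y unfolding G_def using F(1) by (rule maxop_nonneg)
    have gq: "(\<integral>\<^sup>+x. ennreal (g x powr q x) \<partial>Sg) \<le> 1"
    proof -
      have "(\<integral>\<^sup>+x. ennreal (g x powr q x) \<partial>Sg) = (\<integral>\<^sup>+x. ennreal (s x) * ennreal (g x powr q x) \<partial>lebesgue)"
        unfolding s_def by (subst nn_integral_density) auto
      also have "\<dots> = (\<integral>\<^sup>+y. ennreal ((f y * w y) powr q y) \<partial>lebesgue)"
      proof (intro nn_integral_cong)
        fix y
        have "s y * g y powr q y = f y powr q y * (s y powr 1 / s y powr q y)"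
          unfolding g_def using f0 s_pos[of y] by (simp add: powr_divide)
        also have "s y powr 1 / s y powr q y = s y powr (1 - q y)" by (simp add: powr_diff)
        also have "\<dots> = (1 / w y) powr (- q y)"
          unfolding s_def powr_powr using cq_mult[of y] by (simp add: algebra_simps)
        also have "\<dots> = w y powr q y" using w_pos[of y] by (simp add: powr_divide powr_minus field_simps)
        finally have "s y * g y powr q y = (f y * w y) powr q y" using f0 w_pos[of y] by (simp add: powr_mult)
        then show "ennreal (s y) * ennreal (g y powr q y) = ennreal ((f y * w y) powr q y)"
          using s_pos[of y] by (simp flip: ennreal_mult)
      qed
      finally show ?thesis using f1 by simp
    qed
    have Gq: "(\<integral>\<^sup>+x. ennreal (G x powr q x) \<partial>Sg) \<le> ennreal k"
    proof -
      have "(\<integral>\<^sup>+x. ennreal (G x powr q x) \<partial>Sg) \<le> ennreal k1"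
        unfolding G_def using F g0 gq by (intro k1(2)[rule_format]) auto
      also have "\<dots> \<le> ennreal k" using k by (intro ennreal_leI)
      finally show ?thesis .
    qed
    \<comment> \<open>Since \<open>conjexp q * (q - 1) = q\<close>, the conjugate modular of
      \<open>h\<close> over \<open>W\<close> is at most \<open>1 / k\<close> times the modular of
      \<open>G\<close> over \<open>Sg\<close>.\<close>
    define h where "h y = G y powr (q y - 1) / (w y powr q y * k)" for y
    have [measurable]: "h \<in> borel_measurable lebesgue" unfolding h_def by measurable
    have h0: "0 \<le> h y" for y using k w_pos[of y] by (simp add: h_def)
    have hq: "(\<integral>\<^sup>+x. ennreal (h x powr conjexp (q x)) \<partial>W) \<le> 1"
    proof -
      have "(\<integral>\<^sup>+x. ennreal (h x powr conjexp (q x)) \<partial>W) = (\<integral>\<^sup>+x. ennreal (w x powr q x) * ennreal (h x powr conjexp (q x)) \<partial>lebesgue)"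
        by (subst nn_integral_W) auto
      also have "\<dots> \<le> (\<integral>\<^sup>+x. ennreal (1 / k) * (ennreal (s x) * ennreal (G x powr q x)) \<partial>lebesgue)"
      proof (intro nn_integral_mono)
        fix y
        have "h y powr conjexp (q y) = G y powr q y / ((w y powr q y) powr conjexp (q y) * k powr conjexp (q y))"
          unfolding h_def using G0 k w_pos[of y] cq_mult[of y] by (simp add: powr_divide powr_mult powr_powr mult.commute)
        moreover have "w y powr q y / (w y powr q y) powr conjexp (q y) = s y"
        proof -
          have "q y - q y * conjexp (q y) = - conjexp (q y)"
            using q_gt_1[of y] by (simp add: conjexp_def field_simps)
          then have "w y powr q y / (w y powr q y) powr conjexp (q y) = w y powr (- conjexp (q y))"
            by (simp add: powr_powr flip: powr_diff)
          also have "\<dots> = s y" unfolding s_def using w_pos[of y] by (simp add: powr_divide powr_minus field_simps)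
          finally show ?thesis .
        qed
        moreover have "w y powr q y * (G y powr q y / (X * k powr conjexp (q y))) = w y powr q y / X * G y powr q y / k powr conjexp (q y)" for X
          by simp
        ultimately have "w y powr q y * h y powr conjexp (q y) = s y * G y powr q y / k powr conjexp (q y)"
          by (simp only:)
        also have "\<dots> \<le> s y * G y powr q y / k"
        proof -
          have "k powr 1 \<le> k powr conjexp (q y)" using k cq[of y] by (intro powr_mono) auto
          then show ?thesis using k s_pos[of y] by (intro divide_left_mono) auto
        qed
        finally have "ennreal (w y powr q y * h y powr conjexp (q y)) \<le> ennreal (1 / k * (s y * G y powr q y))"
          by (intro ennreal_leI) simp
        then show "ennreal (w y powr q y) * ennreal (h y powr conjexp (q y)) \<le> ennreal (1 / k) * (ennreal (s y) * ennreal (G y powr q y))"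
          using k s_pos[of y] by (simp add: ennreal_mult[symmetric] less_imp_le)
      qed
      also have "\<dots> = ennreal (1 / k) * (\<integral>\<^sup>+x. ennreal (G x powr q x) \<partial>Sg)"
        unfolding s_def by (subst nn_integral_cmult) (auto simp: nn_integral_density)
      also have "\<dots> \<le> ennreal (1 / k) * ennreal k" by (intro mult_left_mono Gq) auto
      also have "\<dots> = 1" using k by (simp flip: ennreal_mult)
      finally show ?thesis .
    qed
    let ?T = "maxop W F h"
    have T0: "0 \<le> ?T x" for x using F(1) by (rule maxop_nonneg)
    have [measurable]: "?T \<in> borel_measurable lebesgue"
      using borel_measurable_maxop[OF F(1), of W h] by (simp cong: measurable_cong_sets)
    have [measurable]: "maxop lebesgue F f \<in> borel_measurable lebesgue"
      using borel_measurable_maxop[OF F(1), of lebesgue f] by simp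
    have hfin: "(\<integral>\<^sup>+y\<in>cube c r. ennreal (h y) \<partial>W) < \<infinity>" for c r
    proof -
      have "(\<integral>\<^sup>+y\<in>cube c r. ennreal (h y) \<partial>W) \<le> (\<integral>\<^sup>+y. ennreal (h y powr conjexp (q y)) + indicator (cube c r) y \<partial>W)"
      proof (intro nn_integral_mono)
        fix y
        have "h y powr 1 \<le> 1 + h y powr conjexp (q y)" using h0 cq[of y] by (intro powr_le_1_plus) auto
        then have "ennreal (h y) \<le> ennreal (h y powr conjexp (q y) + 1)" using h0 by (intro ennreal_leI) simp
        then show "ennreal (h y) * indicator (cube c r) y \<le> ennreal (h y powr conjexp (q y)) + indicator (cube c r) y"
          by (auto simp: indicator_def)
      qed
      also have "\<dots> = (\<integral>\<^sup>+y. ennreal (h y powr conjexp (q y)) \<partial>W) + emeasure W (cube c r)"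
        by (subst nn_integral_add) auto
      also have "\<dots> < \<infinity>" using hq CW.emeasure_cube_finite[of c r] by (auto intro: le_less_trans)
      finally show ?thesis .
    qed
    \<comment> \<open>In the first case the value is below \<open>tail m x <= 1\<close>, and so is
      its power, the exponent being at least 1. In the second the maximum is attained at a cube to
      which \<open>main\<close> applies.\<close>
    have pw: "maxop lebesgue F f x powr q x \<le> Kb * ?T x powr conjexp (q x) + tail m x" if x: "x \<notin> N" for x
    proof (cases "maxop lebesgue F f x < tail m x")
      case True
      have "maxop lebesgue F f x powr q x \<le> maxop lebesgue F f x powr 1"
        using True tail_le_1[OF m(1), of x] q_ge_1[of x] maxop_nonneg[OF F(1)] by (intro powr_le_powr_self) auto
      also have "\<dots> \<le> tail m x" using True maxop_nonneg[OF F(1), of lebesgue f x] by simp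
      finally show ?thesis using T0[of x] by (simp add: Kb_def add_increasing)
    next
      case False
      then have nz: "maxop lebesgue F f x \<noteq> 0" using tail_pos[of m x] by linarith
      obtain c r where cr: "(c, r) \<in> F" "x \<in> cube c r" "maxop lebesgue F f x = avg lebesgue f c r"
        using nz by (cases rule: maxop_cases[OF F(1), of lebesgue f x]) auto
      have r: "0 < r" using F(2) cr(1) by auto
      define A where "A = avg lebesgue f c r"
      define V where "V = measure W (cube c (3 * r))"
      have V: "0 < V" unfolding V_def using r by (intro CW.measure_cube_pos) simp
      \<comment> \<open>All points of the cube see the same average over \<open>Sg\<close>, so the
        constant base under the integral may be replaced by \<open>G y\<close>.\<close>
      have GA: "A * (6 * r) ^ DIM('a) / measure Sg (cube c (3 * r)) \<le> G y" if y: "y \<in> cube c r" for y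
      proof -
        have "(\<integral>\<^sup>+y\<in>cube c r. ennreal (g y) \<partial>Sg) = (\<integral>\<^sup>+y. ennreal (s y) * (ennreal (g y) * indicator (cube c r) y) \<partial>lebesgue)"
          unfolding s_def by (subst nn_integral_density) auto
        also have "\<dots> = (\<integral>\<^sup>+y\<in>cube c r. ennreal (f y) \<partial>lebesgue)"
        proof (intro nn_integral_cong)
          fix y show "ennreal (s y) * (ennreal (g y) * indicator (cube c r) y) = ennreal (f y) * indicator (cube c r) y"
            using s_pos[of y] g0[of y] by (auto simp: g_def indicator_def simp flip: ennreal_mult)
        qed
        finally have "avg Sg g c r = A * (6 * r) ^ DIM('a) / measure Sg (cube c (3 * r))"
          unfolding avg_def A_def using r by (simp add: measure_cube)
        then show ?thesis unfolding G_def using avg_le_maxop[OF F(1) cr(1) y, of Sg g] by simp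
      qed
      have "ennreal (A powr (q x - 1) * V) \<le> ennreal K * ?I f c r"
        unfolding A_def V_def using r cr x f0 f1 False by (intro main) auto
      also have "?I f c r \<le> (\<integral>\<^sup>+y\<in>cube c r. ennreal (G y powr (q y - 1)) \<partial>lebesgue)"
      proof (intro nn_integral_mono)
        fix y
        have "(A * (6 * r) ^ DIM('a) / measure Sg (cube c (3 * r))) powr (q y - 1) \<le> G y powr (q y - 1)" if "y \<in> cube c r"
          using GA[OF that] q_ge_1[of y] r by (intro powr_mono2) (auto simp: A_def avg_nonneg)
        then show "ennreal ((avg lebesgue f c r * (6 * r) ^ DIM('a) / measure Sg (cube c (3 * r))) powr (q y - 1)) * indicator (cube c r) y
          \<le> ennreal (G y powr (q y - 1)) * indicator (cube c r) y"
          unfolding A_def by (auto simp: indicator_def intro: ennreal_leI)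
      qed
      also have "\<dots> = (\<integral>\<^sup>+y. ennreal (w y powr q y) * (ennreal k * (ennreal (h y) * indicator (cube c r) y)) \<partial>lebesgue)"
      proof (intro nn_integral_cong)
        fix y
        have "G y powr (q y - 1) = w y powr q y * (k * h y)" unfolding h_def using w_pos[of y] k by simp
        then show "ennreal (G y powr (q y - 1)) * indicator (cube c r) y
            = ennreal (w y powr q y) * (ennreal k * (ennreal (h y) * indicator (cube c r) y))"
          using h0[of y] k by (auto simp: indicator_def simp flip: ennreal_mult)
      qed
      also have "\<dots> = ennreal k * (\<integral>\<^sup>+y\<in>cube c r. ennreal (h y) \<partial>W)"
        by (subst nn_integral_W[symmetric]) (auto simp: nn_integral_cmult)
      also have "(\<integral>\<^sup>+y\<in>cube c r. ennreal (h y) \<partial>W) = ennreal (avg W h c r * V)"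
        using hfin[of c r] V unfolding avg_def V_def by (simp add: less_top)
      finally have "ennreal (A powr (q x - 1) * V) \<le> ennreal K * (ennreal k * ennreal (avg W h c r * V))"
        by (simp add: mult_left_mono)
      also have "\<dots> = ennreal (K * (k * (avg W h c r * V)))"
        using K0 k V avg_nonneg[of W h c r] by (simp add: ennreal_mult)
      finally have "A powr (q x - 1) * V \<le> K * (k * (avg W h c r * V))"
        using K0 k V avg_nonneg[of W h c r] by (subst (asm) ennreal_le_iff) auto
      then have "A powr (q x - 1) \<le> K * k * avg W h c r" using V by (simp add: mult.assoc[symmetric])
      also have "\<dots> \<le> K * k * ?T x" using K0 k avg_le_maxop[OF F(1) cr(1,2), of W h] by (intro mult_left_mono) auto
      also have "\<dots> \<le> max 1 (K * k) * ?T x" using T0 by (intro mult_right_mono) auto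
      finally have "(A powr (q x - 1)) powr conjexp (q x) \<le> (max 1 (K * k) * ?T x) powr conjexp (q x)"
        using cq[of x] by (intro powr_mono2) auto
      also have "\<dots> = max 1 (K * k) powr conjexp (q x) * ?T x powr conjexp (q x)" using T0 by (simp add: powr_mult)
      also have "\<dots> \<le> Kb * ?T x powr conjexp (q x)" unfolding Kb_def
        using conjexp_antimono[OF lo_gt_1 lo_le_q] by (intro mult_right_mono powr_mono) auto
      finally have "A powr q x \<le> Kb * ?T x powr conjexp (q x)"
        using cq_mult[of x] by (simp add: powr_powr mult.commute)
      then show ?thesis unfolding cr(3) A_def[symmetric] using tail_pos[of m x] by linarith
    qed
    have "(\<integral>\<^sup>+y. ennreal ((maxop lebesgue F f y * w y) powr q y) \<partial>lebesgue)
        = (\<integral>\<^sup>+y. ennreal (maxop lebesgue F f y powr q y) \<partial>W)"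
      by (subst nn_integral_W) (auto intro!: nn_integral_cong simp: powr_mult maxop_nonneg[OF F(1)] w_pos less_imp_le mult.commute simp flip: ennreal_mult)
    also have "\<dots> \<le> (\<integral>\<^sup>+y. ennreal Kb * ennreal (?T y powr conjexp (q y)) + ennreal (tail m y) \<partial>W)"
    proof (intro nn_integral_mono_AE)
      have "AE y in W. y \<notin> N"
        using null_N absolutely_continuous_W by (intro AE_not_in) (auto simp: absolutely_continuous_def)
      then show "AE y in W. ennreal (maxop lebesgue F f y powr q y) \<le> ennreal Kb * ennreal (?T y powr conjexp (q y)) + ennreal (tail m y)"
      proof eventually_elim
        case (elim y)
        have "ennreal (maxop lebesgue F f y powr q y) \<le> ennreal (Kb * ?T y powr conjexp (q y) + tail m y)"
          using pw[OF elim] by (rule ennreal_leI)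
        then show ?case using tail_pos[of m y] by (simp add: ennreal_mult Kb_def)
      qed
    qed
    also have "\<dots> = ennreal Kb * (\<integral>\<^sup>+y. ennreal (?T y powr conjexp (q y)) \<partial>W) + ennreal e"
      unfolding e(1)[symmetric] by (subst nn_integral_add) (auto simp: nn_integral_cmult)
    also have "\<dots> \<le> ennreal Kb * ennreal k2 + ennreal e"
      using F h0 hq by (intro add_right_mono mult_left_mono k2(2)[rule_format]) auto
    also have "\<dots> = ennreal (Kb * k2 + e)" using k2(1) e(2) by (simp add: ennreal_mult Kb_def)
    finally show "(\<integral>\<^sup>+y. ennreal ((maxop lebesgue F f y * w y) powr q y) \<partial>lebesgue) \<le> ennreal (Kb * k2 + e)" .
  qed
qed

end

section \<open>From finite families of cubes to the maximal operator\<close>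

lemma maxop_mono:
  assumes "F \<subseteq> F'" "finite F'" shows "maxop M F g x \<le> maxop M F' g x"
  unfolding maxop_def using assms by (intro Max_mono) auto

lemma cubes_eq: "cubes = {cube c r | c r. 0 < r}"
proof (intro equalityI subsetI)
  fix Q :: "'a set" assume "Q \<in> cubes"
  then obtain a l where Q: "Q = cbox a (a + l *\<^sub>R One)" "0 < l" by (auto simp: cubes_def)
  have "Q = cube (a + (l / 2) *\<^sub>R One) (l / 2)"
    unfolding cube_def Q(1) by (simp add: add.assoc flip: scaleR_add_left)
  then show "Q \<in> {cube c r | c r. 0 < r}"
    using Q(2) by (intro CollectI exI[of _ "a + (l / 2) *\<^sub>R One"] exI[of _ "l / 2"] conjI) auto
next
  fix Q :: "'a set" assume "Q \<in> {cube c r | c r. 0 < r}"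
  then obtain c r where Q: "Q = cube c r" "0 < r" by auto
  have "Q = cbox (c - r *\<^sub>R One) ((c - r *\<^sub>R One) + (2 * r) *\<^sub>R One)"
    unfolding Q(1) cube_def by (intro arg_cong2[where f = cbox]) (simp_all add: algebra_simps flip: scaleR_add_left)
  then show "Q \<in> cubes" using Q(2) unfolding cubes_def by (auto intro!: exI[of _ "c - r *\<^sub>R One"] exI[of _ "2 * r"])
qed

lemma less_maximalE:
  fixes f :: "'a::euclidean_space \<Rightarrow> real"
  assumes "t < maximal f x"
  obtains c r where "0 < r" "x \<in> cube c r"
    "t < (\<integral>\<^sup>+y\<in>cube c r. ennreal \<bar>f y\<bar> \<partial>lebesgue) / ennreal ((2 * r) ^ DIM('a))"
proof -
  obtain Q where Q: "Q \<in> cubes" "t < (\<integral>\<^sup>+y\<in>Q. ennreal \<bar>f y\<bar> \<partial>lebesgue) / emeasure lebesgue Q * indicator Q x"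
    using assms unfolding maximal_def less_SUP_iff by blast
  then obtain c r where cr: "Q = cube c r" "0 < r" unfolding cubes_eq by blast
  have "x \<in> Q" using Q(2) by (cases "x \<in> Q") auto
  then show thesis using that[of r c] Q(2) cr emeasure_cube[of r c] by auto
qed

lemma maximal_ge:
  fixes f :: "'a::euclidean_space \<Rightarrow> real"
  assumes "0 < r" "x \<in> cube c r"
  shows "(\<integral>\<^sup>+y\<in>cube c r. ennreal \<bar>f y\<bar> \<partial>lebesgue) / ennreal ((2 * r) ^ DIM('a)) \<le> maximal f x"
proof -
  have "(\<integral>\<^sup>+y\<in>cube c r. ennreal \<bar>f y\<bar> \<partial>lebesgue) / emeasure lebesgue (cube c r) * indicator (cube c r) x \<le> maximal f x"
    unfolding maximal_def using assms(1) by (intro SUP_upper) (auto simp: cubes_eq)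
  then show ?thesis using assms by (subst (asm) emeasure_cube) auto
qed

text \<open>The cube witnessing \<open>t < maximal f x\<close> is closed and may have
  \<open>x\<close> on its boundary. A slightly larger radius keeps the average above
  \<open>t\<close>, by continuity if the integral is finite and trivially otherwise; the interior of
  the larger cube is then a neighbourhood of \<open>x\<close> inside the level set.\<close>

lemma open_less_maximal:
  fixes f :: "'a::euclidean_space \<Rightarrow> real"
  shows "open {x. t < maximal f x}"
  unfolding open_subopen[of "{x. t < maximal f x}"]
proof
  fix x assume "x \<in> {x. t < maximal f x}"
  then have "t < maximal f x" by simp
  then obtain c r where cr: "0 < r" "x \<in> cube c r"
      "t < (\<integral>\<^sup>+y\<in>cube c r. ennreal \<bar>f y\<bar> \<partial>lebesgue) / ennreal ((2 * r) ^ DIM('a))" by (rule less_maximalE)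
  define I where "I = (\<integral>\<^sup>+y\<in>cube c r. ennreal \<bar>f y\<bar> \<partial>lebesgue)"
  have "\<exists>r'>r. t < I / ennreal ((2 * r') ^ DIM('a))"
  proof (cases I)
    case (real i)
    have P: "0 < (2 * r') ^ DIM('a)" if "r \<le> r'" for r' using that cr(1) by simp
    have t: "t < ennreal (i / (2 * r) ^ DIM('a))"
      using cr(3) real P[of r] unfolding I_def[symmetric] by (simp add: divide_ennreal)
    have "((\<lambda>r'. i / (2 * r') ^ DIM('a)) \<longlongrightarrow> i / (2 * r) ^ DIM('a)) (at_right r)"
      using cr(1) by (intro tendsto_intros) auto
    then have "((\<lambda>r'. ennreal (i / (2 * r') ^ DIM('a))) \<longlongrightarrow> ennreal (i / (2 * r) ^ DIM('a))) (at_right r)"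
      by (rule tendsto_ennrealI)
    from order_tendstoD(1)[OF this t] have "\<forall>\<^sub>F r' in at_right r. t < ennreal (i / (2 * r') ^ DIM('a))" .
    then obtain b where b: "b > r" "\<forall>y>r. y < b \<longrightarrow> t < ennreal (i / (2 * y) ^ DIM('a))"
      unfolding eventually_at_right_field by blast
    have "r < (r + b) / 2" using b(1) by simp
    moreover have "t < ennreal (i / (2 * ((r + b) / 2)) ^ DIM('a))" using b(1) by (intro b(2)[rule_format]) auto
    ultimately show ?thesis using real P[of "(r + b) / 2"] by (intro exI[of _ "(r + b) / 2"]) (auto simp: divide_ennreal)
  next
    case top
    have "t < \<infinity>" using cr(3) by (rule order.strict_trans2) simp
    then have "t < I / ennreal ((2 * (r + 1)) ^ DIM('a))" unfolding top
      using cr(1) by (simp add: ennreal_top_divide)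
    then show ?thesis by (intro exI[of _ "r + 1"]) simp
  qed
  then obtain r' where r': "r < r'" "t < I / ennreal ((2 * r') ^ DIM('a))" by blast
  define T where "T = box (c - r' *\<^sub>R One) (c + r' *\<^sub>R One)"
  have "x \<in> T" unfolding T_def mem_box
  proof
    fix i :: 'a assume i: "i \<in> Basis"
    have "\<bar>x \<bullet> i - c \<bullet> i\<bar> \<le> r" using cr(2) i unfolding mem_cube by blast
    then show "(c - r' *\<^sub>R One) \<bullet> i < x \<bullet> i \<and> x \<bullet> i < (c + r' *\<^sub>R One) \<bullet> i"
      using i r'(1) by (simp add: inner_diff_left inner_add_left) linarith
  qed
  moreover have "T \<subseteq> {x. t < maximal f x}"
  proof
    fix y assume "y \<in> T"
    then have y: "y \<in> cube c r'" unfolding T_def cube_def using box_subset_cbox by blast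
    have "I \<le> (\<integral>\<^sup>+y\<in>cube c r'. ennreal \<bar>f y\<bar> \<partial>lebesgue)"
      unfolding I_def using cube_mono[of r r' c] r'(1) by (intro nn_integral_mono mult_left_mono) (auto simp: indicator_def)
    then have "I / ennreal ((2 * r') ^ DIM('a)) \<le> (\<integral>\<^sup>+y\<in>cube c r'. ennreal \<bar>f y\<bar> \<partial>lebesgue) / ennreal ((2 * r') ^ DIM('a))"
      by (rule divide_right_mono_ennreal)
    also have "\<dots> \<le> maximal f y" using r'(1) cr(1) y by (intro maximal_ge) auto
    finally show "y \<in> {x. t < maximal f x}" using r'(2) by auto
  qed
  ultimately show "\<exists>T. open T \<and> x \<in> T \<and> T \<subseteq> {x. t < maximal f x}"
    unfolding T_def by (intro exI[of _ T]) (auto simp: T_def)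
qed

lemma borel_measurable_maximal [measurable]: "maximal f \<in> borel_measurable lebesgue"
proof (rule borel_measurableI_greater)
  fix t
  have "{x. t < maximal f x} \<in> sets lebesgue" 
    by (rule sets_completionI_sets) (auto intro: borel_open open_less_maximal)
  then show "{x \<in> space lebesgue. t < maximal f x} \<in> sets lebesgue" by simp
qed

text \<open>Centres from a countable dense set and rational radii suffice when cubes only have to be
  covered, and at most doubling the radius costs a bounded factor in averages. The sets
  \<open>E n\<close> increase, and so do the maximal operators over them.\<close>

lemma countable_cubes:
  obtains E :: "nat \<Rightarrow> ('a::euclidean_space \<times> real) set"
  where "\<And>n. finite (E n)" "\<And>n. \<forall>(c, r)\<in>E n. 0 < r" "incseq E"
    "\<And>c r. 0 < r \<Longrightarrow> \<exists>n c' r'. (c', r') \<in> E n \<and> cube c r \<subseteq> cube c' r' \<and> r' \<le> 2 * r"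
proof -
  obtain D0 :: "'a set" where D0: "countable D0" "\<And>X. open X \<Longrightarrow> X \<noteq> {} \<Longrightarrow> \<exists>d\<in>D0. d \<in> X"
    using countable_dense_exists by (metis (full_types))
  define D where "D = D0 \<times> (\<rat> \<inter> {0<..} :: real set)"
  have cD: "countable D" unfolding D_def using D0(1) countable_rat by (intro countable_SIGMA) auto
  have approx: "\<exists>c' r'. (c', r') \<in> D \<and> cube c r \<subseteq> cube c' r' \<and> r' \<le> 2 * r" if r: "0 < r" for c r
  proof -
    obtain d where d: "d \<in> D0" "d \<in> ball c (r / 2)" using D0(2)[of "ball c (r / 2)"] r by auto
    obtain r' where r': "r' \<in> \<rat>" "3 / 2 * r < r'" "r' < 2 * r" using Rats_dense_in_real[of "3 / 2 * r" "2 * r"] r by auto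
    have "cube c r \<subseteq> cube d r'"
    proof
      fix y assume y: "y \<in> cube c r"
      show "y \<in> cube d r'" unfolding mem_cube
      proof
        fix i :: 'a assume i: "i \<in> Basis"
        have "\<bar>(c - d) \<bullet> i\<bar> \<le> norm (c - d)" by (rule Basis_le_norm[OF i])
        also have "\<dots> < r / 2" using d(2) by (simp add: dist_norm)
        finally have "\<bar>c \<bullet> i - d \<bullet> i\<bar> < r / 2" by (simp add: inner_diff_left)
        moreover have "\<bar>y \<bullet> i - c \<bullet> i\<bar> \<le> r" using y i unfolding mem_cube by blast
        ultimately show "\<bar>y \<bullet> i - d \<bullet> i\<bar> \<le> r'" using r'(2) by linarith
      qed
    qed
    then show ?thesis using d(1) r' r unfolding D_def by (intro exI[of _ d] exI[of _ r']) auto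
  qed
  have ne: "D \<noteq> {}" using approx[of 1 0] by auto
  define E where "E n = from_nat_into D ` {..n}" for n
  show thesis
  proof
    show "finite (E n)" for n by (simp add: E_def)
    show "\<forall>(c, r)\<in>E n. 0 < r" for n
    proof -
      have "E n \<subseteq> D" unfolding E_def using from_nat_into[OF ne] by auto
      then show ?thesis by (auto simp: D_def)
    qed
    show "incseq E" unfolding E_def incseq_def by (auto intro!: image_mono)
    show "\<exists>n c' r'. (c', r') \<in> E n \<and> cube c r \<subseteq> cube c' r' \<and> r' \<le> 2 * r" if r: "0 < r" for c r
    proof -
      obtain c' r' where *: "(c', r') \<in> D" "cube c r \<subseteq> cube c' r'" "r' \<le> 2 * r" using approx[OF r] by blast
      obtain n where "from_nat_into D n = (c', r')" using from_nat_into_surj[OF cD *(1)] by blast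
      then have "(c', r') \<in> E n" unfolding E_def by (metis atMost_iff image_eqI order_refl)
      with * show ?thesis by blast
    qed
  qed
qed

context A_weight
begin

lemma maximal_weighted_bound:
  "\<exists>K\<ge>0. \<forall>f. f \<in> borel_measurable lebesgue \<longrightarrow> (\<integral>\<^sup>+y. ennreal ((\<bar>f y\<bar> * w y) powr q y) \<partial>lebesgue) \<le> 1 \<longrightarrow>
    (AE x in lebesgue. maximal f x < \<infinity>) \<and>
    (\<integral>\<^sup>+y. ennreal ((enn2real (maximal f y) * w y) powr q y) \<partial>lebesgue) \<le> ennreal K"
proof -
  obtain K where K: "0 \<le> K" "\<forall>F f. finite F \<longrightarrow> (\<forall>(c, r)\<in>F. 0 < r) \<longrightarrow> f \<in> borel_measurable lebesgue \<longrightarrow> (\<forall>y. 0 \<le> f y) \<longrightarrow>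
    (\<integral>\<^sup>+y. ennreal ((f y * w y) powr q y) \<partial>lebesgue) \<le> 1 \<longrightarrow>
    (\<integral>\<^sup>+y. ennreal ((maxop lebesgue F f y * w y) powr q y) \<partial>lebesgue) \<le> ennreal K"
    using maxop_weighted_bound by (elim exE conjE) (rule that)
  obtain E :: "nat \<Rightarrow> ('a \<times> real) set" where E: "\<And>n. finite (E n)" "\<And>n. \<forall>(c, r)\<in>E n. 0 < r" "incseq E"
    "\<And>c r. 0 < r \<Longrightarrow> \<exists>n c' r'. (c', r') \<in> E n \<and> cube c r \<subseteq> cube c' r' \<and> r' \<le> 2 * r"
    by (rule countable_cubes) blast
  \<comment> \<open>Loss in passing from an average over radius \<open>r\<close> to
    \<open>avg\<close> over radius \<open>r' <= 2 * r\<close>: the denominator there belongs to the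
    triple, of radius at most \<open>6 * r\<close>.\<close>
  define D where "D = (6::real) ^ DIM('a)"
  have D: "0 < D" by (simp add: D_def)
  \<comment> \<open>The additional factor 2 appears because the comparison \<open>le\<close> asks
    for a strict inequality and is therefore applied to half of the maximal function.\<close>
  define C where "C = (2 * D) powr hi"
  show ?thesis
  proof (intro exI[of _ "C * K"] conjI allI impI)
    show "0 \<le> C * K" using K(1) by (simp add: C_def)
    fix f :: "'a \<Rightarrow> real"
    assume [measurable]: "f \<in> borel_measurable lebesgue" and f1: "(\<integral>\<^sup>+y. ennreal ((\<bar>f y\<bar> * w y) powr q y) \<partial>lebesgue) \<le> 1"
    define T where "T n = maxop lebesgue (E n) (\<lambda>y. \<bar>f y\<bar>)" for n
    have [measurable]: "T n \<in> borel_measurable lebesgue" for n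
      unfolding T_def using E(1) by (intro borel_measurable_maxop) auto
    have T0: "0 \<le> T n x" for n x unfolding T_def using E(1) by (rule maxop_nonneg)
    have approx: "\<exists>n. j \<le> D * T n x" if j: "0 \<le> j" "ennreal j < maximal f x" for j x
    proof -
      obtain c r where cr: "0 < r" "x \<in> cube c r"
        "ennreal j < (\<integral>\<^sup>+y\<in>cube c r. ennreal \<bar>f y\<bar> \<partial>lebesgue) / ennreal ((2 * r) ^ DIM('a))"
        using j(2) by (rule less_maximalE)
      obtain n c' r' where n: "(c', r') \<in> E n" "cube c r \<subseteq> cube c' r'" "r' \<le> 2 * r" using E(4)[OF cr(1)] by blast
      have r': "0 < r'" using E(2) n(1) by blast
      have fin: "(\<integral>\<^sup>+y\<in>cube c' r'. ennreal \<bar>f y\<bar> \<partial>lebesgue) \<le> ennreal (2 * mu c' r')"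
        using r' f1 by (intro nn_integral_cube_le) auto
      define i where "i = enn2real (\<integral>\<^sup>+y\<in>cube c' r'. ennreal \<bar>f y\<bar> \<partial>lebesgue)"
      have i: "(\<integral>\<^sup>+y\<in>cube c' r'. ennreal \<bar>f y\<bar> \<partial>lebesgue) = ennreal i" "0 \<le> i"
        using le_less_trans[OF fin ennreal_less_top] unfolding i_def by auto
      have "(\<integral>\<^sup>+y\<in>cube c r. ennreal \<bar>f y\<bar> \<partial>lebesgue) \<le> ennreal i"
        unfolding i(1)[symmetric] using n(2) by (intro nn_integral_mono mult_left_mono) (auto simp: indicator_def)
      then have "(\<integral>\<^sup>+y\<in>cube c r. ennreal \<bar>f y\<bar> \<partial>lebesgue) / ennreal ((2 * r) ^ DIM('a)) \<le> ennreal i / ennreal ((2 * r) ^ DIM('a))"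
        by (rule divide_right_mono_ennreal)
      with cr(3) have "ennreal j < ennreal (i / (2 * r) ^ DIM('a))" using i(2) cr(1) by (simp add: divide_ennreal)
      then have "j \<le> i / (2 * r) ^ DIM('a)" using j by (simp add: ennreal_less_iff)
      also have "\<dots> = D * (i / (6 * (2 * r)) ^ DIM('a))" unfolding D_def power_mult_distrib[of 6 "2 * r"] by simp
      also have "\<dots> \<le> D * (i / (2 * (3 * r')) ^ DIM('a))"
        using D i(2) r' n(3) by (intro mult_left_mono divide_left_mono power_mono mult_pos_pos) auto
      also have "i / (2 * (3 * r')) ^ DIM('a) = avg lebesgue (\<lambda>y. \<bar>f y\<bar>) c' r'"
        unfolding avg_def i_def using r' by (simp add: measure_cube)
      also have "D * \<dots> \<le> D * T n x"
        unfolding T_def using D n cr(2) by (intro mult_left_mono avg_le_maxop E(1)) auto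
      finally show ?thesis by blast
    qed
    define Ph where "Ph n x = ennreal ((T n x * w x) powr q x)" for n x
    have [measurable]: "Ph n \<in> borel_measurable lebesgue" for n unfolding Ph_def by measurable
    have inc: "incseq Ph" unfolding incseq_def le_fun_def
    proof (intro allI impI)
      fix n n' x assume "n \<le> (n'::nat)"
      then have "T n x \<le> T n' x" unfolding T_def using E(1,3) by (intro maxop_mono) (auto simp: incseq_def)
      then show "Ph n x \<le> Ph n' x" unfolding Ph_def using T0 w_pos[of x] q_ge_1[of x]
        by (intro ennreal_leI powr_mono2 mult_right_mono) (auto simp: less_imp_le)
    qed
    define P where "P x = (SUP n. Ph n x)" for x
    have [measurable]: "P \<in> borel_measurable lebesgue" unfolding P_def by measurable
    have "(\<integral>\<^sup>+x. P x \<partial>lebesgue) = (SUP n. \<integral>\<^sup>+x. Ph n x \<partial>lebesgue)"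
      unfolding P_def using inc by (intro nn_integral_monotone_convergence_SUP) auto
    also have "\<dots> \<le> ennreal K"
    proof (rule SUP_least)
      fix n show "(\<integral>\<^sup>+x. Ph n x \<partial>lebesgue) \<le> ennreal K"
        unfolding Ph_def T_def using E(1,2) f1 by (intro K(2)[rule_format]) auto
    qed
    finally have PK: "(\<integral>\<^sup>+x. P x \<partial>lebesgue) \<le> ennreal K" .
    then have Pfin: "AE x in lebesgue. P x \<noteq> \<infinity>"
      by (intro nn_integral_noteq_infinite) (auto simp: top_unique)
    have le: "ennreal ((j / D * w x) powr q x) \<le> P x" if j: "0 \<le> j" "ennreal j < maximal f x" for j x
    proof -
      obtain n where n: "j \<le> D * T n x" using approx[OF j] by blast
      have "(j / D * w x) powr q x \<le> (T n x * w x) powr q x"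
        using n D j(1) w_pos[of x] q_ge_1[of x] by (intro powr_mono2 mult_right_mono) (auto simp: field_simps less_imp_le)
      then have "ennreal ((j / D * w x) powr q x) \<le> Ph n x" unfolding Ph_def by (rule ennreal_leI)
      also have "\<dots> \<le> P x" unfolding P_def by (rule SUP_upper) simp
      finally show ?thesis .
    qed
    \<comment> \<open>If the maximal function were infinite at \<open>x\<close>, every level
      \<open>j\<close> would be admissible in \<open>le\<close>; the level chosen makes the
      left-hand side \<open>(p + 1) powr q x\<close>, which exceeds \<open>p\<close>, the value of
      \<open>P x\<close>.\<close>
    have fin: "maximal f x < \<infinity>" if "P x \<noteq> \<infinity>" for x
    proof (rule ccontr)
      assume "\<not> maximal f x < \<infinity>"
      then have top: "maximal f x = \<infinity>" by (simp add: top_unique not_less)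
      obtain p where p: "P x = ennreal p" "0 \<le> p" using \<open>P x \<noteq> \<infinity>\<close> by (cases "P x") auto
      have "ennreal (((D * (p + 1) / w x) / D * w x) powr q x) \<le> P x"
        using p D w_pos[of x] top by (intro le) auto
      also have "(D * (p + 1) / w x) / D * w x = p + 1" using D w_pos[of x] by simp
      finally have "(p + 1) powr q x \<le> p" unfolding p(1) using p(2) by (subst (asm) ennreal_le_iff) auto
      moreover have "(p + 1) powr 1 \<le> (p + 1) powr q x" using p(2) q_ge_1[of x] by (intro powr_mono) auto
      ultimately show False using p(2) by simp
    qed
    show "AE x in lebesgue. maximal f x < \<infinity>" using Pfin by eventually_elim (rule fin)
    have "(\<integral>\<^sup>+y. ennreal ((enn2real (maximal f y) * w y) powr q y) \<partial>lebesgue) \<le> (\<integral>\<^sup>+y. ennreal C * P y \<partial>lebesgue)"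
    proof (intro nn_integral_mono_AE)
      show "AE y in lebesgue. ennreal ((enn2real (maximal f y) * w y) powr q y) \<le> ennreal C * P y"
        using Pfin
      proof eventually_elim
        case (elim y)
        define m where "m = enn2real (maximal f y)"
        have m: "maximal f y = ennreal m" "0 \<le> m" using fin[OF elim] by (auto simp: m_def)
        show ?case
        proof (cases "m = 0")
          case False
          then have m0: "0 < m" using m by simp
          have "m * w y = 2 * D * (m / 2 / D * w y)" using D by simp
          then have "(m * w y) powr q y = (2 * D) powr q y * (m / 2 / D * w y) powr q y"
            using m0 w_pos[of y] D by (simp only: powr_mult)
          also have "\<dots> \<le> C * (m / 2 / D * w y) powr q y"
          proof -
            have "1 \<le> 2 * D" unfolding D_def by (simp add: one_le_power order_trans[of 1 2])
            then show ?thesis unfolding C_def using q_le_hi by (intro mult_right_mono powr_mono) auto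
          qed
          finally have "ennreal ((m * w y) powr q y) \<le> ennreal (C * (m / 2 / D * w y) powr q y)" by (rule ennreal_leI)
          also have "\<dots> = ennreal C * ennreal ((m / 2 / D * w y) powr q y)" by (simp add: ennreal_mult C_def)
          also have "\<dots> \<le> ennreal C * P y" using m0 m by (intro mult_left_mono le) (auto simp: ennreal_less_iff)
          finally show ?thesis unfolding m_def .
        qed (simp flip: m_def)
      qed
    qed
    also have "\<dots> = ennreal C * (\<integral>\<^sup>+y. P y \<partial>lebesgue)" by (rule nn_integral_cmult) simp
    also have "\<dots> \<le> ennreal C * ennreal K" by (intro mult_left_mono PK) auto
    also have "\<dots> = ennreal (C * K)" using K(1) by (simp add: ennreal_mult C_def)
    finally show "(\<integral>\<^sup>+y. ennreal ((enn2real (maximal f y) * w y) powr q y) \<partial>lebesgue) \<le> ennreal (C * K)" .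
  qed
qed

end

section \<open>Powers and Koethe duals\<close>

text \<open>Disjoint shells \<open>B k\<close> of finite measure \<open>b k >= 1\<close> are cut
  from the exhaustion, and \<open>\<phi>\<close> is \<open>1 / (Suc k * b k)\<close> on
  \<open>B k\<close>. Its integral is the harmonic series, while that of
  \<open>\<phi> powr lo\<close> is at most the series of \<open>Suc k powr (- lo)\<close>, because
  \<open>b k powr (1 - lo) <= 1\<close>.\<close>

lemma infinite_measure_dilution:
  assumes A: "incseq A" "\<And>n. A n \<in> sets M" "\<And>n. emeasure M (A n) < \<infinity>" "(SUP n. emeasure M (A n)) = \<infinity>"
    and lo: "(1::real) < lo"
  obtains \<phi> :: "'a \<Rightarrow> real" where "\<phi> \<in> borel_measurable M" "\<And>x. 0 \<le> \<phi> x" "\<And>x. \<phi> x \<le> 1"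
    "(\<integral>\<^sup>+x. ennreal (\<phi> x) \<partial>M) = \<infinity>" "(\<integral>\<^sup>+x. ennreal (\<phi> x powr lo) \<partial>M) < \<infinity>"
proof -
  have fin: "emeasure M (A n) = ennreal (measure M (A n))" for n
    using A(3)[of n] by (intro emeasure_eq_ennreal_measure) auto
  have mono: "measure M (A n) \<le> measure M (A m)" if "n \<le> m" for n m
    using A that by (intro measure_mono_fmeasurable) (auto simp: incseq_def fmeasurable_def)
  have step: "\<exists>m. n < m \<and> measure M (A n) + 1 \<le> measure M (A m)" for n
  proof -
    have "ennreal (measure M (A n) + 1) < (SUP n. emeasure M (A n))" unfolding A(4) by simp
    then obtain m where "ennreal (measure M (A n) + 1) < emeasure M (A m)" unfolding less_SUP_iff by blast
    then have m: "measure M (A n) + 1 < measure M (A m)" unfolding fin by (subst (asm) ennreal_less_iff) auto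
    then have "n < m" using mono[of m n] by (cases "n < m") auto
    then show ?thesis using m by auto
  qed
  have "\<exists>f. \<forall>n. True \<and> (f n < f (Suc n) \<and> measure M (A (f n)) + 1 \<le> measure M (A (f (Suc n))))"
    using step by (intro dependent_nat_choice) auto
  then obtain f where f: "\<And>n. f n < f (Suc n)" "\<And>n. measure M (A (f n)) + 1 \<le> measure M (A (f (Suc n)))" by blast
  define B where "B k = A (f (Suc k)) - A (f k)" for k
  define b where "b k = measure M (A (f (Suc k))) - measure M (A (f k))" for k
  have sub: "A (f k) \<subseteq> A (f (Suc k))" for k using A(1) f(1)[of k] by (auto simp: incseq_def dest: less_imp_le)
  have disj: "disjoint_family B" unfolding B_def using sub by (intro disjoint_family_Suc)
  have [measurable]: "B k \<in> sets M" for k unfolding B_def using A(2) by simp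
  have b1: "1 \<le> b k" for k using f(2)[of k] by (simp add: b_def)
  have B_b: "emeasure M (B k) = ennreal (b k)" for k
  proof -
    have "emeasure M (B k) = emeasure M (A (f (Suc k))) - emeasure M (A (f k))"
      unfolding B_def using A(2,3) sub by (intro emeasure_Diff) (auto simp: less_top)
    also have "\<dots> = ennreal (b k)" unfolding fin b_def by (simp add: ennreal_minus)
    finally show ?thesis .
  qed
  define c where "c k = 1 / (real (Suc k) * b k)" for k
  have c0: "0 < c k" for k unfolding c_def using b1[of k] by simp
  have c1: "c k \<le> 1" for k
  proof -
    have "1 * 1 \<le> real (Suc k) * b k" using b1[of k] by (intro mult_mono) auto
    then show ?thesis unfolding c_def by simp
  qed
  define S where "S x = (\<Sum>n. ennreal (c n) * indicator (B n) x)" for x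
  have S_in: "S x = ennreal (c n)" if "x \<in> B n" for x n
    unfolding S_def using disj that by (rule suminf_cmult_indicator)
  have S_out: "S x = 0" if "\<And>n. x \<notin> B n" for x unfolding S_def using that by simp
  have [measurable]: "S \<in> borel_measurable M" unfolding S_def by measurable
  define \<phi> where "\<phi> x = enn2real (S x)" for x
  have phiS: "ennreal (\<phi> x) = S x" for x
    unfolding \<phi>_def using S_in S_out by (cases "\<exists>n. x \<in> B n") (auto simp: c0 less_imp_le)
  have S_powr: "ennreal (\<phi> x powr lo) = (\<Sum>n. ennreal (c n powr lo) * indicator (B n) x)" for x
  proof (cases "\<exists>n. x \<in> B n")
    case True
    then obtain n where n: "x \<in> B n" by blast
    have "\<phi> x = c n" unfolding \<phi>_def S_in[OF n] using c0[of n] by simp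
    then show ?thesis by (subst suminf_cmult_indicator[OF disj n]) simp
  next
    case False
    then have "\<phi> x = 0" by (simp add: \<phi>_def S_out)
    then show ?thesis using False lo by simp
  qed
  show thesis
  proof
    show "\<phi> \<in> borel_measurable M" unfolding \<phi>_def by measurable
    show "0 \<le> \<phi> x" for x by (simp add: \<phi>_def)
    show "\<phi> x \<le> 1" for x
      unfolding \<phi>_def using S_in S_out c1 c0 by (cases "\<exists>n. x \<in> B n") (auto simp: less_imp_le)
    have "(\<integral>\<^sup>+x. ennreal (\<phi> x) \<partial>M) = (\<Sum>n. ennreal (c n) * emeasure M (B n))"
      unfolding phiS S_def by (subst nn_integral_suminf) (auto simp: nn_integral_cmult_indicator)
    also have "\<dots> = (\<Sum>n. ennreal (real (Suc n) powr -1))"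
    proof (intro suminf_cong)
      fix n show "ennreal (c n) * emeasure M (B n) = ennreal (real (Suc n) powr -1)"
        unfolding B_b c_def using b1[of n] by (simp add: powr_minus_divide flip: ennreal_mult)
    qed
    also have "\<dots> = \<infinity>"
    proof (rule ccontr)
      assume "(\<Sum>n. ennreal (real (Suc n) powr -1)) \<noteq> \<infinity>"
      then have "summable (\<lambda>n. real (Suc n) powr -1)" by (intro summable_suminf_not_top) auto
      then have "summable (\<lambda>n. real n powr -1)" using summable_Suc_iff[of "\<lambda>n. real n powr -1"] by simp
      then show False using summable_real_powr_iff[of "-1"] by simp
    qed
    finally show "(\<integral>\<^sup>+x. ennreal (\<phi> x) \<partial>M) = \<infinity>" .
    have "(\<integral>\<^sup>+x. ennreal (\<phi> x powr lo) \<partial>M) = (\<Sum>n. ennreal (c n powr lo) * emeasure M (B n))"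
      unfolding S_powr by (subst nn_integral_suminf) (auto simp: nn_integral_cmult_indicator)
    also have "\<dots> \<le> (\<Sum>n. ennreal (real (Suc n) powr (- lo)))"
    proof (intro suminf_le)
      fix n
      have "c n powr lo * b n = real (Suc n) powr (- lo) * b n powr (1 - lo)"
        unfolding c_def using b1[of n] by (simp add: powr_divide powr_mult powr_minus powr_diff field_simps del: of_nat_Suc)
      also have "\<dots> \<le> real (Suc n) powr (- lo) * b n powr 0"
        using b1[of n] lo by (intro mult_left_mono powr_mono) auto
      also have "\<dots> = real (Suc n) powr (- lo)" using b1[of n] by simp
      finally show "ennreal (c n powr lo) * emeasure M (B n) \<le> ennreal (real (Suc n) powr (- lo))"
        unfolding B_b using b1[of n] by (simp add: ennreal_leI flip: ennreal_mult)
    qed auto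
    also have "\<dots> < \<infinity>"
    proof -
      have "summable (\<lambda>n. real n powr (- lo))" using summable_real_powr_iff[of "- lo"] lo by simp
      then have "summable (\<lambda>n. real (Suc n) powr (- lo))" using summable_Suc_iff[of "\<lambda>n. real n powr (- lo)"] by simp
      then show ?thesis by (subst suminf_ennreal2) auto
    qed
    finally show "(\<integral>\<^sup>+x. ennreal (\<phi> x powr lo) \<partial>M) < \<infinity>" .
  qed
qed

definition vmod :: "('a::euclidean_space \<Rightarrow> real) \<Rightarrow> ('a \<Rightarrow> real) \<Rightarrow> ('a \<Rightarrow> real) \<Rightarrow> ennreal" where
  "vmod q w f = (\<integral>\<^sup>+x. ennreal ((\<bar>f x\<bar> * w x) powr q x) \<partial>lebesgue)"

text \<open>Membership is exact, but the quasi-norm is only controlled up to equivalence. This relation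
  is stable under powers and Koethe duals, which is all that is needed of \<^const>\<open>rs_space\<close>.\<close>

definition like_vLp :: "'a::euclidean_space fun_space \<Rightarrow> ('a \<Rightarrow> real) \<Rightarrow> ('a \<Rightarrow> real) \<Rightarrow> bool" where
  "like_vLp Y q w \<longleftrightarrow>
     members Y = {f \<in> borel_measurable lebesgue. vmod q w f < \<infinity>} \<and>
     (\<forall>f\<in>members Y. \<forall>c>0. qnorm Y (\<lambda>x. c * f x) = ennreal c * qnorm Y f) \<and>
     (\<exists>K>0. \<forall>f\<in>members Y. (qnorm Y f \<le> 1 \<longrightarrow> vmod q w (\<lambda>x. f x / K) \<le> 1) \<and>
        (vmod q w f \<le> 1 \<longrightarrow> qnorm Y f \<le> ennreal K))"

text \<open>The lower bound is only positive, as for the quasi-Banach spaces with which the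
  construction starts; \<open>1 < lo\<close> is added where duality enters.\<close>

locale bounded_vexponent =
  fixes q :: "'a::euclidean_space \<Rightarrow> real" and lo hi :: real and w :: "'a \<Rightarrow> real"
  assumes q_measurable' [measurable]: "q \<in> borel_measurable lebesgue" and lo_pos: "0 < lo"
    and q_bounds: "lo \<le> q x" "q x \<le> hi"
    and w_measurable' [measurable]: "w \<in> borel_measurable lebesgue" and w_pos': "0 < w x"
begin

lemma vmod_scale_le:
  assumes [measurable]: "f \<in> borel_measurable lebesgue" and "0 \<le> c"
    and s: "\<And>x. c powr q x \<le> s"
  shows "vmod q w (\<lambda>x. c * f x) \<le> ennreal s * vmod q w f"
proof -
  have "vmod q w (\<lambda>x. c * f x) \<le> (\<integral>\<^sup>+x. ennreal s * ennreal ((\<bar>f x\<bar> * w x) powr q x) \<partial>lebesgue)"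
    unfolding vmod_def
  proof (intro nn_integral_mono)
    fix x
    have s0: "0 \<le> s" using s[of x] powr_ge_zero[of c "q x"] by linarith
    have "(\<bar>c * f x\<bar> * w x) powr q x = c powr q x * (\<bar>f x\<bar> * w x) powr q x"
      using assms(2) w_pos'[of x] by (simp add: abs_mult powr_mult mult.assoc)
    also have "\<dots> \<le> s * (\<bar>f x\<bar> * w x) powr q x" by (intro mult_right_mono s) auto
    finally show "ennreal ((\<bar>c * f x\<bar> * w x) powr q x) \<le> ennreal s * ennreal ((\<bar>f x\<bar> * w x) powr q x)"
      using s0 by (simp add: ennreal_leI flip: ennreal_mult)
  qed
  also have "\<dots> = ennreal s * vmod q w f" unfolding vmod_def by (rule nn_integral_cmult) measurable
  finally show ?thesis .
qed

lemma vmod_scale_finite: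
  assumes "f \<in> borel_measurable lebesgue" "vmod q w f < \<infinity>" "0 \<le> c"
  shows "vmod q w (\<lambda>x. c * f x) < \<infinity>"
proof -
  have "c powr q x \<le> max 1 c powr hi" for x
  proof -
    have "c powr q x \<le> max 1 c powr q x" using assms(3) lo_pos q_bounds(1)[of x] by (intro powr_mono2) auto
    also have "\<dots> \<le> max 1 c powr hi" using q_bounds by (intro powr_mono) auto
    finally show ?thesis .
  qed
  then have "vmod q w (\<lambda>x. c * f x) \<le> ennreal (max 1 c powr hi) * vmod q w f"
    using assms by (intro vmod_scale_le) auto
  also have "\<dots> < \<infinity>" using assms(2) by (simp add: ennreal_mult_less_top)
  finally show ?thesis .
qed

lemma vmod_scale_down:
  assumes "f \<in> borel_measurable lebesgue" "0 \<le> c" "c \<le> 1"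
  shows "vmod q w (\<lambda>x. c * f x) \<le> ennreal (c powr lo) * vmod q w f"
  using assms q_bounds lo_pos by (intro vmod_scale_le powr_le_powr_self) auto

lemma vmod_mono: "(\<And>x. \<bar>f x\<bar> \<le> \<bar>g x\<bar>) \<Longrightarrow> vmod q w f \<le> vmod q w g"
  unfolding vmod_def using w_pos' lo_pos q_bounds(1)
  by (intro nn_integral_mono ennreal_leI powr_mono2 mult_right_mono) (auto simp: less_imp_le intro: order_trans[of 0 lo])

lemma exists_scale:
  assumes "f \<in> borel_measurable lebesgue" "vmod q w f < \<infinity>"
  shows "\<exists>l>0. vmod q w (\<lambda>x. f x / l) \<le> 1"
proof -
  obtain v where v: "vmod q w f = ennreal v" "0 \<le> v" using assms(2) by (cases "vmod q w f") auto
  define c where "c = (1 / (v + 1)) powr (1 / lo)"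
  have c: "0 < c" "c \<le> 1" unfolding c_def using v(2) lo_pos by (auto intro: powr_le1)
  have "c powr lo = 1 / (v + 1)" unfolding c_def powr_powr using lo_pos v(2) by simp
  then have "vmod q w (\<lambda>x. c * f x) \<le> ennreal (1 / (v + 1)) * ennreal v"
    using vmod_scale_down[OF assms(1), of c] c v by simp
  also have "\<dots> = ennreal (1 / (v + 1) * v)" using v(2) by (intro ennreal_mult[symmetric]) auto
  also have "\<dots> \<le> 1" using v(2) by simp
  finally have "vmod q w (\<lambda>x. f x / (1 / c)) \<le> 1" by (simp add: mult.commute)
  then show ?thesis using c by (intro exI[of _ "1 / c"]) auto
qed

text \<open>The original exponent and weight agree with \<open>q\<close> and \<open>w\<close> only
  almost everywhere; modular and norm do not see the difference.\<close>

context
  fixes p :: "'a \<Rightarrow> ennreal" and v :: "'a \<Rightarrow> real"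
  assumes p: "\<And>x. p x \<noteq> \<infinity>" and pq: "AE x in lebesgue. enn2real (p x) = q x" and v: "AE x in lebesgue. v x = w x"
begin

lemma vLp_modular_eq: "vLp_modular p v f = vmod q w f"
proof -
  have "esssup lebesgue (\<lambda>x. ennreal (\<bar>f x\<bar> * v x) * indicator {x. p x = \<infinity>} x) = esssup (lebesgue :: 'a measure) (\<lambda>x. 0)"
    using p by simp
  also have "\<dots> = (0::ennreal)" by (rule esssup_const) simp
  finally have "vLp_modular p v f = (\<integral>\<^sup>+x\<in>{x. p x \<noteq> \<infinity>}. ennreal ((\<bar>f x\<bar> * v x) powr enn2real (p x)) \<partial>lebesgue)"
    unfolding vLp_modular_def by simp
  also have "\<dots> = vmod q w f" unfolding vmod_def
  proof (intro nn_integral_cong_AE)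
    show "AE x in lebesgue. ennreal ((\<bar>f x\<bar> * v x) powr enn2real (p x)) * indicator {x. p x \<noteq> \<infinity>} x = ennreal ((\<bar>f x\<bar> * w x) powr q x)"
      using pq v by eventually_elim (use p in auto)
  qed
  finally show ?thesis .
qed

lemma vLp_norm_eq: "vLp_norm p v f = (INF l\<in>{l::real. 0 < l \<and> vmod q w (\<lambda>x. f x / l) \<le> 1}. ennreal l)"
  unfolding vLp_norm_def vLp_modular_eq ..

lemma vLp_norm_lessE: "vLp_norm p v f < t \<Longrightarrow> \<exists>l>0. ennreal l < t \<and> vmod q w (\<lambda>x. f x / l) \<le> 1"
  unfolding vLp_norm_eq INF_less_iff by auto

text \<open>Makes both norms in the Muckenhoupt condition nonzero on each cube, so that neither can
  be infinite when their product is finite.\<close>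

lemma vLp_norm_eq_0:
  assumes "f \<in> borel_measurable lebesgue" "vLp_norm p v f = 0" shows "vmod q w f = 0"
proof -
  have le: "vmod q w f \<le> ennreal (e powr lo)" if e: "0 < e" "e \<le> 1" for e
  proof -
    have "vLp_norm p v f < ennreal e" using assms(2) e by simp
    from vLp_norm_lessE[OF this] obtain l where l: "0 < l" "l < e" "vmod q w (\<lambda>x. f x / l) \<le> 1"
      by (auto simp: ennreal_less_iff)
    have "vmod q w f = vmod q w (\<lambda>x. l * (f x / l))" using l by simp
    also have "\<dots> \<le> ennreal (l powr lo) * vmod q w (\<lambda>x. f x / l)" using l e assms by (intro vmod_scale_down) auto
    also have "\<dots> \<le> ennreal (e powr lo) * 1" using l lo_pos by (intro mult_mono ennreal_leI powr_mono2) auto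
    finally show ?thesis by simp
  qed
  have "vmod q w f \<le> 0 + ennreal e" if e: "0 < e" for e
  proof -
    define e' where "e' = min 1 e powr (1 / lo)"
    have "0 < e'" "e' \<le> 1" using e lo_pos by (auto simp: e'_def intro: powr_le1)
    then have "vmod q w f \<le> ennreal (e' powr lo)" by (rule le)
    also have "e' powr lo = min 1 e" unfolding e'_def powr_powr using lo_pos e by simp
    also have "ennreal (min 1 e) \<le> 0 + ennreal e" by (simp add: ennreal_leI)
    finally show ?thesis .
  qed
  then have "vmod q w f \<le> 0" by (rule ennreal_le_epsilon)
  then show ?thesis by simp
qed

lemma like_vLp_vLp: "like_vLp (vLp p v) q w"
proof -
  note norm = vLp_norm_eq
  have norm_le: "vLp_norm p v f \<le> ennreal l" if "0 < l" "vmod q w (\<lambda>x. f x / l) \<le> 1" for f l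
    unfolding norm using that by (intro INF_lower) auto
  note norm_lessE = vLp_norm_lessE
  have mem: "members (vLp p v) = {f \<in> borel_measurable lebesgue. vmod q w f < \<infinity>}"
  proof (intro equalityI subsetI)
    fix f assume "f \<in> members (vLp p v)"
    then have [measurable]: "f \<in> borel_measurable lebesgue" and "vLp_norm p v f < \<infinity>" by (auto simp: vLp_def)
    from norm_lessE[OF this(2)] obtain l where l: "0 < l" "vmod q w (\<lambda>x. f x / l) \<le> 1" by blast
    have "vmod q w (\<lambda>x. l * (f x / l)) < \<infinity>"
      using l by (intro vmod_scale_finite) (auto intro: le_less_trans)
    then show "f \<in> {f \<in> borel_measurable lebesgue. vmod q w f < \<infinity>}" using l by simp
  next
    fix f assume "f \<in> {f \<in> borel_measurable lebesgue. vmod q w f < \<infinity>}"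
    then have f: "f \<in> borel_measurable lebesgue" "vmod q w f < \<infinity>" by auto
    obtain l where l: "0 < l" "vmod q w (\<lambda>x. f x / l) \<le> 1" using exists_scale[OF f] by blast
    have "vLp_norm p v f < \<infinity>" using norm_le[OF l] by (rule le_less_trans) simp
    then show "f \<in> members (vLp p v)" using f by (simp add: vLp_def)
  qed
  have scale_le: "vLp_norm p v (\<lambda>x. c * f x) \<le> ennreal c * vLp_norm p v f" if c: "0 < c" for c f
  proof -
    have "ennreal (1 / c) * vLp_norm p v (\<lambda>x. c * f x) \<le> vLp_norm p v f"
      unfolding norm[of f]
    proof (rule INF_greatest)
      fix l assume "l \<in> {l. 0 < l \<and> vmod q w (\<lambda>x. f x / l) \<le> 1}"
      then have l: "0 < l" "vmod q w (\<lambda>x. f x / l) \<le> 1" by auto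
      have "vLp_norm p v (\<lambda>x. c * f x) \<le> ennreal (c * l)" using c l by (intro norm_le) auto
      then have "ennreal (1 / c) * vLp_norm p v (\<lambda>x. c * f x) \<le> ennreal (1 / c) * ennreal (c * l)" by (rule mult_left_mono) simp
      also have "\<dots> = ennreal l" using c l by (simp flip: ennreal_mult)
      finally show "ennreal (1 / c) * vLp_norm p v (\<lambda>x. c * f x) \<le> ennreal l" .
    qed
    then have "ennreal c * (ennreal (1 / c) * vLp_norm p v (\<lambda>x. c * f x)) \<le> ennreal c * vLp_norm p v f" by (rule mult_left_mono) simp
    moreover have "ennreal c * (ennreal (1 / c) * vLp_norm p v (\<lambda>x. c * f x)) = vLp_norm p v (\<lambda>x. c * f x)"
      using c by (simp add: mult.assoc[symmetric] flip: ennreal_mult)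
    ultimately show ?thesis by simp
  qed
  have hom: "vLp_norm p v (\<lambda>x. c * f x) = ennreal c * vLp_norm p v f" if c: "0 < c" for c f
  proof (rule antisym[OF scale_le[OF c]])
    have "vLp_norm p v (\<lambda>x. 1 / c * (c * f x)) \<le> ennreal (1 / c) * vLp_norm p v (\<lambda>x. c * f x)"
      using c by (intro scale_le) simp
    then have "vLp_norm p v f \<le> ennreal (1 / c) * vLp_norm p v (\<lambda>x. c * f x)" using c by simp
    then have "ennreal c * vLp_norm p v f \<le> ennreal c * (ennreal (1 / c) * vLp_norm p v (\<lambda>x. c * f x))" by (rule mult_left_mono) simp
    also have "\<dots> = vLp_norm p v (\<lambda>x. c * f x)"
      using c by (simp add: mult.assoc[symmetric] flip: ennreal_mult)
    finally show "ennreal c * vLp_norm p v f \<le> vLp_norm p v (\<lambda>x. c * f x)" .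
  qed
  show ?thesis unfolding like_vLp_def
  \<comment> \<open>The constant is 2 because the infimum in the norm is not known to be attained: a
    norm at most 1 yields an admissible scale below 2.\<close>
  proof (intro conjI ballI allI impI exI[of _ 2])
    show "members (vLp p v) = {f \<in> borel_measurable lebesgue. vmod q w f < \<infinity>}" by (rule mem)
    show "qnorm (vLp p v) (\<lambda>x. c * f x) = ennreal c * qnorm (vLp p v) f" if "0 < c" for f c
      using hom[OF that] by (simp add: vLp_def)
    show "vmod q w (\<lambda>x. f x / 2) \<le> 1" if "qnorm (vLp p v) f \<le> 1" for f
    proof -
      have "vLp_norm p v f < ennreal 2" using that by (auto simp: vLp_def intro: le_less_trans)
      from norm_lessE[OF this] obtain l where l: "0 < l" "l < 2" "vmod q w (\<lambda>x. f x / l) \<le> 1"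
        by (auto simp: ennreal_less_iff simp del: ennreal_numeral)
      have "\<bar>f x\<bar> / 2 \<le> \<bar>f x\<bar> / l" for x using l by (intro divide_left_mono) auto
      then have "vmod q w (\<lambda>x. f x / 2) \<le> vmod q w (\<lambda>x. f x / l)"
        using l by (intro vmod_mono) (simp only: abs_divide abs_numeral abs_of_pos)
      with l(3) show ?thesis by simp
    qed
    show "qnorm (vLp p v) f \<le> ennreal 2" if "vmod q w f \<le> 1" for f
    proof -
      have "vLp_norm p v f \<le> ennreal 1" using that by (intro norm_le) auto
      also have "\<dots> \<le> ennreal 2" by (intro ennreal_leI) simp
      finally show ?thesis by (simp add: vLp_def)
    qed
  qed simp
qed

end

lemma bounded_vexponent_power:
  assumes "0 < t" shows "bounded_vexponent (\<lambda>x. q x / t) (lo / t) (hi / t) (\<lambda>x. w x powr t)"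
proof
  show "0 < w x powr t" for x using w_pos'[of x] by (simp only: powr_gt_zero)
qed (use assms lo_pos q_bounds in \<open>auto intro: divide_right_mono\<close>)

lemma ennpowr_mult:
  assumes "0 < c" shows "ennpowr (ennreal c * n) t = ennreal (c powr t) * ennpowr n t"
proof (cases n)
  case (real x)
  then show ?thesis using assms by (simp add: ennpowr_def powr_mult ennreal_mult[symmetric] less_imp_le)
next
  case top
  then show ?thesis using assms by (simp add: ennpowr_def ennreal_mult_top)
qed

text \<open>The modular of \<open>\<bar>f\<bar> powr (1 / t)\<close> equals that of \<open>f\<close>
  for the exponent \<open>q / t\<close> and the weight \<open>w powr t\<close>, so membership
  transfers exactly and the constant becomes \<open>K powr t\<close>.\<close>

lemma like_vLp_space_power:
  assumes Y: "like_vLp Y q w" and t: "0 < t"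
  shows "like_vLp (space_power Y t) (\<lambda>x. q x / t) (\<lambda>x. w x powr t)"
proof -
  obtain K where mem: "members Y = {f \<in> borel_measurable lebesgue. vmod q w f < \<infinity>}"
    and hom: "\<And>f c. f \<in> members Y \<Longrightarrow> 0 < c \<Longrightarrow> qnorm Y (\<lambda>x. c * f x) = ennreal c * qnorm Y f"
    and K: "0 < K" "\<And>f. f \<in> members Y \<Longrightarrow> qnorm Y f \<le> 1 \<Longrightarrow> vmod q w (\<lambda>x. f x / K) \<le> 1"
      "\<And>f. f \<in> members Y \<Longrightarrow> vmod q w f \<le> 1 \<Longrightarrow> qnorm Y f \<le> ennreal K"
    using Y unfolding like_vLp_def by blast
  have mod: "vmod q w (\<lambda>x. \<bar>f x\<bar> powr (1 / t)) = vmod (\<lambda>x. q x / t) (\<lambda>x. w x powr t) f" for f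
    unfolding vmod_def
  proof (intro nn_integral_cong arg_cong[where f = ennreal])
    fix x
    have "\<bar>f x\<bar> * w x powr t = (\<bar>f x\<bar> powr (1 / t) * w x) powr t"
      using t w_pos'[of x] by (simp add: powr_mult powr_powr)
    then show "(\<bar>\<bar>f x\<bar> powr (1 / t)\<bar> * w x) powr q x = (\<bar>f x\<bar> * w x powr t) powr (q x / t)"
      using t by (simp add: powr_powr)
  qed
  have pm: "members (space_power Y t) = {f \<in> borel_measurable lebesgue. vmod (\<lambda>x. q x / t) (\<lambda>x. w x powr t) f < \<infinity>}"
    unfolding space_power_def fun_space.simps mem mod[symmetric] by auto
  show ?thesis unfolding like_vLp_def
  proof (intro conjI ballI allI impI exI[of _ "K powr t"] pm)
    fix f assume "f \<in> members (space_power Y t)"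
    then have f: "(\<lambda>x. \<bar>f x\<bar> powr (1 / t)) \<in> members Y" by (simp add: space_power_def)
    show "qnorm (space_power Y t) (\<lambda>x. c * f x) = ennreal c * qnorm (space_power Y t) f" if c: "0 < c" for c
    proof -
      have "(\<lambda>x. \<bar>c * f x\<bar> powr (1 / t)) = (\<lambda>x. c powr (1 / t) * \<bar>f x\<bar> powr (1 / t))"
        using c by (simp add: abs_mult powr_mult)
      then have "qnorm Y (\<lambda>x. \<bar>c * f x\<bar> powr (1 / t)) = ennreal (c powr (1 / t)) * qnorm Y (\<lambda>x. \<bar>f x\<bar> powr (1 / t))"
        using hom[OF f, of "c powr (1 / t)"] c by simp
      then show ?thesis
        using c t by (simp add: space_power_def ennpowr_mult powr_powr)
    qed
    show "vmod (\<lambda>x. q x / t) (\<lambda>x. w x powr t) (\<lambda>x. f x / K powr t) \<le> 1" if "qnorm (space_power Y t) f \<le> 1"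
    proof -
      have "qnorm Y (\<lambda>x. \<bar>f x\<bar> powr (1 / t)) \<le> 1"
      proof (cases "qnorm Y (\<lambda>x. \<bar>f x\<bar> powr (1 / t))")
        case (real n)
        then have "n powr t \<le> 1" using that by (simp add: space_power_def ennpowr_def)
        have "n \<le> 1"
        proof (rule ccontr)
          assume "\<not> n \<le> 1"
          then have "1 powr t < n powr t" using t by (intro powr_less_mono2) auto
          then show False using \<open>n powr t \<le> 1\<close> by simp
        qed
        then show ?thesis using real by simp
      next
        case top then show ?thesis using that by (simp add: space_power_def ennpowr_def top_unique)
      qed
      from K(2)[OF f this] have "vmod q w (\<lambda>x. \<bar>f x\<bar> powr (1 / t) / K) \<le> 1" .
      moreover have "(\<lambda>x. \<bar>f x\<bar> powr (1 / t) / K) = (\<lambda>x. \<bar>f x / K powr t\<bar> powr (1 / t))"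
        using K(1) t by (simp add: abs_divide powr_divide powr_powr)
      ultimately show ?thesis unfolding mod[symmetric] by simp
    qed
    show "qnorm (space_power Y t) f \<le> ennreal (K powr t)" if "vmod (\<lambda>x. q x / t) (\<lambda>x. w x powr t) f \<le> 1"
    proof -
      have le: "qnorm Y (\<lambda>x. \<bar>f x\<bar> powr (1 / t)) \<le> ennreal K" using that by (intro K(3) f) (simp add: mod)
      then obtain n where n: "qnorm Y (\<lambda>x. \<bar>f x\<bar> powr (1 / t)) = ennreal n" "0 \<le> n"
        by (cases "qnorm Y (\<lambda>x. \<bar>f x\<bar> powr (1 / t))") (auto simp: top_unique)
      then have "n \<le> K" using le K(1) by simp
      then have "n powr t \<le> K powr t" using n t by (intro powr_mono2) auto
      then show ?thesis using n by (simp add: space_power_def ennpowr_def ennreal_leI)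
    qed
  qed (use K in simp)
qed

lemma mult_le_vmod:
  assumes "1 < lo"
  shows "\<bar>f x * g x\<bar> \<le> (\<bar>f x\<bar> * w x) powr q x + (\<bar>g x\<bar> * (1 / w x)) powr conjexp (q x)"
proof -
  have "\<bar>f x * g x\<bar> = (\<bar>f x\<bar> * w x) * (\<bar>g x\<bar> * (1 / w x))" using w_pos'[of x] by (simp add: abs_mult)
  also have "\<dots> \<le> (\<bar>f x\<bar> * w x) powr q x + (\<bar>g x\<bar> * (1 / w x)) powr conjexp (q x)"
    using assms q_bounds(1)[of x] w_pos'[of x] by (intro mult_le_conj_powr) auto
  finally show ?thesis .
qed

lemma bounded_vexponent_conj:
  assumes "1 < lo"
  shows "bounded_vexponent (\<lambda>x. conjexp (q x)) (conjexp hi) (conjexp lo) (\<lambda>x. 1 / w x)"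
proof
  have q1: "1 < q x" for x using assms q_bounds(1)[of x] by simp
  have hi1: "1 < hi" using q1[of undefined] q_bounds(2)[of undefined] by simp
  show "(\<lambda>x. conjexp (q x)) \<in> borel_measurable lebesgue" unfolding conjexp_def by measurable
  show "0 < conjexp hi" using conjexp_gt_1[OF hi1] by simp
  show "conjexp hi \<le> conjexp (q x)" "conjexp (q x) \<le> conjexp lo" for x
    using q1[of x] q_bounds assms by (auto intro: conjexp_antimono)
qed (use w_pos' in auto)

lemma nn_integral_mult_le:
  assumes "1 < lo" and [measurable]: "f \<in> borel_measurable lebesgue" "g \<in> borel_measurable lebesgue"
  shows "(\<integral>\<^sup>+x. ennreal \<bar>f x * g x\<bar> \<partial>lebesgue) \<le> vmod q w f + vmod (\<lambda>x. conjexp (q x)) (\<lambda>x. 1 / w x) g"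
proof -
  have [measurable]: "(\<lambda>x. conjexp (q x)) \<in> borel_measurable lebesgue" unfolding conjexp_def by measurable
  have "(\<integral>\<^sup>+x. ennreal \<bar>f x * g x\<bar> \<partial>lebesgue)
      \<le> (\<integral>\<^sup>+x. ennreal ((\<bar>f x\<bar> * w x) powr q x) + ennreal ((\<bar>g x\<bar> * (1 / w x)) powr conjexp (q x)) \<partial>lebesgue)"
    using mult_le_vmod[OF assms(1), of f _ g] by (intro nn_integral_mono) (simp add: ennreal_leI flip: ennreal_plus)
  also have "\<dots> = vmod q w f + vmod (\<lambda>x. conjexp (q x)) (\<lambda>x. 1 / w x) g"
    unfolding vmod_def by (rule nn_integral_add) measurable
  finally show ?thesis .
qed

text \<open>If the conjugate modular of \<open>g\<close> is infinite, the extremiser \<open>f\<close> of the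
  pairing is diluted by a factor \<open>\<phi>\<close> so that its modular becomes finite but the pairing does not.\<close>

lemma vmod_conj_finite:
  assumes lo: "1 < lo" and [measurable]: "g \<in> borel_measurable lebesgue"
    and int: "\<And>f. f \<in> borel_measurable lebesgue \<Longrightarrow> vmod q w f < \<infinity> \<Longrightarrow> integrable lebesgue (\<lambda>x. f x * g x)"
  shows "vmod (\<lambda>x. conjexp (q x)) (\<lambda>x. 1 / w x) g < \<infinity>"
proof (rule ccontr)
  assume not: "\<not> vmod (\<lambda>x. conjexp (q x)) (\<lambda>x. 1 / w x) g < \<infinity>"
  have q1: "1 < q x" for x using lo q_bounds(1)[of x] by simp
  have [measurable]: "(\<lambda>x. conjexp (q x)) \<in> borel_measurable lebesgue" unfolding conjexp_def by measurable
  define h where "h x = (\<bar>g x\<bar> / w x) powr conjexp (q x)" for x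
  have [measurable]: "h \<in> borel_measurable lebesgue" unfolding h_def by measurable
  have h0: "0 \<le> h x" for x by (simp add: h_def)
  have hinf: "(\<integral>\<^sup>+x. ennreal (h x) \<partial>lebesgue) = \<infinity>" using not unfolding vmod_def h_def by (simp add: not_less top_unique)
  \<comment> \<open>The diluted extremiser pairs with \<open>g\<close> to the integral of
    \<open>\<phi>\<close> over \<open>M\<close>, while its modular is at most the integral of
    \<open>\<phi> powr lo\<close> over \<open>M\<close>.\<close>
  define M where "M = density lebesgue (\<lambda>x. ennreal (h x))"
  have sM [measurable_cong, simp]: "sets M = sets lebesgue" "space M = UNIV" unfolding M_def by simp_all
  \<comment> \<open>Truncation both in space and in height makes the exhausting sets finite for
    \<open>M\<close>.\<close>
  define A where "A n = {x \<in> cube 0 (real n). h x \<le> real n}" for n :: nat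
  have Am [measurable]: "A n \<in> sets lebesgue" for n unfolding A_def by measurable
  have "incseq A" unfolding A_def incseq_def using cube_mono[of "real _" "real _" 0]
    by (auto simp: subset_eq)
  moreover have "A n \<in> sets M" for n by simp
  moreover have "emeasure M (A n) < \<infinity>" for n
  proof -
    have "emeasure M (A n) = (\<integral>\<^sup>+x. ennreal (h x) * indicator (A n) x \<partial>lebesgue)"
      unfolding M_def by (subst emeasure_density) auto
    also have "\<dots> \<le> (\<integral>\<^sup>+x. ennreal (real n) * indicator (cube (0::'a) (real n)) x \<partial>lebesgue)"
      by (intro nn_integral_mono) (auto simp: A_def indicator_def intro: ennreal_leI)
    also have "\<dots> = ennreal (real n) * emeasure lebesgue (cube (0::'a) (real n))"
      by (rule nn_integral_cmult_indicator) simp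
    also have "\<dots> = ennreal (real n * (2 * real n) ^ DIM('a))"
      by (subst emeasure_cube) (auto simp: ennreal_mult)
    also have "\<dots> < \<infinity>" by simp
    finally show ?thesis .
  qed
  moreover have "(SUP n. emeasure M (A n)) = \<infinity>"
  proof -
    have "(\<Union>n. A n) = UNIV"
    proof (intro equalityI subsetI UNIV_I)
      fix x :: 'a
      obtain n :: nat where n: "max (norm x) (h x) \<le> real n" using real_arch_simple by blast
      then have "x \<in> A n" unfolding A_def mem_cube using Basis_le_norm[of _ x] by (auto intro: order_trans)
      then show "x \<in> (\<Union>n. A n)" by blast
    qed
    moreover have "emeasure M UNIV = \<infinity>" unfolding M_def using hinf by (subst emeasure_density) auto
    moreover have "range A \<subseteq> sets M" by auto
    ultimately show ?thesis using SUP_emeasure_incseq[of A M] \<open>incseq A\<close> by simp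
  qed
  ultimately obtain \<phi> :: "'a \<Rightarrow> real" where phi: "\<phi> \<in> borel_measurable M" "\<And>x. 0 \<le> \<phi> x" "\<And>x. \<phi> x \<le> 1"
    "(\<integral>\<^sup>+x. ennreal (\<phi> x) \<partial>M) = \<infinity>" "(\<integral>\<^sup>+x. ennreal (\<phi> x powr lo) \<partial>M) < \<infinity>"
    using infinite_measure_dilution[OF _ _ _ _ lo, of A M] by blast
  have [measurable]: "\<phi> \<in> borel_measurable lebesgue" using phi(1) by (simp cong: measurable_cong_sets)
  define f where "f x = \<phi> x * h x powr (1 / q x) / w x" for x
  have [measurable]: "f \<in> borel_measurable lebesgue" unfolding f_def by measurable
  have "vmod q w f \<le> (\<integral>\<^sup>+x. ennreal (h x) * ennreal (\<phi> x powr lo) \<partial>lebesgue)" unfolding vmod_def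
  proof (intro nn_integral_mono)
    fix x
    have "\<bar>f x\<bar> * w x = \<phi> x * h x powr (1 / q x)" unfolding f_def using phi(2)[of x] w_pos'[of x] by (simp add: abs_mult abs_divide)
    then have "(\<bar>f x\<bar> * w x) powr q x = \<phi> x powr q x * h x"
      using phi(2)[of x] q1[of x] h0[of x] by (simp add: powr_mult powr_powr)
    also have "\<dots> \<le> \<phi> x powr lo * h x" using phi(2,3) lo q_bounds(1) h0 by (intro mult_right_mono powr_le_powr_self) auto
    finally show "ennreal ((\<bar>f x\<bar> * w x) powr q x) \<le> ennreal (h x) * ennreal (\<phi> x powr lo)"
      using h0[of x] by (simp add: ennreal_leI mult.commute flip: ennreal_mult)
  qed
  also have "\<dots> = (\<integral>\<^sup>+x. ennreal (\<phi> x powr lo) \<partial>M)" unfolding M_def by (subst nn_integral_density) auto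
  also have "\<dots> < \<infinity>" by (rule phi(5))
  finally have "integrable lebesgue (\<lambda>x. f x * g x)" by (intro int) auto
  then have "(\<integral>\<^sup>+x. ennreal (norm (f x * g x)) \<partial>lebesgue) < \<infinity>" by (simp add: integrable_iff_bounded)
  moreover have "(\<integral>\<^sup>+x. ennreal (norm (f x * g x)) \<partial>lebesgue) = (\<integral>\<^sup>+x. ennreal (h x) * ennreal (\<phi> x) \<partial>lebesgue)"
  proof (intro nn_integral_cong)
    fix x
    define a where "a = \<bar>g x\<bar> / w x"
    have a0: "0 \<le> a" unfolding a_def using w_pos'[of x] by simp
    have "h x powr (1 / q x) * a = a powr (conjexp (q x) - 1) * a"
    proof -
      have "conjexp (q x) * (1 / q x) = conjexp (q x) - 1" using q1[of x] by (simp add: conjexp_def field_simps)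
      then show ?thesis unfolding h_def a_def[symmetric] powr_powr by simp
    qed
    also have "\<dots> = h x" unfolding h_def a_def[symmetric] using powr_mult_base[OF a0, of "conjexp (q x) - 1"] by (simp add: mult.commute)
    finally have ha: "h x powr (1 / q x) * a = h x" .
    have "norm (f x * g x) = \<phi> x * (h x powr (1 / q x) * a)"
      unfolding f_def a_def using phi(2)[of x] w_pos'[of x] by (simp add: abs_mult abs_divide)
    then show "ennreal (norm (f x * g x)) = ennreal (h x) * ennreal (\<phi> x)"
      unfolding ha using h0[of x] phi(2)[of x] by (simp add: mult.commute flip: ennreal_mult)
  qed
  moreover have "\<dots> = (\<integral>\<^sup>+x. ennreal (\<phi> x) \<partial>M)" unfolding M_def by (subst nn_integral_density) auto
  ultimately show False using phi(4) by simp
qed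

text \<open>One direction is Young's inequality after scaling. For the other, a function
  \<open>g\<close> of dual norm at most 1 whose modular at scale \<open>2 * K\<close> exceeds 1 is
  paired with its extremiser, normalised in \<open>Y\<close>; the pairing would be at least
  2.\<close>

lemma like_vLp_koethe_dual:
  assumes Y: "like_vLp Y q w" and lo: "1 < lo"
  shows "like_vLp (koethe_dual Y) (\<lambda>x. conjexp (q x)) (\<lambda>x. 1 / w x)"
proof -
  interpret dual: bounded_vexponent "\<lambda>x. conjexp (q x)" "conjexp hi" "conjexp lo" "\<lambda>x. 1 / w x"
    by (rule bounded_vexponent_conj[OF lo])
  let ?m = "vmod (\<lambda>x. conjexp (q x)) (\<lambda>x. 1 / w x)"
  have q1: "1 < q x" for x using lo q_bounds(1)[of x] by simp
  obtain K where mem: "members Y = {f \<in> borel_measurable lebesgue. vmod q w f < \<infinity>}"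
    and hom: "\<And>f c. f \<in> members Y \<Longrightarrow> 0 < c \<Longrightarrow> qnorm Y (\<lambda>x. c * f x) = ennreal c * qnorm Y f"
    and K: "0 < K" "\<And>f. f \<in> members Y \<Longrightarrow> qnorm Y f \<le> 1 \<Longrightarrow> vmod q w (\<lambda>x. f x / K) \<le> 1"
      "\<And>f. f \<in> members Y \<Longrightarrow> vmod q w f \<le> 1 \<Longrightarrow> qnorm Y f \<le> ennreal K"
    using Y unfolding like_vLp_def by blast
  have dmem: "members (koethe_dual Y) = {f \<in> borel_measurable lebesgue. ?m f < \<infinity>}"
  proof (intro equalityI subsetI)
    fix g assume "g \<in> members (koethe_dual Y)"
    then have "g \<in> borel_measurable lebesgue" "\<And>f. f \<in> members Y \<Longrightarrow> integrable lebesgue (\<lambda>x. f x * g x)"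
      by (auto simp: koethe_dual_def)
    then show "g \<in> {f \<in> borel_measurable lebesgue. ?m f < \<infinity>}" using vmod_conj_finite[OF lo, of g] by (auto simp: mem)
  next
    fix g assume "g \<in> {f \<in> borel_measurable lebesgue. ?m f < \<infinity>}"
    then have g [measurable]: "g \<in> borel_measurable lebesgue" and gm: "?m g < \<infinity>" by auto
    have "integrable lebesgue (\<lambda>x. f x * g x)" if "f \<in> members Y" for f
    proof -
      have [measurable]: "f \<in> borel_measurable lebesgue" and fm: "vmod q w f < \<infinity>" using that by (auto simp: mem)
      have "(\<integral>\<^sup>+x. ennreal (norm (f x * g x)) \<partial>lebesgue) \<le> vmod q w f + ?m g"
        using nn_integral_mult_le[OF lo, of f g] by simp
      also have "\<dots> < \<infinity>" using fm gm by simp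
      finally show ?thesis by (simp add: integrable_iff_bounded)
    qed
    then show "g \<in> members (koethe_dual Y)" using g by (simp add: koethe_dual_def)
  qed
  define P where "P g = (SUP f\<in>{f \<in> members Y. qnorm Y f = 1}. \<integral>\<^sup>+x. ennreal \<bar>f x * g x\<bar> \<partial>lebesgue)" for g
  have P: "qnorm (koethe_dual Y) g = P g" for g by (simp add: koethe_dual_def P_def)
  show ?thesis unfolding like_vLp_def P
  proof (intro conjI ballI allI impI exI[of _ "2 * K"] dmem)
    fix g assume "g \<in> members (koethe_dual Y)"
    then have [measurable]: "g \<in> borel_measurable lebesgue" and gm: "?m g < \<infinity>" unfolding dmem by auto
    show "P (\<lambda>x. c * g x) = ennreal c * P g" if c: "0 < c" for c
      unfolding P_def SUP_mult_left_ennreal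
    proof (intro SUP_cong refl)
      fix f assume "f \<in> {f \<in> members Y. qnorm Y f = 1}"
      then have [measurable]: "f \<in> borel_measurable lebesgue" by (simp add: mem)
      have "(\<integral>\<^sup>+x. ennreal \<bar>f x * (c * g x)\<bar> \<partial>lebesgue) = (\<integral>\<^sup>+x. ennreal c * ennreal \<bar>f x * g x\<bar> \<partial>lebesgue)"
      proof (intro nn_integral_cong)
        fix x
        have "\<bar>f x * (c * g x)\<bar> = c * \<bar>f x * g x\<bar>" using c by (simp add: abs_mult)
        then show "ennreal \<bar>f x * (c * g x)\<bar> = ennreal c * ennreal \<bar>f x * g x\<bar>" using c by (simp add: ennreal_mult)
      qed
      also have "\<dots> = ennreal c * (\<integral>\<^sup>+x. ennreal \<bar>f x * g x\<bar> \<partial>lebesgue)" by (rule nn_integral_cmult) measurable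
      finally show "(\<integral>\<^sup>+x. ennreal \<bar>f x * (c * g x)\<bar> \<partial>lebesgue) = ennreal c * (\<integral>\<^sup>+x. ennreal \<bar>f x * g x\<bar> \<partial>lebesgue)" .
    qed
    show "P g \<le> ennreal (2 * K)" if g1: "?m g \<le> 1" unfolding P_def
    proof (rule SUP_least)
      fix f assume "f \<in> {f \<in> members Y. qnorm Y f = 1}"
      then have f: "f \<in> members Y" "qnorm Y f \<le> 1" and [measurable]: "f \<in> borel_measurable lebesgue" by (auto simp: mem)
      have "(\<integral>\<^sup>+x. ennreal \<bar>f x * g x\<bar> \<partial>lebesgue) = (\<integral>\<^sup>+x. ennreal K * ennreal \<bar>f x / K * g x\<bar> \<partial>lebesgue)"
        using K(1) by (intro nn_integral_cong) (simp add: abs_mult abs_divide flip: ennreal_mult)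
      also have "\<dots> = ennreal K * (\<integral>\<^sup>+x. ennreal \<bar>f x / K * g x\<bar> \<partial>lebesgue)" by (rule nn_integral_cmult) measurable
      also have "\<dots> \<le> ennreal K * (vmod q w (\<lambda>x. f x / K) + ?m g)"
        by (intro mult_left_mono nn_integral_mult_le lo) auto
      also have "\<dots> \<le> ennreal K * (1 + 1)" by (intro mult_left_mono add_mono K(2) f g1) auto
      also have "\<dots> = ennreal (2 * K)" using K(1) by (simp add: ennreal_mult mult.commute)
      finally show "(\<integral>\<^sup>+x. ennreal \<bar>f x * g x\<bar> \<partial>lebesgue) \<le> ennreal (2 * K)" .
    qed
    show "?m (\<lambda>x. g x / (2 * K)) \<le> 1" if P1: "P g \<le> 1"
    proof (rule ccontr)
      assume gt: "\<not> ?m (\<lambda>x. g x / (2 * K)) \<le> 1"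
      define l where "l = 2 * K"
      have l: "0 < l" using K by (simp add: l_def)
      have "?m (\<lambda>x. 1 / l * g x) < \<infinity>" using l gm by (intro dual.vmod_scale_finite) auto
      then obtain I where I: "?m (\<lambda>x. g x / l) = ennreal I" "0 \<le> I" by (cases "?m (\<lambda>x. g x / l)") auto
      have I1: "1 < I" using gt unfolding l_def[symmetric] I(1) by (simp add: not_le)
      \<comment> \<open>The extremiser: \<open>(\<bar>f\<bar> * w) powr q\<close> equals
        \<open>(\<bar>g\<bar> / (w * l)) powr conjexp q\<close>, so the modular of \<open>f\<close>
        is the modular \<open>I\<close> of \<open>g / l\<close>.\<close>
      define f where "f x = (\<bar>g x\<bar> / (w x * l)) powr (conjexp (q x) - 1) / w x" for x
      have [measurable]: "f \<in> borel_measurable lebesgue" unfolding f_def by measurable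
      have f0: "0 \<le> f x" for x unfolding f_def using w_pos'[of x] by simp
      have fmod: "vmod q w f = ennreal I"
      proof -
        have "vmod q w f = ?m (\<lambda>x. g x / l)" unfolding vmod_def
        proof (intro nn_integral_cong arg_cong[where f = ennreal])
          fix x
          have "\<bar>f x\<bar> * w x = (\<bar>g x\<bar> / (w x * l)) powr (conjexp (q x) - 1)" using f0[of x] w_pos'[of x] by (simp add: f_def)
          moreover have "(conjexp (q x) - 1) * q x = conjexp (q x)" using q1[of x] by (simp add: conjexp_def field_simps)
          moreover have "\<bar>g x\<bar> / (w x * l) = \<bar>g x / l\<bar> * (1 / w x)" using l by (simp add: abs_divide)
          ultimately show "(\<bar>f x\<bar> * w x) powr q x = (\<bar>g x / l\<bar> * (1 / w x)) powr conjexp (q x)" by (simp add: powr_powr)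
        qed
        then show ?thesis using I by simp
      qed
      have fY: "(\<lambda>x. c * f x) \<in> members Y" if "0 < c" for c
        unfolding mem using vmod_scale_finite[of f c] that fmod by auto
      define n where "n = qnorm Y (\<lambda>x. 1 / I * f x)"
      have nK: "n \<le> ennreal K" unfolding n_def
      proof (rule K(3))
        show "(\<lambda>x. 1 / I * f x) \<in> members Y" using I1 by (intro fY) simp
        have "vmod q w (\<lambda>x. 1 / I * f x) \<le> ennreal ((1 / I) powr lo) * vmod q w f"
          using I1 by (intro vmod_scale_down) auto
        also have "\<dots> \<le> ennreal ((1 / I) powr 1) * vmod q w f"
          using I1 lo by (intro mult_right_mono ennreal_leI powr_le_powr_self) auto
        also have "\<dots> = 1" unfolding fmod using I1 by (simp flip: ennreal_mult)
        finally show "vmod q w (\<lambda>x. 1 / I * f x) \<le> 1" .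
      qed
      obtain n' where n': "n = ennreal n'" "0 \<le> n'" using nK by (cases n) (auto simp: top_unique)
      have n'K: "n' \<le> K" using nK n' K(1) by simp
      \<comment> \<open>Otherwise homogeneity gives \<open>K * f\<close> quasi-norm 0 as well, and
        the equivalence bounds the modular of \<open>f\<close> by 1, against
        \<open>I > 1\<close>.\<close>
      have "n' \<noteq> 0"
      proof
        assume "n' = 0"
        then have "qnorm Y (\<lambda>x. (K * I) * (1 / I * f x)) = 0"
          using hom[OF fY[of "1 / I"], of "K * I"] I1 K(1) n' unfolding n_def by simp
        moreover have "(\<lambda>x. (K * I) * (1 / I * f x)) = (\<lambda>x. K * f x)" using I1 by auto
        ultimately have "vmod q w (\<lambda>x. K * f x / K) \<le> 1" using K(1) by (intro K(2) fY) auto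
        then show False using K(1) fmod I1 by simp
      qed
      then have n'0: "0 < n'" using n' by simp
      \<comment> \<open>The dual norm is a supremum over functions of quasi-norm exactly 1, so a
        bound by \<open>K\<close> is not enough and the function is divided by its quasi-norm
        \<open>n'\<close>.\<close>
      have "qnorm Y (\<lambda>x. 1 / n' * (1 / I * f x)) = ennreal (1 / n') * n"
        unfolding n_def using n'0 I1 by (intro hom fY) auto
      also have "\<dots> = 1" unfolding n' using n'0 by (simp flip: ennreal_mult)
      finally have q1': "qnorm Y (\<lambda>x. 1 / n' * (1 / I * f x)) = 1" .
      have fm: "(\<lambda>x. 1 / n' * (1 / I * f x)) \<in> members Y"
        using fY[of "1 / n' * (1 / I)"] n'0 I1 by (simp add: mult.assoc)
      have "(\<integral>\<^sup>+x. ennreal \<bar>1 / n' * (1 / I * f x) * g x\<bar> \<partial>lebesgue) \<le> P g"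
        unfolding P_def using fm q1' by (intro SUP_upper) auto
      with P1 have le1: "(\<integral>\<^sup>+x. ennreal \<bar>1 / n' * (1 / I * f x) * g x\<bar> \<partial>lebesgue) \<le> 1" by (rule order_trans[rotated])
      have "(\<integral>\<^sup>+x. ennreal \<bar>1 / n' * (1 / I * f x) * g x\<bar> \<partial>lebesgue)
          = (\<integral>\<^sup>+x. ennreal (l / (n' * I)) * ennreal ((\<bar>g x / l\<bar> * (1 / w x)) powr conjexp (q x)) \<partial>lebesgue)"
      proof (intro nn_integral_cong)
        fix x
        define a where "a = \<bar>g x\<bar> / (w x * l)"
        have a0: "0 \<le> a" unfolding a_def using w_pos'[of x] l by simp
        have "\<bar>1 / n' * (1 / I * f x) * g x\<bar> = 1 / (n' * I) * (f x * \<bar>g x\<bar>)"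
          using n'0 I1 f0[of x] by (simp add: abs_mult)
        also have "f x * \<bar>g x\<bar> = l * (a * a powr (conjexp (q x) - 1))"
          unfolding f_def a_def using w_pos'[of x] l by simp
        also have "a * a powr (conjexp (q x) - 1) = a powr conjexp (q x)" using powr_mult_base[OF a0, of "conjexp (q x) - 1"] by simp
        also have "a = \<bar>g x / l\<bar> * (1 / w x)" unfolding a_def using l by (simp add: abs_divide)
        finally have "\<bar>1 / n' * (1 / I * f x) * g x\<bar> = l / (n' * I) * (\<bar>g x / l\<bar> * (1 / w x)) powr conjexp (q x)" by simp
        then show "ennreal \<bar>1 / n' * (1 / I * f x) * g x\<bar> = ennreal (l / (n' * I)) * ennreal ((\<bar>g x / l\<bar> * (1 / w x)) powr conjexp (q x))"
          using l n'0 I1 by (simp flip: ennreal_mult)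
      qed
      also have "\<dots> = ennreal (l / (n' * I)) * ?m (\<lambda>x. g x / l)" unfolding vmod_def by (rule nn_integral_cmult) measurable
      also have "\<dots> = ennreal (l / n')" unfolding I(1) using l n'0 I1 by (simp flip: ennreal_mult)
      finally have "ennreal (l / n') \<le> 1" using le1 by simp
      then have "l \<le> n'" using n'0 by (simp add: field_simps)
      then show False using n'K K(1) by (simp add: l_def)
    qed
  qed (use K in simp)
qed

end

section \<open>Boundedness in the quasi-norms\<close>

lemma maximal_scale:
  assumes c: "0 \<le> c" and [measurable]: "f \<in> borel_measurable lebesgue"
  shows "maximal (\<lambda>x. c * f x) x = ennreal c * maximal f x"
  unfolding maximal_def SUP_mult_left_ennreal
proof (intro SUP_cong refl)
  fix Q :: "'a set" assume "Q \<in> cubes"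
  then obtain c' r where Q: "Q = cube c' r" by (auto simp: cubes_eq)
  have "(\<integral>\<^sup>+y\<in>Q. ennreal \<bar>c * f y\<bar> \<partial>lebesgue) = (\<integral>\<^sup>+y. ennreal c * (ennreal \<bar>f y\<bar> * indicator Q y) \<partial>lebesgue)"
    using c by (intro nn_integral_cong) (simp add: abs_mult ennreal_mult mult.assoc)
  also have "\<dots> = ennreal c * (\<integral>\<^sup>+y\<in>Q. ennreal \<bar>f y\<bar> \<partial>lebesgue)"
    unfolding Q by (rule nn_integral_cmult) measurable
  finally show "(\<integral>\<^sup>+y\<in>Q. ennreal \<bar>c * f y\<bar> \<partial>lebesgue) / emeasure lebesgue Q * indicator Q x
      = ennreal c * ((\<integral>\<^sup>+y\<in>Q. ennreal \<bar>f y\<bar> \<partial>lebesgue) / emeasure lebesgue Q * indicator Q x)"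
    by (simp only: ennreal_times_divide[symmetric] mult.assoc)
qed

text \<open>Homogeneity carries the bound on the unit ball of the modular to all members. Entering
  and leaving the modular costs a factor \<open>K\<close> each, and \<open>k\<close> brings the
  modular bound \<open>K0\<close> down to 1, because
  \<open>(1 / k) powr lo <= 1 / k\<close>.\<close>

lemma (in A_weight) maximal_bounded_like_vLp:
  assumes Y: "like_vLp Y q w"
  shows "maximal_bounded_on Y"
proof -
  interpret bounded_vexponent q lo hi w
    using lo_gt_1 lo_le_q q_le_hi w_pos by unfold_locales auto
  obtain K where mem: "members Y = {f \<in> borel_measurable lebesgue. vmod q w f < \<infinity>}"
    and hom: "\<And>f c. f \<in> members Y \<Longrightarrow> 0 < c \<Longrightarrow> qnorm Y (\<lambda>x. c * f x) = ennreal c * qnorm Y f"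
    and K: "0 < K" "\<And>f. f \<in> members Y \<Longrightarrow> qnorm Y f \<le> 1 \<Longrightarrow> vmod q w (\<lambda>x. f x / K) \<le> 1"
      "\<And>f. f \<in> members Y \<Longrightarrow> vmod q w f \<le> 1 \<Longrightarrow> qnorm Y f \<le> ennreal K"
    using Y unfolding like_vLp_def by blast
  obtain K0 where K0: "0 \<le> K0" "\<forall>f. f \<in> borel_measurable lebesgue \<longrightarrow> (\<integral>\<^sup>+y. ennreal ((\<bar>f y\<bar> * w y) powr q y) \<partial>lebesgue) \<le> 1 \<longrightarrow>
    (AE x in lebesgue. maximal f x < \<infinity>) \<and>
    (\<integral>\<^sup>+y. ennreal ((enn2real (maximal f y) * w y) powr q y) \<partial>lebesgue) \<le> ennreal K0"
    using maximal_weighted_bound by (elim exE conjE) (rule that)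
  define k where "k = max 1 K0"
  have k: "1 \<le> k" "K0 \<le> k" by (auto simp: k_def)
  have memc: "(\<lambda>x. c * f x) \<in> members Y" if "f \<in> members Y" "0 \<le> c" for f c
    using that vmod_scale_finite[of f c] unfolding mem by auto
  have main: "(AE x in lebesgue. maximal f x < \<infinity>) \<and> (\<lambda>x. enn2real (maximal f x)) \<in> members Y \<and>
      qnorm Y (\<lambda>x. enn2real (maximal f x)) \<le> ennreal (k * K * K * e)"
    if f: "f \<in> members Y" and e: "0 < e" "qnorm Y f \<le> ennreal e" for f e
  proof -
    have fm [measurable]: "f \<in> borel_measurable lebesgue" using f by (simp add: mem)
    define c where "c = 1 / (e * K)"
    have c: "0 < c" unfolding c_def using e K by simp
    have "qnorm Y (\<lambda>x. 1 / e * f x) = ennreal (1 / e) * qnorm Y f" using f e by (intro hom) auto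
    also have "\<dots> \<le> ennreal (1 / e) * ennreal e" by (intro mult_left_mono e) auto
    also have "\<dots> = 1" using e by (simp flip: ennreal_mult)
    finally have "vmod q w (\<lambda>x. 1 / e * f x / K) \<le> 1" using e f by (intro K(2) memc) auto
    then have "vmod q w (\<lambda>x. c * f x) \<le> 1" by (simp add: c_def)
    then have le1: "(\<integral>\<^sup>+y. ennreal ((\<bar>c * f y\<bar> * w y) powr q y) \<partial>lebesgue) \<le> 1" by (simp add: vmod_def)
    have "(\<lambda>x. c * f x) \<in> borel_measurable lebesgue" by measurable
    from K0(2)[rule_format, OF this le1]
    have fin: "AE x in lebesgue. maximal (\<lambda>x. c * f x) x < \<infinity>"
      and bd: "(\<integral>\<^sup>+y. ennreal ((enn2real (maximal (\<lambda>x. c * f x) y) * w y) powr q y) \<partial>lebesgue) \<le> ennreal K0" by auto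
    have ms: "maximal (\<lambda>x. c * f x) x = ennreal c * maximal f x" for x using c by (intro maximal_scale) auto
    have fin': "AE x in lebesgue. maximal f x < \<infinity>"
      using fin unfolding ms by eventually_elim (use c in \<open>auto simp: ennreal_mult_less_top\<close>)
    define m where "m x = enn2real (maximal f x)" for x
    have [measurable]: "m \<in> borel_measurable lebesgue" unfolding m_def by measurable
    have cm: "enn2real (maximal (\<lambda>x. c * f x) x) = c * m x" for x
      unfolding ms m_def enn2real_mult using c by simp
    have m0: "0 \<le> m x" for x by (simp add: m_def)
    have vm: "vmod q w (\<lambda>x. c * m x) \<le> ennreal K0"
      using bd c m0 unfolding cm vmod_def by (simp add: abs_mult)
    have "vmod q w (\<lambda>x. 1 / k * (c * m x)) \<le> ennreal ((1 / k) powr lo) * vmod q w (\<lambda>x. c * m x)"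
      using k by (intro vmod_scale_down) auto
    also have "\<dots> \<le> ennreal ((1 / k) powr 1) * ennreal k"
      using k lo_gt_1 vm by (intro mult_mono ennreal_leI powr_le_powr_self) (auto intro: order_trans ennreal_leI)
    also have "\<dots> = 1" using k by (simp flip: ennreal_mult)
    finally have v1: "vmod q w (\<lambda>x. 1 / k * (c * m x)) \<le> 1" .
    have M1: "(\<lambda>x. 1 / k * (c * m x)) \<in> members Y" unfolding mem using v1 by (auto intro: le_less_trans)
    have meq: "m = (\<lambda>x. k / c * (1 / k * (c * m x)))" using c k by auto
    have "m \<in> members Y" using memc[OF M1, of "k / c"] c k by (subst meq) auto
    moreover have "qnorm Y m \<le> ennreal (k * K * K * e)"
    proof -
      have "qnorm Y m = ennreal (k / c) * qnorm Y (\<lambda>x. 1 / k * (c * m x))"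
        using hom[OF M1, of "k / c"] c k meq by simp
      also have "\<dots> \<le> ennreal (k / c) * ennreal K" by (intro mult_left_mono K(3) M1 v1) auto
      also have "\<dots> = ennreal (k / c * K)" using c k K by (intro ennreal_mult[symmetric]) auto
      also have "k / c * K = k * K * K * e" by (simp add: c_def)
      finally show ?thesis .
    qed
    ultimately show ?thesis using fin' unfolding m_def by auto
  qed
  define C where "C = k * K * K"
  have C: "0 < C" unfolding C_def using k K by simp
  show ?thesis unfolding maximal_bounded_on_def
  proof (intro exI[of _ C] ballI)
    fix f assume f: "f \<in> members Y"
    then have fm: "f \<in> borel_measurable lebesgue" "vmod q w f < \<infinity>" by (auto simp: mem)
    obtain l where l: "0 < l" "vmod q w (\<lambda>x. f x / l) \<le> 1" using exists_scale[OF fm] by blast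
    have "qnorm Y f \<le> ennreal (l * K)"
    proof -
      have f': "(\<lambda>x. 1 / l * f x) \<in> members Y" using f l by (intro memc) auto
      have "qnorm Y (\<lambda>x. l * (1 / l * f x)) = ennreal l * qnorm Y (\<lambda>x. 1 / l * f x)" using f' l by (intro hom) auto
      also have "\<dots> \<le> ennreal l * ennreal K" using l f' by (intro mult_left_mono K(3)) auto
      also have "\<dots> = ennreal (l * K)" using l K by (intro ennreal_mult[symmetric]) auto
      finally show ?thesis using l by simp
    qed
    then obtain n where n: "qnorm Y f = ennreal n" "0 \<le> n" by (cases "qnorm Y f") (auto simp: top_unique)
    have "qnorm Y (\<lambda>x. enn2real (maximal f x)) \<le> ennreal C * qnorm Y f"
    \<comment> \<open>A member of quasi-norm 0 cannot be normalised; for it, the bound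
      \<open>main\<close> is used with arbitrarily small scales.\<close>
    proof (cases "n = 0")
      case True
      have "qnorm Y (\<lambda>x. enn2real (maximal f x)) \<le> 0 + ennreal e" if e: "0 < e" for e
        using main[OF f, of "e / C", folded C_def] e C n True by simp
      then have "qnorm Y (\<lambda>x. enn2real (maximal f x)) \<le> 0" by (rule ennreal_le_epsilon)
      then show ?thesis by simp
    next
      case False
      then have "qnorm Y (\<lambda>x. enn2real (maximal f x)) \<le> ennreal (C * n)"
        using main[OF f, of n] n by (simp add: C_def)
      then show ?thesis using n C by (simp add: ennreal_mult)
    qed
    moreover have "qnorm Y f \<le> ennreal (n + 1)" unfolding n(1) by (rule ennreal_leI) simp
    ultimately show "(AE x in lebesgue. maximal f x < \<infinity>) \<and> (\<lambda>x. enn2real (maximal f x)) \<in> members Y \<and>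
        qnorm Y (\<lambda>x. enn2real (maximal f x)) \<le> ennreal C * qnorm Y f"
      using main[OF f, of "n + 1"] n(2) by auto
  qed
qed

section \<open>From the hypotheses to log-Hoelder exponents and Muckenhoupt weights\<close>

lemma AE_lebesgue_ex:
  assumes "AE x in lebesgue. P x" and "0 < r"
  shows "\<exists>x\<in>cube (c::'a::euclidean_space) r. P x"
proof (rule ccontr)
  assume "\<not> ?thesis"
  then have "AE x in lebesgue. x \<notin> cube c r" using assms(1) by (auto elim!: eventually_mono)
  then have "cube c r \<in> null_sets lebesgue" using AE_iff_null_sets[of "cube c r" lebesgue] by simp
  from null_setsD1[OF this] show False using assms(2) by (subst (asm) emeasure_cube) auto
qed

text \<open>\<open>LH0\<close> holds for almost all \<open>x\<close> and then almost all
  \<open>z\<close>, with an exceptional set depending on \<open>x\<close>, so two good points need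
  not be directly comparable. They are compared through a point near their midpoint that is good for
  both; it is closer to each than they are to each other, so only a factor 2 is lost.\<close>

lemma log_Hoelder_everywhere:
  fixes u :: "'a::euclidean_space \<Rightarrow> real"
  assumes C: "0 < C"
    and x: "AE z in lebesgue. norm (x - z) < 1 / 2 \<longrightarrow> \<bar>1 / u x - 1 / u z\<bar> \<le> C / (- ln (norm (x - z)))"
    and y: "AE z in lebesgue. norm (y - z) < 1 / 2 \<longrightarrow> \<bar>1 / u y - 1 / u z\<bar> \<le> C / (- ln (norm (y - z)))"
    and xy: "x \<noteq> y" "norm (x - y) < 1 / 2"
  shows "\<bar>1 / u x - 1 / u y\<bar> \<le> 2 * C / (- ln (norm (x - y)))"
proof -
  define d where "d = norm (x - y)"
  have d: "0 < d" "d < 1 / 2" using xy by (auto simp: d_def)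
  define m where "m = (1 / 2) *\<^sub>R (x + y)"
  \<comment> \<open>The cube of this radius lies within \<open>d / 4\<close> of the midpoint, so the
    distances of \<open>z\<close> to \<open>x\<close> and \<open>y\<close> are between
    \<open>d / 4\<close> and \<open>3 * d / 4\<close>.\<close>
  define \<rho> where "\<rho> = d / (4 * DIM('a))"
  have rho: "0 < \<rho>" unfolding \<rho>_def using d by simp
  have "AE z in lebesgue. (norm (x - z) < 1 / 2 \<longrightarrow> \<bar>1 / u x - 1 / u z\<bar> \<le> C / (- ln (norm (x - z)))) \<and>
      (norm (y - z) < 1 / 2 \<longrightarrow> \<bar>1 / u y - 1 / u z\<bar> \<le> C / (- ln (norm (y - z))))" using x y by eventually_elim auto
  from AE_lebesgue_ex[OF this rho, of m] obtain z where z: "z \<in> cube m \<rho>"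
    "norm (x - z) < 1 / 2 \<Longrightarrow> \<bar>1 / u x - 1 / u z\<bar> \<le> C / (- ln (norm (x - z)))"
    "norm (y - z) < 1 / 2 \<Longrightarrow> \<bar>1 / u y - 1 / u z\<bar> \<le> C / (- ln (norm (y - z)))" by blast
  have "\<bar>(z - m) \<bullet> i\<bar> \<le> \<rho>" if "i \<in> Basis" for i using z(1) that unfolding mem_cube inner_diff_left by blast
  then have "norm (z - m) \<le> DIM('a) * \<rho>" by (rule norm_le_of_coords)
  then have zm: "norm (z - m) \<le> d / 4" by (simp add: \<rho>_def)
  have close: "0 < norm (a - z) \<and> norm (a - z) < d" if "norm (a - m) = d / 2" for a
  proof -
    have "norm (a - z) \<le> norm (a - m) + norm (z - m)" using norm_triangle_ineq4[of "a - m" "z - m"] by simp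
    moreover have "norm (a - m) \<le> norm (a - z) + norm (z - m)" using norm_triangle_ineq[of "a - z" "z - m"] by simp
    ultimately show ?thesis using zm that d by linarith
  qed
  have "x - m = (1 / 2) *\<^sub>R (x - y)" "y - m = - ((1 / 2) *\<^sub>R (x - y))"
    unfolding m_def by (simp_all add: algebra_simps flip: scaleR_add_left) 
  then have "norm (x - m) = d / 2" "norm (y - m) = d / 2" by (simp_all add: d_def)
  from close[OF this(1)] close[OF this(2)]
  have n: "0 < norm (x - z)" "norm (x - z) < d" "0 < norm (y - z)" "norm (y - z) < d" by auto
  have bnd: "C / (- ln a) \<le> C / (- ln d)" if "0 < a" "a < d" for a
  proof (rule divide_left_mono)
    have "ln d < 0" "ln a < 0" using that d by auto
    then show "0 < - ln a * - ln d" by (simp add: mult_neg_neg)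
  qed (use that C in auto)
  have "\<bar>1 / u x - 1 / u y\<bar> \<le> \<bar>1 / u x - 1 / u z\<bar> + \<bar>1 / u y - 1 / u z\<bar>" by linarith
  also have "\<dots> \<le> C / (- ln d) + C / (- ln d)"
    using z(2,3) n d bnd[OF n(1,2)] bnd[OF n(3,4)] by linarith
  also have "\<dots> = 2 * C / (- ln d)" by simp
  finally show ?thesis unfolding d_def .
qed

text \<open>Reciprocals are cleared by \<open>\<bar>q x - q y\<bar> = q x * q y * \<bar>1 / q x - 1
  / q y\<bar>\<close>, at the price of the upper bounds \<open>hi\<close> and
  \<open>ui\<close>.\<close>

lemma lh_exponent_of_LH:
  fixes q u :: "'a::euclidean_space \<Rightarrow> real"
  assumes q: "q \<in> borel_measurable lebesgue" "1 < lo" "\<And>x. lo \<le> q x" "\<And>x. q x \<le> hi"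
    and qu: "AE x in lebesgue. q x = u x" and LH: "u \<in> LH0" "u \<in> LH_inf"
  shows "\<exists>N qi CL. lh_exponent q N qi lo hi CL"
proof -
  obtain C0 where C0: "0 < C0" "AE x in lebesgue. AE y in lebesgue.
     norm (x - y) < 1 / 2 \<longrightarrow> \<bar>1 / u x - 1 / u y\<bar> \<le> C0 / (- ln (norm (x - y)))" using LH(1) unfolding LH0_def by blast
  obtain C1 ui where C1: "0 < C1" "1 \<le> ui" "AE x in lebesgue. \<bar>1 / u x - 1 / ui\<bar> \<le> C1 / ln (exp 1 + norm x)"
    using LH(2) unfolding LH_inf_def by blast
  let ?G = "\<lambda>x. q x = u x \<and> (AE y in lebesgue. norm (x - y) < 1 / 2 \<longrightarrow> \<bar>1 / u x - 1 / u y\<bar> \<le> C0 / (- ln (norm (x - y)))) \<and>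
    \<bar>1 / u x - 1 / ui\<bar> \<le> C1 / ln (exp 1 + norm x)"
  have "AE x in lebesgue. ?G x" using qu C0(2) C1(3) by eventually_elim auto
  then obtain N where N: "{x \<in> space lebesgue. \<not> ?G x} \<subseteq> N" "N \<in> null_sets lebesgue"
    unfolding eventually_ae_filter by blast
  have G: "?G x" if "x \<notin> N" for x using N(1) that by auto
  \<comment> \<open>The limit \<open>ui\<close> is projected to the interval from \<open>lo\<close>
    to \<open>hi\<close>; as \<open>q\<close> takes its values there, no distance to it
    grows.\<close>
  define qi where "qi = max lo (min hi ui)"
  define CL where "CL = hi\<^sup>2 * (2 * C0) + hi * ui * C1"
  have lohi: "lo \<le> hi" using q(3,4)[of undefined] by linarith
  have pos: "0 < q x" for x using q(2) q(3)[of x] by linarith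
  have "lh_exponent q N qi lo hi CL"
  proof
    show "0 \<le> CL" unfolding CL_def using C0(1) C1(1,2) lohi q(2) by simp
    show "\<bar>q x - q y\<bar> * - ln (norm (x - y)) \<le> CL" if xy: "x \<notin> N" "y \<notin> N" "norm (x - y) < 1 / 2" for x y
    proof (cases "x = y")
      case False
      have l: "0 < - ln (norm (x - y))" using False xy(3) by simp
      have "\<bar>1 / u x - 1 / u y\<bar> \<le> 2 * C0 / (- ln (norm (x - y)))"
        using C0(1) G[OF xy(1)] G[OF xy(2)] False xy(3) by (intro log_Hoelder_everywhere) auto
      then have "\<bar>1 / u x - 1 / u y\<bar> * - ln (norm (x - y)) \<le> 2 * C0" unfolding pos_le_divide_eq[OF l] .
      moreover have "q x = u x" "q y = u y" using G[OF xy(1)] G[OF xy(2)] by auto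
      ultimately have *: "\<bar>1 / q x - 1 / q y\<bar> * - ln (norm (x - y)) \<le> 2 * C0" by (simp only:)
      have "\<bar>q x - q y\<bar> = q x * q y * \<bar>1 / q x - 1 / q y\<bar>"
      proof -
        have "q x * q y * (1 / q x - 1 / q y) = q y - q x" using pos[of x] pos[of y] by (simp add: field_simps)
        then have "\<bar>q x * q y * (1 / q x - 1 / q y)\<bar> = \<bar>q x - q y\<bar>" by simp
        then show ?thesis using pos[of x] pos[of y] by (simp add: abs_mult)
      qed
      also have "\<dots> \<le> hi * hi * \<bar>1 / q x - 1 / q y\<bar>"
        using q(4)[of x] q(4)[of y] pos[of x] pos[of y] by (intro mult_right_mono mult_mono) auto
      finally have "\<bar>q x - q y\<bar> * - ln (norm (x - y)) \<le> hi * hi * \<bar>1 / q x - 1 / q y\<bar> * - ln (norm (x - y))"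
        using l by (intro mult_right_mono) auto
      also have "\<dots> = hi * hi * (\<bar>1 / q x - 1 / q y\<bar> * - ln (norm (x - y)))" by simp
      also have "\<dots> \<le> hi * hi * (2 * C0)" by (intro mult_left_mono *) simp
      also have "\<dots> \<le> CL" unfolding CL_def power2_eq_square using C1(1,2) lohi q(2) by simp
      finally show ?thesis .
    qed (use C0(1) C1(1,2) lohi q(2) in \<open>simp add: CL_def\<close>)
    show "\<bar>q x - qi\<bar> * logtail x \<le> CL" if x: "x \<notin> N" for x
    proof -
      have l: "1 \<le> logtail x" by (rule logtail_ge_1)
      have "\<bar>1 / q x - 1 / ui\<bar> \<le> C1 / logtail x" using G[OF x] by (simp add: logtail_def)
      then have *: "\<bar>1 / q x - 1 / ui\<bar> * logtail x \<le> C1" using l by (simp add: pos_le_divide_eq)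
      have "\<bar>q x - qi\<bar> \<le> \<bar>q x - ui\<bar>" unfolding qi_def using q(3)[of x] q(4)[of x] by (auto simp: max_def min_def)
      also have "\<bar>q x - ui\<bar> = q x * ui * \<bar>1 / q x - 1 / ui\<bar>"
      proof -
        have "q x * ui * (1 / q x - 1 / ui) = ui - q x" using pos[of x] C1(2) by (simp add: field_simps)
        then have "\<bar>q x * ui * (1 / q x - 1 / ui)\<bar> = \<bar>q x - ui\<bar>" by simp
        then show ?thesis using pos[of x] C1(2) by (simp add: abs_mult)
      qed
      also have "\<dots> \<le> hi * ui * \<bar>1 / q x - 1 / ui\<bar>"
        using q(4)[of x] C1(2) by (intro mult_right_mono) auto
      finally have "\<bar>q x - qi\<bar> * logtail x \<le> hi * ui * \<bar>1 / q x - 1 / ui\<bar> * logtail x"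
        using l by (intro mult_right_mono) auto
      also have "\<dots> = hi * ui * (\<bar>1 / q x - 1 / ui\<bar> * logtail x)" by simp
      also have "\<dots> \<le> hi * ui * C1" using C1(2) lohi q(2) by (intro mult_left_mono *) auto
      also have "\<dots> \<le> CL" unfolding CL_def using C0(1) by simp
      finally show ?thesis .
    qed
  qed (use q N lohi in \<open>auto simp: qi_def\<close>)
  then show ?thesis by blast
qed

lemma recip_less:
  assumes "0 < a" "ennreal a < s" shows "recip s < 1 / a"
proof (cases s)
  case (real b)
  then have "a < b" using assms by (simp add: ennreal_less_iff)
  then show ?thesis using assms real by (simp add: recip_def inverse_ennreal frac_less2 inverse_eq_divide)
next
  case top then show ?thesis using assms by (simp add: recip_def)
qed

lemma inverse_eq_recip: "0 < s \<Longrightarrow> inverse s = ennreal (recip s)"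
  by (cases s) (auto simp: recip_def inverse_ennreal)

lemma recip_nonneg: "0 \<le> recip s"
  by (simp add: recip_def)

text \<open>Up to null sets, the two exponents in the condition on \<open>v\<close> are
  \<open>q / \<delta>\<close> and \<open>conjexp q / \<delta>\<close>, so the power
  \<open>1 / \<delta>\<close> of that condition is the one for \<open>vt powr (1 / \<delta>)\<close>
  and \<open>q\<close>. \<open>lam\<close> and \<open>mu\<close> are this power of admissible scales
  below twice the norms.\<close>

lemma Muckenhoupt_weights:
  fixes p :: "'a::euclidean_space \<Rightarrow> ennreal" and P Pt v vt :: "'a \<Rightarrow> real" and r :: real and s :: ennreal
  defines "\<delta> \<equiv> 1 / r - recip s"
  defines "q \<equiv> \<lambda>x. \<delta> / (1 / Pt x - recip s)"
  assumes r: "0 < r" and s: "ennreal r < s"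
    and P: "\<And>x. p x = ennreal (P x)" "\<And>x. r < P x" "\<And>x. recip s < 1 / P x"
    and Pt: "Pt \<in> borel_measurable lebesgue" "AE x in lebesgue. Pt x = P x" "\<And>x. ra \<le> Pt x" "\<And>x. Pt x \<le> rb"
      "r < ra" "recip s < 1 / rb"
    and v: "v \<in> borel_measurable lebesgue" "AE x in lebesgue. 0 < v x" "AE x in lebesgue. vt x = v x"
      "vt \<in> borel_measurable lebesgue" "\<And>x. 0 < vt x"
    and A: "v \<in> muckenhoupt_rs p r s"
  shows "\<exists>lam mu CA. \<forall>c \<rho>. 0 < \<rho> \<longrightarrow> 0 < lam c \<rho> \<and> 0 < mu c \<rho> \<and>
    (\<integral>\<^sup>+x\<in>cube c \<rho>. ennreal ((vt x powr (1 / \<delta>) / lam c \<rho>) powr q x) \<partial>lebesgue) \<le> 1 \<and>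
    (\<integral>\<^sup>+x\<in>cube c \<rho>. ennreal ((1 / (vt x powr (1 / \<delta>) * mu c \<rho>)) powr conjexp (q x)) \<partial>lebesgue) \<le> 1 \<and>
    lam c \<rho> * mu c \<rho> \<le> CA * \<rho> ^ DIM('a)"
proof -
  let ?i = "recip s"
  note [measurable] = Pt(1) v(1,4)
  have s0: "0 < s" using s by (auto intro: le_less_trans[OF zero_le])
  have dpos: "0 < \<delta>" unfolding \<delta>_def using recip_less[OF r s] by simp
  have ra: "0 < ra" using r Pt(5) by simp
  have Ptb: "1 / Pt x \<le> 1 / ra" "1 / rb \<le> 1 / Pt x" "0 < Pt x" for x
    using Pt(3)[of x] Pt(4)[of x] ra by (auto intro!: divide_left_mono mult_pos_pos)
  have rb: "0 < rb" using Ptb(3) Pt(4) by (rule less_le_trans)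
  have rr: "1 / ra < 1 / r" using r Pt(5) by (intro divide_strict_left_mono) auto
  have gap: "?i < 1 / Pt x" "1 / Pt x < 1 / r" for x using Ptb[of x] Pt(6) rr by linarith+
  have q1: "q x / \<delta> = 1 / (1 / Pt x - ?i)" for x unfolding q_def using dpos by simp
  have q2: "conjexp (q x) / \<delta> = 1 / (1 / r - 1 / Pt x)" for x
  proof -
    define y where "y = 1 / Pt x - ?i"
    have y: "0 < y" "\<delta> - y = 1 / r - 1 / Pt x" "0 < \<delta> - y" unfolding y_def \<delta>_def using gap[of x] by auto
    have "conjexp (\<delta> / y) / \<delta> = 1 / (\<delta> - y)" unfolding conjexp_def using y dpos by (simp add: field_simps)
    then show ?thesis unfolding q_def y_def[symmetric] y(2) .
  qed
  interpret B1: bounded_vexponent "\<lambda>x. q x / \<delta>" "1 / (1 / ra - ?i)" "1 / (1 / rb - ?i)" "\<lambda>_. 1"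
  proof
    show "(\<lambda>x. q x / \<delta>) \<in> borel_measurable lebesgue" unfolding q1 by measurable
    show "0 < 1 / (1 / ra - ?i)" using gap(1) Ptb(1) by (meson diff_gt_0_iff_gt less_le_trans zero_less_divide_1_iff)
    show "1 / (1 / ra - ?i) \<le> q x / \<delta>" "q x / \<delta> \<le> 1 / (1 / rb - ?i)" for x
      unfolding q1 using gap(1)[of x] Ptb[of x] Pt(6) by (auto intro!: divide_left_mono mult_pos_pos)
  qed auto
  interpret B2: bounded_vexponent "\<lambda>x. conjexp (q x) / \<delta>" "1 / (1 / r - 1 / rb)" "1 / (1 / r - 1 / ra)" "\<lambda>_. 1"
  proof
    show "(\<lambda>x. conjexp (q x) / \<delta>) \<in> borel_measurable lebesgue" unfolding q2 by measurable
    show "0 < 1 / (1 / r - 1 / rb)" using gap(2) Ptb(2) by (meson diff_gt_0_iff_gt le_less_trans zero_less_divide_1_iff)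
    show "1 / (1 / r - 1 / rb) \<le> conjexp (q x) / \<delta>" "conjexp (q x) / \<delta> \<le> 1 / (1 / r - 1 / ra)" for x
      unfolding q2 using gap(2)[of x] Ptb[of x] rr by (auto intro!: divide_left_mono mult_pos_pos)
  qed auto
  define p1 where "p1 x = inverse (inverse (p x) - inverse s)" for x
  define p2 where "p2 x = inverse (inverse (ennreal r) - inverse (p x))" for x
  have invp: "inverse (p x) = ennreal (1 / P x)" for x
    unfolding P(1) using P(2)[of x] r by (simp add: inverse_ennreal inverse_eq_divide)
  have p1: "p1 x = ennreal (1 / (1 / P x - ?i))" for x
    unfolding p1_def invp inverse_eq_recip[OF s0]
    using P(3)[of x] recip_nonneg[of s] by (simp add: ennreal_minus inverse_ennreal inverse_eq_divide)
  have Pr: "1 / P x < 1 / r" for x using P(2)[of x] r by (intro divide_strict_left_mono) auto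
  have p2: "p2 x = ennreal (1 / (1 / r - 1 / P x))" for x
  proof -
    have "inverse (ennreal r) = ennreal (1 / r)" using r by (simp add: inverse_ennreal inverse_eq_divide)
    moreover have "0 \<le> 1 / P x" using P(2)[of x] r by simp
    ultimately show ?thesis unfolding p2_def invp using Pr[of x]
      by (simp add: ennreal_minus inverse_ennreal inverse_eq_divide)
  qed
  have p1q: "AE x in lebesgue. enn2real (p1 x) = q x / \<delta>" using Pt(2)
    by eventually_elim (use P(3) in \<open>simp add: p1 q1 less_imp_le\<close>)
  have p2q: "AE x in lebesgue. enn2real (p2 x) = conjexp (q x) / \<delta>" using Pt(2)
    by eventually_elim (use Pr in \<open>simp add: p2 q2 less_imp_le\<close>)
  have p1t: "p1 x \<noteq> \<infinity>" and p2t: "p2 x \<noteq> \<infinity>" for x unfolding p1 p2 by auto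
  define S where "S = enn2real (SUP Q\<in>cubes. ennreal (measure lebesgue Q powr (- \<delta>))
     * vLp_norm p1 (\<lambda>_. 1) (\<lambda>x. v x * indicator Q x) * vLp_norm p2 (\<lambda>_. 1) (\<lambda>x. inverse (v x) * indicator Q x))"
  have S: "ennreal (measure lebesgue Q powr (- \<delta>))
     * vLp_norm p1 (\<lambda>_. 1) (\<lambda>x. v x * indicator Q x) * vLp_norm p2 (\<lambda>_. 1) (\<lambda>x. inverse (v x) * indicator Q x) \<le> ennreal S"
    if "Q \<in> cubes" for Q :: "'a set"
  proof -
    have "(SUP Q\<in>cubes. ennreal (measure lebesgue Q powr (- \<delta>))
     * vLp_norm p1 (\<lambda>_. 1) (\<lambda>x. v x * indicator Q x) * vLp_norm p2 (\<lambda>_. 1) (\<lambda>x. inverse (v x) * indicator Q x)) < \<infinity>"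
      using A unfolding muckenhoupt_rs_def p1_def p2_def \<delta>_def by simp
    then have "ennreal S = (SUP Q\<in>cubes. ennreal (measure lebesgue Q powr (- \<delta>))
     * vLp_norm p1 (\<lambda>_. 1) (\<lambda>x. v x * indicator Q x) * vLp_norm p2 (\<lambda>_. 1) (\<lambda>x. inverse (v x) * indicator Q x))"
      unfolding S_def by simp
    then show ?thesis using that by (auto intro: SUP_upper)
  qed
  have S0: "0 \<le> S" by (simp add: S_def)
  \<comment> \<open>The 4 comes from the factor 2 lost in each norm, the power of 2 from the measure
    \<open>(2 * \<rho>) ^ DIM('a)\<close> of a cube of radius \<open>\<rho>\<close>.\<close>
  define CA where "CA = (4 * S) powr (1 / \<delta>) * 2 ^ DIM('a)"
  define w where "w x = vt x powr (1 / \<delta>)" for x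
  have w0: "0 < w x" for x unfolding w_def using v(5)[of x] by (simp only: powr_gt_zero)
  have ex: "\<exists>l m. 0 < l \<and> 0 < m \<and> (\<integral>\<^sup>+x\<in>cube c \<rho>. ennreal ((w x / l) powr q x) \<partial>lebesgue) \<le> 1 \<and>
    (\<integral>\<^sup>+x\<in>cube c \<rho>. ennreal ((1 / (w x * m)) powr conjexp (q x)) \<partial>lebesgue) \<le> 1 \<and> l * m \<le> CA * \<rho> ^ DIM('a)"
    if \<rho>: "0 < \<rho>" for c \<rho>
  proof -
    let ?Q = "cube c \<rho>"
    define D where "D = (2 * \<rho>) ^ DIM('a)"
    have D: "0 < D" unfolding D_def using \<rho> by simp
    define f1 where "f1 x = v x * indicator ?Q x" for x
    define f2 where "f2 x = inverse (v x) * indicator ?Q x" for x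
    have [measurable]: "f1 \<in> borel_measurable lebesgue" "f2 \<in> borel_measurable lebesgue"
      unfolding f1_def f2_def by measurable
    define e1 where "e1 = vLp_norm p1 (\<lambda>_. 1) f1"
    define e2 where "e2 = vLp_norm p2 (\<lambda>_. 1) f2"
    have le: "ennreal (D powr (- \<delta>)) * e1 * e2 \<le> ennreal S"
      using S[of ?Q] \<rho> measure_cube[of \<rho> c] unfolding e1_def e2_def f1_def f2_def D_def by (auto simp: cubes_eq)
    have nz: False if "AE x in lebesgue. (\<bar>f x\<bar> * 1) powr b x = 0" "AE x in lebesgue. x \<in> ?Q \<longrightarrow> f x \<noteq> 0" for f b :: "'a \<Rightarrow> real"
    proof -
      have "AE x in lebesgue. x \<notin> ?Q" using that by eventually_elim auto
      from AE_lebesgue_ex[OF this \<rho>, of c] show False by blast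
    qed
    have e1: "e1 \<noteq> 0"
    proof
      assume "e1 = 0"
      then have "vmod (\<lambda>x. q x / \<delta>) (\<lambda>_. 1) f1 = 0"
        unfolding e1_def using p1t p1q by (intro B1.vLp_norm_eq_0[of p1 "\<lambda>_. 1"]) auto
      then have "AE x in lebesgue. ennreal ((\<bar>f1 x\<bar> * 1) powr (q x / \<delta>)) = 0"
        unfolding vmod_def by (subst (asm) nn_integral_0_iff_AE) auto
      then have "AE x in lebesgue. (\<bar>f1 x\<bar> * 1) powr (q x / \<delta>) = 0" by eventually_elim (simp add: ennreal_eq_0_iff order_antisym)
      moreover have "AE x in lebesgue. x \<in> ?Q \<longrightarrow> f1 x \<noteq> 0" using v(2) by eventually_elim (auto simp: f1_def)
      ultimately show False by (rule nz)
    qed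
    have e2: "e2 \<noteq> 0"
    proof
      assume "e2 = 0"
      then have "vmod (\<lambda>x. conjexp (q x) / \<delta>) (\<lambda>_. 1) f2 = 0"
        unfolding e2_def using p2t p2q by (intro B2.vLp_norm_eq_0[of p2 "\<lambda>_. 1"]) auto
      then have "AE x in lebesgue. ennreal ((\<bar>f2 x\<bar> * 1) powr (conjexp (q x) / \<delta>)) = 0"
        unfolding vmod_def by (subst (asm) nn_integral_0_iff_AE) auto
      then have "AE x in lebesgue. (\<bar>f2 x\<bar> * 1) powr (conjexp (q x) / \<delta>) = 0" by eventually_elim (simp add: ennreal_eq_0_iff order_antisym)
      moreover have "AE x in lebesgue. x \<in> ?Q \<longrightarrow> f2 x \<noteq> 0" using v(2) by eventually_elim (auto simp: f2_def)
      ultimately show False by (rule nz)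
    qed
    have Dd: "ennreal (D powr (- \<delta>)) \<noteq> 0" using D by simp
    \<comment> \<open>A factor 0 could hide an infinite norm, since 0 times infinity is 0 in
      \<open>ennreal\<close>; as no factor vanishes, both norms are finite.\<close>
    have "e1 \<noteq> \<infinity>" "e2 \<noteq> \<infinity>"
      using le e1 e2 Dd by (auto simp: ennreal_mult_top ennreal_top_mult top_unique)
    then obtain r1 r2 where r12: "e1 = ennreal r1" "e2 = ennreal r2" "0 < r1" "0 < r2"
      using e1 e2 by (cases e1; cases e2) (auto simp: less_le)
    have "ennreal (D powr (- \<delta>) * r1 * r2) \<le> ennreal S" using le r12 by (simp add: ennreal_mult less_imp_le)
    then have "D powr (- \<delta>) * r1 * r2 \<le> S" using S0 by (simp add: ennreal_le_iff)
    then have prod: "r1 * r2 \<le> S * D powr \<delta>" using D by (simp add: powr_minus field_simps)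
    have "vLp_norm p1 (\<lambda>_. 1) f1 < ennreal (2 * r1)" unfolding e1_def[symmetric] r12 using r12 by (simp add: ennreal_less_iff)
    then obtain l1 where l1: "0 < l1" "ennreal l1 < ennreal (2 * r1)" "vmod (\<lambda>x. q x / \<delta>) (\<lambda>_. 1) (\<lambda>x. f1 x / l1) \<le> 1"
      using B1.vLp_norm_lessE[OF p1t p1q, of "\<lambda>_. 1" f1 "ennreal (2 * r1)"] by auto
    have "vLp_norm p2 (\<lambda>_. 1) f2 < ennreal (2 * r2)" unfolding e2_def[symmetric] r12 using r12 by (simp add: ennreal_less_iff)
    then obtain l2 where l2: "0 < l2" "ennreal l2 < ennreal (2 * r2)" "vmod (\<lambda>x. conjexp (q x) / \<delta>) (\<lambda>_. 1) (\<lambda>x. f2 x / l2) \<le> 1"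
      using B2.vLp_norm_lessE[OF p2t p2q, of "\<lambda>_. 1" f2 "ennreal (2 * r2)"] by auto
    have l12: "l1 * l2 \<le> 4 * S * D powr \<delta>"
    proof -
      have "l1 * l2 \<le> (2 * r1) * (2 * r2)" using l1 l2 by (intro mult_mono) (auto simp: ennreal_less_iff)
      then show ?thesis using prod by simp
    qed
    define l where "l = l1 powr (1 / \<delta>)"
    define m where "m = l2 powr (1 / \<delta>)"
    have lm0: "0 < l" "0 < m" unfolding l_def m_def using l1 l2 by auto
    have "l * m = (l1 * l2) powr (1 / \<delta>)" unfolding l_def m_def using l1 l2 by (simp add: powr_mult)
    also have "\<dots> \<le> (4 * S * D powr \<delta>) powr (1 / \<delta>)" using l12 l1 l2 dpos by (intro powr_mono2) auto
    also have "\<dots> = (4 * S) powr (1 / \<delta>) * D" using S0 D dpos by (simp add: powr_mult powr_powr)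
    also have "\<dots> = CA * \<rho> ^ DIM('a)" unfolding CA_def D_def by (simp add: power_mult_distrib)
    finally have lm: "l * m \<le> CA * \<rho> ^ DIM('a)" .
    have "(\<integral>\<^sup>+x\<in>?Q. ennreal ((w x / l) powr q x) \<partial>lebesgue) = vmod (\<lambda>x. q x / \<delta>) (\<lambda>_. 1) (\<lambda>x. f1 x / l1)"
      unfolding vmod_def
    proof (intro nn_integral_cong_AE)
      show "AE x in lebesgue. ennreal ((w x / l) powr q x) * indicator ?Q x = ennreal ((\<bar>f1 x / l1\<bar> * 1) powr (q x / \<delta>))"
        using v(2,3)
      proof eventually_elim
        case (elim x)
        have "w x / l = (v x / l1) powr (1 / \<delta>)" unfolding w_def l_def using elim l1 by (simp add: powr_divide)
        then have "(w x / l) powr q x = (v x / l1) powr (q x / \<delta>)" by (simp add: powr_powr)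
        then show ?case using elim l1 by (auto simp: f1_def indicator_def)
      qed
    qed
    then have i1: "(\<integral>\<^sup>+x\<in>?Q. ennreal ((w x / l) powr q x) \<partial>lebesgue) \<le> 1" using l1(3) by simp
    have "(\<integral>\<^sup>+x\<in>?Q. ennreal ((1 / (w x * m)) powr conjexp (q x)) \<partial>lebesgue) = vmod (\<lambda>x. conjexp (q x) / \<delta>) (\<lambda>_. 1) (\<lambda>x. f2 x / l2)"
      unfolding vmod_def
    proof (intro nn_integral_cong_AE)
      show "AE x in lebesgue. ennreal ((1 / (w x * m)) powr conjexp (q x)) * indicator ?Q x = ennreal ((\<bar>f2 x / l2\<bar> * 1) powr (conjexp (q x) / \<delta>))"
        using v(2,3)
      proof eventually_elim
        case (elim x)
        have "1 / (w x * m) = (1 / (v x * l2)) powr (1 / \<delta>)" unfolding w_def m_def using elim l2 by (simp add: powr_divide powr_mult)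
        then have "(1 / (w x * m)) powr conjexp (q x) = (1 / (v x * l2)) powr (conjexp (q x) / \<delta>)" by (simp add: powr_powr)
        then show ?case using elim l2 by (auto simp: f2_def indicator_def field_simps)
      qed
    qed
    then have i2: "(\<integral>\<^sup>+x\<in>?Q. ennreal ((1 / (w x * m)) powr conjexp (q x)) \<partial>lebesgue) \<le> 1" using l2(3) by simp
    show ?thesis using lm0 i1 i2 lm by blast
  qed
  define good where "good c \<rho> l m \<longleftrightarrow> 0 < l \<and> 0 < m \<and> (\<integral>\<^sup>+x\<in>cube c \<rho>. ennreal ((w x / l) powr q x) \<partial>lebesgue) \<le> 1 \<and>
    (\<integral>\<^sup>+x\<in>cube c \<rho>. ennreal ((1 / (w x * m)) powr conjexp (q x)) \<partial>lebesgue) \<le> 1 \<and> l * m \<le> CA * \<rho> ^ DIM('a)" for c \<rho> l m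
  have "\<forall>c \<rho>. \<exists>l m. 0 < \<rho> \<longrightarrow> good c \<rho> l m" using ex unfolding good_def by blast
  then obtain lam mu where "\<forall>c \<rho>. 0 < \<rho> \<longrightarrow> good c \<rho> (lam c \<rho>) (mu c \<rho>)" by metis
  then show ?thesis unfolding good_def w_def by blast
qed

theorem theorem3p6:
  fixes r :: real and s :: ennreal
    and p :: "'a::euclidean_space \<Rightarrow> ennreal" and v :: "'a \<Rightarrow> real"
  assumes "0 < r" and "ennreal r < s"
    and "p \<in> borel_measurable lebesgue"
    and "\<And>x. ennreal r < p x \<and> p x < s"
    and "ennreal r < essinf lebesgue p"
    and "essinf lebesgue p \<le> esssup lebesgue p"
    and "esssup lebesgue p < s"
    and "(\<lambda>x. enn2real (rs_exponent r s p x)) \<in> LH0 \<inter> LH_inf"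
    and "weight v"
    and "v \<in> muckenhoupt_rs p r s"
  shows "maximal_bounded_on (rs_space r s (vLp p v)) \<and>
         maximal_bounded_on (koethe_dual (rs_space r s (vLp p v)))"
proof -
  note r = assms(1) and s = assms(2)
  have [measurable]: "p \<in> borel_measurable lebesgue" by fact
  have s0: "0 < s" using s by (auto intro: le_less_trans[OF zero_le])
  let ?i = "recip s"
  define \<delta> where "\<delta> = 1 / r - ?i"
  have dpos: "0 < \<delta>" unfolding \<delta>_def using recip_less[OF r s] by simp
  define P where "P x = enn2real (p x)" for x
  have [measurable]: "P \<in> borel_measurable lebesgue" unfolding P_def by measurable
  have pP: "p x = ennreal (P x)" for x
    unfolding P_def using assms(4)[of x] by (metis ennreal_enn2real order.strict_trans2 top_greatest)
  have rP: "r < P x" for x using assms(4)[of x] r unfolding pP by (auto simp: ennreal_less_iff)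
  have iP: "?i < 1 / P x" for x using assms(4)[of x] rP[of x] r unfolding pP by (intro recip_less) auto
  \<comment> \<open>A number strictly between \<open>r\<close> and the essential infimum bounds
    \<open>p\<close> below almost everywhere and keeps a gap to \<open>r\<close>, on which
    \<open>1 < lo\<close> rests.\<close>
  obtain a where a: "ennreal r < a" "a < essinf lebesgue p" using dense[OF assms(5)] by blast
  then have "a < Liminf (ae_filter lebesgue) p" by (simp add: essinf_def)
  then have AEa: "AE x in lebesgue. a < p x" by (rule less_LiminfD)
  define b where "b = esssup lebesgue p"
  have AEb: "AE x in lebesgue. p x \<le> b" unfolding b_def by (rule esssup_AE)
  have AEab: "AE x in lebesgue. a < p x \<and> p x \<le> b" using AEa AEb by eventually_elim auto
  obtain x0 where x0: "a < p x0" "p x0 \<le> b" using AE_lebesgue_ex[OF AEab, of 1 0] by auto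
  obtain rb where rb: "b = ennreal rb" "0 \<le> rb" using assms(7) unfolding b_def[symmetric] by (cases b) auto
  obtain ra where ra: "a = ennreal ra" "0 \<le> ra" using x0(1) by (cases a) auto
  have ra_r: "r < ra" using a(1) r unfolding ra(1) by (simp add: ennreal_less_iff)
  have ra_rb: "ra \<le> rb" using x0 ra rb by (metis ennreal_le_iff less_imp_le order_trans)
  have rb_s: "?i < 1 / rb" using assms(7) ra_rb ra_r r unfolding b_def[symmetric] rb(1) by (intro recip_less) auto
  \<comment> \<open>Changed on a null set only, so that the bounds hold at every point;
    \<open>vt\<close> does the same for positivity of the weight.\<close>
  define Pt where "Pt x = (if ra \<le> P x \<and> P x \<le> rb then P x else ra)" for x
  have Ptm [measurable]: "Pt \<in> borel_measurable lebesgue" unfolding Pt_def by measurable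
  have PtP: "AE x in lebesgue. Pt x = P x" using AEab
  proof eventually_elim
    case (elim x)
    then have "ra \<le> P x" "P x \<le> rb" using rP[of x] r unfolding pP ra(1) rb(1) by (auto simp: ennreal_less_iff ra(2) rb(2))
    then show ?case by (simp add: Pt_def)
  qed
  have Ptb: "ra \<le> Pt x" "Pt x \<le> rb" for x unfolding Pt_def using ra_rb by auto
  define vt where "vt x = (if 0 < v x then v x else 1)" for x
  have vm [measurable]: "v \<in> borel_measurable lebesgue" and v0: "AE x in lebesgue. 0 < v x"
    using assms(9) by (auto simp: weight_def)
  have vtm [measurable]: "vt \<in> borel_measurable lebesgue" unfolding vt_def by measurable
  have vt0: "0 < vt x" for x by (simp add: vt_def)
  have vtv: "AE x in lebesgue. vt x = v x" using v0 by eventually_elim (simp add: vt_def)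
  define q where "q x = \<delta> / (1 / Pt x - ?i)" for x
  define lo where "lo = \<delta> / (1 / ra - ?i)"
  define hi where "hi = \<delta> / (1 / rb - ?i)"
  have pos: "0 < ra" "0 < rb" "0 < Pt x" for x using ra_r r ra_rb Ptb(1)[of x] by auto
  have ord: "1 / Pt x \<le> 1 / ra" "1 / rb \<le> 1 / Pt x" for x
    using Ptb[of x] pos by (auto intro!: divide_left_mono mult_pos_pos)
  have ra_inv: "1 / ra < 1 / r" using r ra_r by (intro divide_strict_left_mono) auto
  have rb_ra: "1 / rb \<le> 1 / ra" using ra_rb pos by (intro divide_left_mono) auto
  have gap: "0 < 1 / Pt x - ?i" "0 < 1 / ra - ?i" "0 < 1 / rb - ?i" for x
    using ord[of x] rb_s rb_ra by linarith+
  have [measurable]: "q \<in> borel_measurable lebesgue" unfolding q_def by measurable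
  have lo1: "1 < lo" unfolding lo_def \<delta>_def using gap(2) ra_inv by simp
  have qb: "lo \<le> q x" "q x \<le> hi" for x
    unfolding lo_def q_def hi_def using gap ord[of x] dpos by (auto intro!: divide_left_mono mult_pos_pos)
  define u where "u x = enn2real (rs_exponent r s p x)" for x
  have u: "u x = \<delta> / (1 / P x - ?i)" for x
  proof -
    have P0: "0 < P x" using rP[of x] r by simp
    have "inverse (p x) - inverse s = ennreal (1 / P x - ?i)"
      unfolding pP inverse_eq_recip[OF s0] using P0 recip_nonneg[of s]
      by (simp add: inverse_ennreal inverse_eq_divide ennreal_minus)
    moreover have "inverse (ennreal r) - inverse s = ennreal \<delta>"
      unfolding inverse_eq_recip[OF s0] \<delta>_def using r recip_nonneg[of s]
      by (simp add: inverse_ennreal inverse_eq_divide ennreal_minus)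
    ultimately have "rs_exponent r s p x = inverse (ennreal ((1 / P x - ?i) / \<delta>))"
      unfolding rs_exponent_def using iP[of x] dpos by (simp add: divide_ennreal)
    also have "\<dots> = ennreal (\<delta> / (1 / P x - ?i))"
      using iP[of x] dpos by (subst inverse_ennreal) auto
    finally show ?thesis unfolding u_def using iP[of x] dpos by simp
  qed
  have qu: "AE x in lebesgue. q x = u x" using PtP by eventually_elim (simp add: q_def u)
  have "u \<in> LH0" "u \<in> LH_inf" using assms(8) unfolding u_def by auto
  then obtain N qi CL where lh: "lh_exponent q N qi lo hi CL"
    using lh_exponent_of_LH[of q lo hi u] lo1 qb qu by auto
  define w where "w x = vt x powr (1 / \<delta>)" for x
  have w0: "0 < w x" for x unfolding w_def using vt0[of x] by (simp only: powr_gt_zero)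
  have "\<exists>lam mu CA. \<forall>c \<rho>. 0 < \<rho> \<longrightarrow> 0 < lam c \<rho> \<and> 0 < mu c \<rho> \<and>
    (\<integral>\<^sup>+x\<in>cube c \<rho>. ennreal ((w x / lam c \<rho>) powr q x) \<partial>lebesgue) \<le> 1 \<and>
    (\<integral>\<^sup>+x\<in>cube c \<rho>. ennreal ((1 / (w x * mu c \<rho>)) powr conjexp (q x)) \<partial>lebesgue) \<le> 1 \<and>
    lam c \<rho> * mu c \<rho> \<le> CA * \<rho> ^ DIM('a)"
    unfolding w_def q_def \<delta>_def
    by (rule Muckenhoupt_weights[OF r s pP rP iP Ptm PtP Ptb ra_r rb_s vm v0 vtv vtm vt0 assms(10)])
  then obtain lam mu CA where lam: "\<forall>c \<rho>. 0 < \<rho> \<longrightarrow> 0 < lam c \<rho> \<and> 0 < mu c \<rho> \<and>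
    (\<integral>\<^sup>+x\<in>cube c \<rho>. ennreal ((w x / lam c \<rho>) powr q x) \<partial>lebesgue) \<le> 1 \<and>
    (\<integral>\<^sup>+x\<in>cube c \<rho>. ennreal ((1 / (w x * mu c \<rho>)) powr conjexp (q x)) \<partial>lebesgue) \<le> 1 \<and>
    lam c \<rho> * mu c \<rho> \<le> CA * \<rho> ^ DIM('a)"
    by (elim exE) (rule that)
  interpret A_weight q N qi lo hi CL w lam mu CA
  proof (intro A_weight.intro lh A_weight_axioms.intro lo1 w0)
    show "w \<in> borel_measurable lebesgue" unfolding w_def by measurable
    fix c \<rho> assume "(0::real) < \<rho>"
    note * = lam[rule_format, OF this, of c]
    show "0 < lam c \<rho>" "0 < mu c \<rho>" "lam c \<rho> * mu c \<rho> \<le> CA * \<rho> ^ DIM('a)"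
      "(\<integral>\<^sup>+x\<in>cube c \<rho>. ennreal ((w x / lam c \<rho>) powr q x) \<partial>lebesgue) \<le> 1"
      "(\<integral>\<^sup>+x\<in>cube c \<rho>. ennreal ((1 / (w x * mu c \<rho>)) powr conjexp (q x)) \<partial>lebesgue) \<le> 1"
      using * by - (elim conjE, assumption)+
  qed
  have r_rs: "0 < 1 - r * ?i" using dpos r unfolding \<delta>_def by (simp add: field_simps)
  \<comment> \<open>The conjugate exponent of \<open>s / r\<close>, equal to 1 for infinite
    \<open>s\<close>.\<close>
  define t where "t = 1 / (1 - r * ?i)"
  have t0: "0 < t" unfolding t_def using r_rs by simp
  interpret X: bounded_vexponent Pt ra rb vt
    using pos Ptb vt0 by unfold_locales auto
  have X1: "like_vLp (vLp p v) Pt vt"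
  proof (rule X.like_vLp_vLp)
    show "p x \<noteq> \<infinity>" for x unfolding pP by simp
    show "AE x in lebesgue. enn2real (p x) = Pt x" using PtP by eventually_elim (simp add: P_def)
    show "AE x in lebesgue. v x = vt x" using vtv by eventually_elim simp
  qed
  have X2: "like_vLp (space_power (vLp p v) r) (\<lambda>x. Pt x / r) (\<lambda>x. vt x powr r)"
    using X1 r by (rule X.like_vLp_space_power)
  interpret X2: bounded_vexponent "\<lambda>x. Pt x / r" "ra / r" "rb / r" "\<lambda>x. vt x powr r"
    using r by (rule X.bounded_vexponent_power)
  have rar: "1 < ra / r" "1 < rb / r" using ra_r ra_rb r by auto
  have X3: "like_vLp (koethe_dual (space_power (vLp p v) r)) (\<lambda>x. conjexp (Pt x / r)) (\<lambda>x. 1 / vt x powr r)"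
    using X2 rar(1) by (rule X2.like_vLp_koethe_dual)
  interpret X3: bounded_vexponent "\<lambda>x. conjexp (Pt x / r)" "conjexp (rb / r)" "conjexp (ra / r)" "\<lambda>x. 1 / vt x powr r"
    using rar(1) by (rule X2.bounded_vexponent_conj)
  have X4: "like_vLp (space_power (koethe_dual (space_power (vLp p v) r)) t) (\<lambda>x. conjexp (Pt x / r) / t) (\<lambda>x. (1 / vt x powr r) powr t)"
    using X3 t0 by (rule X3.like_vLp_space_power)
  interpret X4: bounded_vexponent "\<lambda>x. conjexp (Pt x / r) / t" "conjexp (rb / r) / t" "conjexp (ra / r) / t" "\<lambda>x. (1 / vt x powr r) powr t"
    using t0 by (rule X3.bounded_vexponent_power)
  \<comment> \<open>After the first duality and the power \<open>t\<close>, the exponent is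
    \<open>\<delta> / (1 / r - 1 / Pt x)\<close>; its conjugate is
    \<open>\<delta> / (1 / Pt x - ?i)\<close>, which is \<open>q x\<close>.\<close>
  have cpt: "conjexp (y / r) / t = (1 / r - ?i) / (1 / r - 1 / y)" if "r < y" for y
  proof -
    have "1 / r - 1 / y \<noteq> 0" using that r by (simp add: field_simps)
    have "conjexp (y / r) = (1 / r) / (1 / r - 1 / y)" unfolding conjexp_def using that r by (simp add: field_simps)
    moreover have "1 / t = 1 - r * ?i" by (simp add: t_def)
    moreover have "(1 / r) * (1 - r * ?i) = 1 / r - ?i" using r by (simp add: field_simps)
    ultimately have "conjexp (y / r) * (1 / t) = (1 / r - ?i) / (1 / r - 1 / y)" by (metis times_divide_eq_left)
    then show ?thesis by simp
  qed
  \<comment> \<open>The last duality wants exponents uniformly above 1; this is where the gap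
    between the essential supremum of \<open>p\<close> and \<open>s\<close> enters.\<close>
  have "1 < conjexp (rb / r) / t"
  proof -
    have "0 < 1 / r - 1 / rb" using ra_inv rb_ra by linarith
    then show ?thesis using rb_s ra_r ra_rb by (subst cpt) auto
  qed
  from X4.like_vLp_koethe_dual[OF X4 this]
  have "like_vLp (rs_space r s (vLp p v)) (\<lambda>x. conjexp (conjexp (Pt x / r) / t)) (\<lambda>x. 1 / (1 / vt x powr r) powr t)"
    unfolding rs_space_def t_def .
  moreover have "(\<lambda>x. conjexp (conjexp (Pt x / r) / t)) = q"
  proof
    fix x
    define y where "y = 1 / r - 1 / Pt x"
    have y: "0 < y" "1 / Pt x - ?i = \<delta> - y" unfolding y_def \<delta>_def using ord[of x] ra_inv by auto
    have dy: "0 < \<delta> - y" using gap(1)[of x] y by simp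
    have "conjexp (Pt x / r) / t = \<delta> / y" using Ptb(1)[of x] ra_r by (subst cpt) (auto simp: \<delta>_def y_def)
    moreover have "conjexp (\<delta> / y) = \<delta> / (\<delta> - y)" unfolding conjexp_def using y dy by (simp add: field_simps)
    ultimately show "conjexp (conjexp (Pt x / r) / t) = q x" unfolding q_def y(2) by simp
  qed
  moreover have "(\<lambda>x. 1 / (1 / vt x powr r) powr t) = w"
  proof
    fix x
    have "r * t = 1 / \<delta>" unfolding t_def \<delta>_def using r r_rs by (simp add: field_simps)
    then show "1 / (1 / vt x powr r) powr t = w x"
      unfolding w_def using vt0[of x] by (simp add: powr_divide powr_powr)
  qed
  ultimately have Z: "like_vLp (rs_space r s (vLp p v)) q w" by simp
  interpret B: bounded_vexponent q lo hi w
    using lo1 qb w0 by unfold_locales auto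
  interpret dual: A_weight "\<lambda>x. conjexp (q x)" N "conjexp qi" "conjexp hi" "conjexp lo" "CL / (lo - 1)\<^sup>2" "\<lambda>x. 1 / w x" mu lam CA
    by (rule A_weight_dual)
  have "like_vLp (koethe_dual (rs_space r s (vLp p v))) (\<lambda>x. conjexp (q x)) (\<lambda>x. 1 / w x)"
    using Z lo1 by (rule B.like_vLp_koethe_dual)
  then show ?thesis using maximal_bounded_like_vLp[OF Z] dual.maximal_bounded_like_vLp by blast
qed

end
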